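(* Let $A$ be a finite-dimensional formally real Jordan algebra with unit $u$ and rank $r$, and $T_u=\{w\in A:\mathrm{tr}\,w=0\}$ with the variation norm $|w|_u=\max\sigma(w)-\min\sigma(w)$. The horofunctions of $(T_u,|\cdot|_u)$ (basepoint $0$) are precisely the functions $g\colon T_u\to\mathbb{R}$ of the form $$g(v)=\Lambda_{A(p_I)}\Big(-U_{p_I}v-\sum_{i\in I}\alpha_ip_i\Big)+\Lambda_{A(p_J)}\Big(U_{p_J}v-\sum_{j\in J}\alpha_jp_j\Big),$$ where $p_1,\dots,p_r$ is a Jordan frame, $I,J\subseteq\{1,\dots,r\}$ are disjoint and nonempty, $p_I=\sum_{i\in I}p_i$, $p_J=\sum_{j\in J}p_j$, and $\alpha\in\mathbb{R}^{I\cup J}$ with $\min_{i\in I}\alpha_i=0=\min_{j\in J}\alpha_j$. Each horofunction is a Busemann point.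
   Context: $A$: finite-dimensional real vector space with commutative bilinear product $\bullet$ satisfying $x^2\bullet(x\bullet y)=x\bullet(x^2\bullet y)$, formally real, unit $u$; $x\le y$ iff $y-x\in\{a^2:a\in A\}$. Spectral decomposition $x=\sum_{i=1}^r\lambda_ip_i$ over a Jordan frame (mutually orthogonal primitive idempotents summing to $u$); $\sigma(x)=\{\lambda_i\}$, $\mathrm{tr}\,x=\sum\lambda_i$. $U_pv=2p\bullet(p\bullet v)-p^2\bullet v$, $A(p)=U_p(A)$, $\Lambda_{A(p)}(z)=\inf\{\lambda:z\le\lambda p\}$ for $z\in A(p)$. For $w\in T_u$, $g_w(v)=|v-w|_u-|w|_u$; horofunctions are points of the pointwise closure of $\{g_w\}$ in $\mathbb{R}^{T_u}$ not of the form $g_w$. An almost geodesic is a path $\gamma\colon T\to T_u$, $T\subseteq[0,\infty)$ unbounded, $0\in T$, such that for every $\varepsilon>0$ there is $N$ with $\big||\gamma(t)-\gamma(s)|_u+|\gamma(s)-\gamma(0)|_u-t\big|<\varepsilon$ for $t\ge s\ge N$; a Busemann point is a horofunction that is the limit of $g_{\gamma(t)}$ along an almost geodesic. *)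

theory Defs
  imports "HOL-Analysis.Analysis"
begin

definition jordan_algebra :: "('a::euclidean_space \<Rightarrow> 'a \<Rightarrow> 'a) \<Rightarrow> 'a \<Rightarrow> bool" where
  "jordan_algebra m u \<longleftrightarrow>
     bilinear m \<and>
     (\<forall>x y. m x y = m y x) \<and>
     (\<forall>x y. m (m x x) (m x y) = m x (m (m x x) y)) \<and>
     (\<forall>(n::nat) x. (\<Sum>i<n. m (x i) (x i)) = 0 \<longrightarrow> (\<forall>i<n. x i = 0)) \<and>
     (\<forall>x. m u x = x)"

definition jle :: "('a::euclidean_space \<Rightarrow> 'a \<Rightarrow> 'a) \<Rightarrow> 'a \<Rightarrow> 'a \<Rightarrow> bool" where
  "jle m x y \<longleftrightarrow> (\<exists>a. y - x = m a a)"

definition idempotent :: "('a::euclidean_space \<Rightarrow> 'a \<Rightarrow> 'a) \<Rightarrow> 'a \<Rightarrow> bool" where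
  "idempotent m p \<longleftrightarrow> m p p = p"

definition primitive_idempotent :: "('a::euclidean_space \<Rightarrow> 'a \<Rightarrow> 'a) \<Rightarrow> 'a \<Rightarrow> bool" where
  "primitive_idempotent m p \<longleftrightarrow> idempotent m p \<and> p \<noteq> 0 \<and>
     \<not> (\<exists>q r. idempotent m q \<and> idempotent m r \<and> q \<noteq> 0 \<and> r \<noteq> 0 \<and> m q r = 0 \<and> p = q + r)"

definition jordan_frame :: "('a::euclidean_space \<Rightarrow> 'a \<Rightarrow> 'a) \<Rightarrow> 'a \<Rightarrow> nat \<Rightarrow> (nat \<Rightarrow> 'a) \<Rightarrow> bool" where
  "jordan_frame m u n p \<longleftrightarrow>
     (\<forall>i<n. primitive_idempotent m (p i)) \<and>
     (\<forall>i<n. \<forall>j<n. i \<noteq> j \<longrightarrow> m (p i) (p j) = 0) \<and>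
     (\<Sum>i<n. p i) = u"

definition jspectrum :: "('a::euclidean_space \<Rightarrow> 'a \<Rightarrow> 'a) \<Rightarrow> 'a \<Rightarrow> 'a \<Rightarrow> real set" where
  "jspectrum m u x = {l. \<exists>n p c. jordan_frame m u n p \<and> x = (\<Sum>i<n. c i *\<^sub>R p i) \<and>
                                 (\<exists>i<n. c i = l)}"

definition jtrace :: "('a::euclidean_space \<Rightarrow> 'a \<Rightarrow> 'a) \<Rightarrow> 'a \<Rightarrow> 'a \<Rightarrow> real" where
  "jtrace m u x = (SOME t. \<exists>n p c. jordan_frame m u n p \<and> x = (\<Sum>i<n. c i *\<^sub>R p i) \<and>
                                   t = (\<Sum>i<n. c i))"

definition Tu :: "('a::euclidean_space \<Rightarrow> 'a \<Rightarrow> 'a) \<Rightarrow> 'a \<Rightarrow> 'a set" where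
  "Tu m u = {w. jtrace m u w = 0}"

definition varnorm :: "('a::euclidean_space \<Rightarrow> 'a \<Rightarrow> 'a) \<Rightarrow> 'a \<Rightarrow> 'a \<Rightarrow> real" where
  "varnorm m u w = Max (jspectrum m u w) - Min (jspectrum m u w)"

definition Uop :: "('a::euclidean_space \<Rightarrow> 'a \<Rightarrow> 'a) \<Rightarrow> 'a \<Rightarrow> 'a \<Rightarrow> 'a" where
  "Uop m p v = 2 *\<^sub>R m p (m p v) - m (m p p) v"

text \<open>Lambda_{A(p)}(z) = inf { lambda. z \<le> lambda p } (for z in A(p) = U_p(A)).\<close>
definition jLambda :: "('a::euclidean_space \<Rightarrow> 'a \<Rightarrow> 'a) \<Rightarrow> 'a \<Rightarrow> 'a \<Rightarrow> real" where
  "jLambda m p z = Inf {l::real. jle m z (l *\<^sub>R p)}"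

definition gfun :: "('a::euclidean_space \<Rightarrow> 'a \<Rightarrow> 'a) \<Rightarrow> 'a \<Rightarrow> 'a \<Rightarrow> 'a \<Rightarrow> real" where
  "gfun m u w v = varnorm m u (v - w) - varnorm m u w"

text \<open>Horofunctions: points of the closure of {g_w | w in T_u} in the topology of pointwise
  convergence on T_u (product topology on functions, restricted to T_u), not of the form g_w.\<close>
definition horofunction :: "('a::euclidean_space \<Rightarrow> 'a \<Rightarrow> 'a) \<Rightarrow> 'a \<Rightarrow> ('a \<Rightarrow> real) \<Rightarrow> bool" where
  "horofunction m u h \<longleftrightarrow>
     restrict h (Tu m u) \<in> closure ((\<lambda>w. restrict (gfun m u w) (Tu m u)) ` Tu m u) \<and>
     restrict h (Tu m u) \<notin> (\<lambda>w. restrict (gfun m u w) (Tu m u)) ` Tu m u"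

definition almost_geodesic :: "('a::euclidean_space \<Rightarrow> 'a \<Rightarrow> 'a) \<Rightarrow> 'a \<Rightarrow> real set \<Rightarrow> (real \<Rightarrow> 'a) \<Rightarrow> bool" where
  "almost_geodesic m u T \<gamma> \<longleftrightarrow>
     T \<subseteq> {0..} \<and> \<not> bdd_above T \<and> 0 \<in> T \<and> \<gamma> ` T \<subseteq> Tu m u \<and>
     (\<forall>\<epsilon>>0. \<exists>N. \<forall>t\<in>T. \<forall>s\<in>T. t \<ge> s \<and> s \<ge> N \<longrightarrow>
        \<bar>varnorm m u (\<gamma> t - \<gamma> s) + varnorm m u (\<gamma> s - \<gamma> 0) - t\<bar> < \<epsilon>)"

definition busemann_point :: "('a::euclidean_space \<Rightarrow> 'a \<Rightarrow> 'a) \<Rightarrow> 'a \<Rightarrow> ('a \<Rightarrow> real) \<Rightarrow> bool" where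
  "busemann_point m u h \<longleftrightarrow> horofunction m u h \<and>
     (\<exists>T \<gamma>. almost_geodesic m u T \<gamma> \<and>
        (\<forall>v\<in>Tu m u. ((\<lambda>t. gfun m u (\<gamma> t) v) \<longlongrightarrow> h v) (inf at_top (principal T))))"

end

theory Submission
  imports Defs "HOL-Computational_Algebra.Fundamental_Theorem_Algebra"
begin

text \<open>
  The trace form \<open>tau x y = Tr L(x \<bullet> y)\<close> is associative and positive definite, so the cone of
  squares is closed, convex and self-dual. Hence \<open>\<Lambda>\<^bsub>A(p)\<^esub>(z)\<close> is the maximum of \<open>tau y z\<close> over
  the compact set of states \<open>y\<close> supported on \<open>p\<close>, and \<open>|w|\<^sub>u = \<Lambda>(w) + \<Lambda>(-w)\<close>.

  If the functions \<open>g\<close> of \<open>w\<^sub>k\<close> converge to a horofunction, pass to a subsequence along which the Jordan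
  frames of the \<open>w\<^sub>k\<close> converge and the distances of their eigenvalues to the largest and to the
  smallest one converge in \<open>[0,\<infinity>]\<close>; \<open>I\<close> and \<open>J\<close> are the indices with finite limits \<open>\<alpha>\<close>. Conversely
  the stated functions are the limits along the unit speed geodesic
  \<open>t \<mapsto> (t/2) (p\<^sub>I - p\<^sub>J) - \<Sum>\<^sub>I \<alpha>\<^sub>i p\<^sub>i + \<Sum>\<^sub>J \<alpha>\<^sub>j p\<^sub>j\<close>, on which they are unbounded below.

  Of the hyperplane \<open>T\<^sub>u\<close> only one property matters, as everything is invariant under adding multiples
  of \<open>u\<close>: every element can be translated into \<open>T\<^sub>u\<close>. This needs the trace to be well defined, that
  is, all Jordan frames to have the same size.
\<close>

section \<open>Traces of operators\<close>

text \<open>\<open>jtrace\<close> cannot supply the inner product: it is a choice among frames, and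
  its independence of the choice rests on the equality of frame sizes, whose proof already uses
  compactness of the set of idempotents. The trace of multiplication operators is available from the
  start. Its price is that \<open>tau c u\<close> may differ between primitive idempotents c; hence
  states are normalized by \<open>tau y u = 1\<close>, and coefficients are read off as quotients by
  \<open>tau c u\<close>, which is at least 1.

  Neither frames nor maximizing states are unique, so they cannot be chosen continuously;
  compactness replaces continuity. What makes limits of states usable is that
  \<open>tau y c = 0\<close> forces \<open>y \<odot> c = 0\<close> for y in the cone and c
  idempotent: vanishing weights become membership in a Peirce space.

  The pointwise topology is not first countable in general, so it is a separate point that a
  horofunction is the limit of a sequence. It holds because all functions \<open>gfun m u w\<close>
  are 1-Lipschitz for the variation norm.\<close>

definition optrace :: "('a::euclidean_space \<Rightarrow> 'a) \<Rightarrow> real" where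
  "optrace f = (\<Sum>b\<in>Basis. f b \<bullet> b)"

lemma optrace_add: "optrace (\<lambda>x. f x + g x) = optrace f + optrace g"
  by (simp add: optrace_def inner_add_left sum.distrib)

lemma optrace_diff: "optrace (\<lambda>x. f x - g x) = optrace f - optrace g"
  by (simp add: optrace_def inner_diff_left sum_subtractf)

lemma optrace_scaleR: "optrace (\<lambda>x. c *\<^sub>R f x) = c * optrace f"
  by (simp add: optrace_def sum_distrib_left)

lemma optrace_comp_commute:
  fixes f g :: "'a::euclidean_space \<Rightarrow> 'a"
  assumes "linear f" "linear g"
  shows "optrace (\<lambda>x. f (g x)) = optrace (\<lambda>x. g (f x))"
proof -
  have expand: "h (k b) \<bullet> b = (\<Sum>c\<in>Basis. (k b \<bullet> c) * (h c \<bullet> b))" if "linear h"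
    for h k :: "'a \<Rightarrow> 'a" and b
  proof -
    have "h (k b) = h (\<Sum>c\<in>Basis. (k b \<bullet> c) *\<^sub>R c)"
      by (simp add: euclidean_representation)
    then show ?thesis
      by (simp add: linear_sum[OF that] linear_cmul[OF that] inner_sum_left)
  qed
  have "optrace (\<lambda>x. f (g x)) = (\<Sum>b\<in>Basis. \<Sum>c\<in>Basis. (g b \<bullet> c) * (f c \<bullet> b))"
    unfolding optrace_def by (simp add: expand[OF assms(1)])
  also have "\<dots> = (\<Sum>c\<in>Basis. \<Sum>b\<in>Basis. (f c \<bullet> b) * (g b \<bullet> c))"
    by (subst sum.swap) (simp add: mult.commute)
  also have "\<dots> = optrace (\<lambda>x. g (f x))"
    unfolding optrace_def by (simp add: expand[OF assms(2)])
  finally show ?thesis .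
qed

text \<open>Expanding each \<open>P e\<close> in an orthonormal basis B of the range and exchanging
  the sums turns the trace into the sum of \<open>P b \<bullet> b\<close> over B, and P fixes B. The
  projection may be oblique, as Peirce projections can be for the ambient inner product.\<close>

lemma optrace_projection:
  fixes P :: "'a::euclidean_space \<Rightarrow> 'a"
  assumes P: "linear P" and idem: "\<And>x. P (P x) = P x"
  shows "optrace P = dim (range P)"
proof -
  have subspace: "subspace (range P)"
    using P by (simp add: linear_subspace_image)
  obtain B where B: "B \<subseteq> range P" "pairwise orthogonal B" "\<And>x. x \<in> B \<Longrightarrow> norm x = 1"
      "independent B" "card B = dim (range P)" "span B = range P"
    using orthonormal_basis_subspace[OF subspace] by metis
  have fin: "finite B" using B(4) independent_imp_finite by blast
  have ortho: "a \<bullet> b = (if a = b then 1 else 0)" if "a \<in> B" "b \<in> B" for a b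
    using B(2,3) that by (auto simp: pairwise_def orthogonal_def norm_eq_1)
  have expand: "y = (\<Sum>b\<in>B. (y \<bullet> b) *\<^sub>R b)" if "y \<in> span B" for y
    using that
  proof (induction rule: span_induct_alt)
    case base then show ?case by simp
  next
    case (step c x y)
    have "(\<Sum>b\<in>B. ((c *\<^sub>R x + y) \<bullet> b) *\<^sub>R b)
        = c *\<^sub>R (\<Sum>b\<in>B. (x \<bullet> b) *\<^sub>R b) + (\<Sum>b\<in>B. (y \<bullet> b) *\<^sub>R b)"
      by (simp add: inner_add_left scaleR_add_left sum.distrib scaleR_sum_right)
    also have "(\<Sum>b\<in>B. (x \<bullet> b) *\<^sub>R b) = (\<Sum>b\<in>B. if b = x then x else 0)"
      using ortho step(1) by (intro sum.cong) auto
    also have "\<dots> = x" using fin step(1) by simp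
    finally show ?case using step by simp
  qed
  have fixed: "P b = b" if "b \<in> B" for b using B(1) that idem by auto
  have "optrace P = (\<Sum>e\<in>Basis. (\<Sum>b\<in>B. (P e \<bullet> b) *\<^sub>R b) \<bullet> e)"
    unfolding optrace_def using expand B(6) by (metis (no_types, lifting) rangeI sum.cong)
  also have "\<dots> = (\<Sum>e\<in>Basis. \<Sum>b\<in>B. (b \<bullet> e) * (P e \<bullet> b))"
    by (simp add: inner_sum_left mult.commute)
  also have "\<dots> = (\<Sum>b\<in>B. \<Sum>e\<in>Basis. (b \<bullet> e) * (P e \<bullet> b))"
    by (rule sum.swap)
  also have "\<dots> = (\<Sum>b\<in>B. P (\<Sum>e\<in>Basis. (b \<bullet> e) *\<^sub>R e) \<bullet> b)"
    by (simp add: linear_sum[OF P] linear_cmul[OF P] inner_sum_left)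
  also have "\<dots> = (\<Sum>b\<in>B. b \<bullet> b)"
    using fixed by (simp add: euclidean_representation)
  also have "\<dots> = card B" using ortho by simp
  finally show ?thesis using B(5) by simp
qed

text \<open>The divisor is the minimal polynomial of z over the reals: the remainder is real, of
  degree at most 1, and has the nonreal root z, so it is zero.\<close>

lemma quadratic_dvd_poly:
  fixes r :: "real poly"
  assumes "poly (map_poly complex_of_real r) z = 0" "Im z \<noteq> 0"
  shows "[:(Re z)\<^sup>2 + (Im z)\<^sup>2, - 2 * Re z, 1:] dvd r"
proof -
  let ?d = "[:(Re z)\<^sup>2 + (Im z)\<^sup>2, - 2 * Re z, 1:]"
  let ?r = "r mod ?d"
  have hom: "poly (map_poly complex_of_real (p * q + s)) z
      = poly (map_poly complex_of_real p) z * poly (map_poly complex_of_real q) z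
        + poly (map_poly complex_of_real s) z" for p q s
  proof -
    have add: "poly (map_poly complex_of_real (p + q)) z
        = poly (map_poly complex_of_real p) z + poly (map_poly complex_of_real q) z" for p q
      by (induction p q rule: poly_induct2) (simp_all add: map_poly_pCons algebra_simps)
    have smult: "poly (map_poly complex_of_real (smult c p)) z
        = c * poly (map_poly complex_of_real p) z" for c p
      by (induction p) (simp_all add: map_poly_pCons algebra_simps)
    have "poly (map_poly complex_of_real (p * q)) z
        = poly (map_poly complex_of_real p) z * poly (map_poly complex_of_real q) z" for p q
      by (induction p) (simp_all add: add smult map_poly_pCons algebra_simps)
    then show ?thesis by (simp add: add)
  qed
  have "poly (map_poly complex_of_real ?d) z = 0"
    by (simp add: map_poly_pCons complex_eq_iff power2_eq_square algebra_simps)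
  with hom[of ?d "r div ?d" ?r] assms(1) have root: "poly (map_poly complex_of_real ?r) z = 0"
    by (simp only: mult_div_mod_eq mult_zero_left add_0_left)
  have "degree ?r < 2"
    using degree_mod_less'[of ?d r] by (cases "?r = 0") auto
  then have "?r = [:coeff ?r 0, coeff ?r 1:]"
    by (intro poly_eqI) (auto simp: coeff_pCons coeff_eq_0 split: nat.splits)
  then obtain a b where ab: "?r = [:a, b:]" by blast
  with root have "b = 0" "a = 0"
    using assms(2) by (auto simp: map_poly_pCons complex_eq_iff)
  with ab show ?thesis by (simp add: mod_eq_0_iff_dvd)
qed

section \<open>Jordan identities and power associativity\<close>

locale formally_real_jordan_algebra =
  fixes m :: "'a::euclidean_space \<Rightarrow> 'a \<Rightarrow> 'a" (infixl "\<odot>" 70) and u :: 'a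
  assumes jordan_algebra: "jordan_algebra m u"
begin

lemma bilinear_mult: "bilinear m"
  and mult_commute: "x \<odot> y = y \<odot> x"
  and jordan_identity: "(x \<odot> x) \<odot> (x \<odot> y) = x \<odot> ((x \<odot> x) \<odot> y)"
  and unit_left [simp]: "u \<odot> x = x"
  and sum_squares_zero: "(\<Sum>i<(n::nat). f i \<odot> f i) = 0 \<Longrightarrow> i < n \<Longrightarrow> f i = 0"
  using jordan_algebra unfolding jordan_algebra_def by blast+

lemma unit_right [simp]: "x \<odot> u = x"
  using mult_commute unit_left by metis

lemma bounded_bilinear_mult: "bounded_bilinear m"
  using bilinear_mult by (simp add: bilinear_conv_bounded_bilinear)

lemmas tendsto_mult_jordan [tendsto_intros] = bounded_bilinear.tendsto[OF bounded_bilinear_mult]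

lemma linear_mult: "linear (m x)"
  using bilinear_mult by (simp add: bilinear_def)

lemma linear_mult_left: "linear (\<lambda>x. x \<odot> y)"
  using bilinear_mult by (simp add: bilinear_def)

lemmas mult_distribs =
  linear_add[OF linear_mult] linear_add[OF linear_mult_left]
  linear_diff[OF linear_mult] linear_diff[OF linear_mult_left]
  linear_cmul[OF linear_mult] linear_cmul[OF linear_mult_left]
  linear_neg[OF linear_mult] linear_neg[OF linear_mult_left]

lemmas mult_zero [simp] = linear_0[OF linear_mult] linear_0[OF linear_mult_left]

lemma mult_sum_right: "x \<odot> (\<Sum>i\<in>I. f i) = (\<Sum>i\<in>I. x \<odot> f i)"
  by (rule linear_sum[OF linear_mult])

lemma mult_sum_left: "(\<Sum>i\<in>I. f i) \<odot> x = (\<Sum>i\<in>I. f i \<odot> x)"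
  using linear_sum[OF linear_mult_left] by fast

lemma square_sum_zeroD:
  assumes "x \<odot> x + y \<odot> y = 0" shows "x = 0"
proof -
  have "(\<Sum>i<(2::nat). (if i = 0 then x else y) \<odot> (if i = 0 then x else y)) = 0"
    using assms by (simp add: numeral_2_eq_2)
  from sum_squares_zero[OF this, of 0] show ?thesis by simp
qed

lemma square_zeroD: "x \<odot> x = 0 \<Longrightarrow> x = 0"
  using square_sum_zeroD[of x 0] by simp

lemma unit_nonzero: "u \<noteq> 0"
proof
  assume "u = 0"
  then have "x = 0" for x :: 'a using unit_left[of x] by simp
  then show False using nonempty_Basis nonzero_Basis by blast
qed

text \<open>Polarization: the difference of the Jordan identity at \<open>x + z\<close> and at
  \<open>x - z\<close> is twice its part of odd degree in z, and the cubic part goes away with the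
  identity for z itself. Pairing with b leaves linear arithmetic over the reals.\<close>

lemma jordan_linearized:
  "2 *\<^sub>R ((x \<odot> z) \<odot> (x \<odot> y)) + (x \<odot> x) \<odot> (z \<odot> y) = z \<odot> ((x \<odot> x) \<odot> y) + 2 *\<^sub>R (x \<odot> ((x \<odot> z) \<odot> y))"
  (is "?l = ?r")
proof (rule euclidean_eqI)
  fix b :: 'a
  have zx: "z \<odot> x = x \<odot> z" by (rule mult_commute)
  have "?l \<bullet> b + ?l \<bullet> b = ?r \<bullet> b + ?r \<bullet> b"
    using jordan_identity[of "x + z" y, THEN arg_cong[of _ _ "\<lambda>v. v \<bullet> b"]]
      jordan_identity[of "x - z" y, THEN arg_cong[of _ _ "\<lambda>v. v \<bullet> b"]]
      jordan_identity[of "z" y, THEN arg_cong[of _ _ "\<lambda>v. v \<bullet> b"]]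
    by (simp add: mult_distribs inner_simps zx)
  then show "?l \<bullet> b = ?r \<bullet> b" by simp
qed

text \<open>The previous identity is quadratic in x; polarizing it with \<open>x + w\<close> gives
  twice the claim.\<close>

lemma jordan_fully_linearized:
  "(x \<odot> z) \<odot> (w \<odot> y) + (w \<odot> z) \<odot> (x \<odot> y) + (x \<odot> w) \<odot> (z \<odot> y)
    = z \<odot> ((x \<odot> w) \<odot> y) + x \<odot> ((w \<odot> z) \<odot> y) + w \<odot> ((x \<odot> z) \<odot> y)"
  (is "?l = ?r")
proof (rule euclidean_eqI)
  fix b :: 'a
  have wx: "w \<odot> x = x \<odot> w" by (rule mult_commute)
  show "?l \<bullet> b = ?r \<bullet> b"
    using jordan_linearized[of "x + w" z y, THEN arg_cong[of _ _ "\<lambda>v. v \<bullet> b"]]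
      jordan_linearized[of x z y, THEN arg_cong[of _ _ "\<lambda>v. v \<bullet> b"]]
      jordan_linearized[of w z y, THEN arg_cong[of _ _ "\<lambda>v. v \<bullet> b"]]
    by (simp add: mult_distribs inner_simps wx)
qed

text \<open>Read as an identity of operators on z, this expresses multiplication by
  \<open>(x \<odot> x) \<odot> y\<close> through multiplications by x, y, \<open>x \<odot> x\<close>
  and \<open>x \<odot> y\<close>. It drives the induction on powers and yields the cubic equation of
  an idempotent.\<close>

lemma mult_square_mult:
  "((x \<odot> x) \<odot> y) \<odot> z = 2 *\<^sub>R ((x \<odot> y) \<odot> (x \<odot> z)) + (x \<odot> x) \<odot> (y \<odot> z) - 2 *\<^sub>R (x \<odot> (y \<odot> (x \<odot> z)))"
proof -
  have "2 *\<^sub>R ((x \<odot> z) \<odot> (x \<odot> y)) + (x \<odot> x) \<odot> (z \<odot> y)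
      = ((x \<odot> x) \<odot> y) \<odot> z + 2 *\<^sub>R (x \<odot> (y \<odot> (x \<odot> z)))"
    using jordan_linearized[of x z y] mult_commute by metis
  then show ?thesis
    using mult_commute[of "x \<odot> z" "x \<odot> y"] mult_commute[of z y] by (simp add: algebra_simps)
qed

text \<open>With L for multiplication operators, the right side is the double commutator
  [[L y, L x], L w] applied to z. This is what makes the trace form associative.\<close>

lemma mult_difference:
  "((x \<odot> w) \<odot> y) \<odot> z - (x \<odot> (w \<odot> y)) \<odot> z
    = (y \<odot> (x \<odot> (w \<odot> z)) - x \<odot> (y \<odot> (w \<odot> z))) - (w \<odot> (y \<odot> (x \<odot> z)) - w \<odot> (x \<odot> (y \<odot> z)))"
proof -
  \<comment> \<open>The fully linearized identity, solved for multiplication by a triple product.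
    Its first three terms are symmetric in x, w and y, so they cancel in the difference of two
    instances.\<close>
  have *: "((x \<odot> w) \<odot> y) \<odot> z = (w \<odot> y) \<odot> (x \<odot> z) + (x \<odot> y) \<odot> (w \<odot> z) + (x \<odot> w) \<odot> (y \<odot> z)
      - x \<odot> (y \<odot> (w \<odot> z)) - w \<odot> (y \<odot> (x \<odot> z))" for x w y
  proof -
    have "(w \<odot> y) \<odot> (x \<odot> z) + (x \<odot> y) \<odot> (w \<odot> z) + (x \<odot> w) \<odot> (y \<odot> z)
        = ((x \<odot> w) \<odot> y) \<odot> z + x \<odot> (y \<odot> (w \<odot> z)) + w \<odot> (y \<odot> (x \<odot> z))"
      using jordan_fully_linearized[of x z w y] mult_commute
      by (smt (verit, best))
    then show ?thesis by (simp add: algebra_simps)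
  qed
  have "(x \<odot> (w \<odot> y)) \<odot> z = ((y \<odot> w) \<odot> x) \<odot> z"
    by (metis mult_commute)
  then show ?thesis
    unfolding *[of y w x] *[of x w y] using mult_commute[of w x] mult_commute[of w y] mult_commute[of x y]
    by (simp add: algebra_simps)
qed

section \<open>Powers and polynomials in one element\<close>

fun jpow :: "'a \<Rightarrow> nat \<Rightarrow> 'a" where
  "jpow x 0 = u"
| "jpow x (Suc n) = x \<odot> jpow x n"

text \<open>Horner's scheme multiplies by x only, so evaluation makes sense before powers are known
  to associate.\<close>

definition ev :: "'a \<Rightarrow> real poly \<Rightarrow> 'a" where
  "ev x p = fold_coeffs (\<lambda>a v. a *\<^sub>R u + x \<odot> v) p 0"

lemma ev_0 [simp]: "ev x 0 = 0"
  by (simp add: ev_def)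

lemma ev_pCons [simp]: "ev x (pCons a p) = a *\<^sub>R u + x \<odot> ev x p"
  by (cases "p = 0 \<and> a = 0") (auto simp: ev_def)

lemma ev_1 [simp]: "ev x 1 = u"
  by (simp add: one_pCons)

lemma ev_add: "ev x (p + q) = ev x p + ev x q"
  by (induction p q rule: poly_induct2) (simp_all add: mult_distribs scaleR_add_left)

lemma ev_smult: "ev x (smult c p) = c *\<^sub>R ev x p"
  by (induction p) (simp_all add: mult_distribs scaleR_add_right)

lemma ev_diff: "ev x (p - q) = ev x p - ev x q"
  using ev_add[of x "p - q" q] by simp

lemma ev_sum: "ev x (\<Sum>i\<in>I. f i) = (\<Sum>i\<in>I. ev x (f i))"
  by (induction I rule: infinite_finite_induct) (simp_all add: ev_add)

lemma ev_monom: "ev x (monom c n) = c *\<^sub>R jpow x n"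
  by (induction n) (simp_all add: monom_0 monom_Suc mult_distribs)

lemma ev_in_span_jpow: "ev x p \<in> span (range (jpow x))"
proof (induction p)
  case (pCons a p)
  have "x \<odot> v \<in> span (range (jpow x))" if "v \<in> span (range (jpow x))" for v
    using that
  proof (induction rule: span_induct_alt)
    case base then show ?case by (simp add: span_zero)
  next
    case (step c w v)
    then obtain n where "w = jpow x n" by auto
    then have "x \<odot> w \<in> range (jpow x)" by (metis jpow.simps(2) rangeI)
    then show ?case using step by (simp add: mult_distribs span_add span_scale span_base)
  qed
  moreover have "u \<in> span (range (jpow x))"
    by (rule span_base) (metis jpow.simps(1) rangeI)
  ultimately show ?case using pCons by (simp add: span_add span_scale)
qed (simp add: span_zero)

lemma square_mult_jpow: "(x \<odot> x) \<odot> jpow x n = jpow x (n + 2)"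
proof (induction n)
  case (Suc n)
  then show ?case using jordan_identity[of x "jpow x n"] by simp
qed simp

text \<open>Since \<open>jpow x (k + 2)\<close> is \<open>(x \<odot> x) \<odot> jpow x k\<close>,
  the operator identity \<open>mult_square_mult\<close> builds multiplication by it from
  multiplications by x, \<open>x \<odot> x\<close> and two lower powers, with which T commutes
  already. Used with T the multiplication by x, where the last hypothesis is the Jordan
  identity.\<close>

lemma jpow_commutes:
  assumes T: "linear T" "\<And>z. T (x \<odot> z) = x \<odot> T z" "\<And>z. T ((x \<odot> x) \<odot> z) = (x \<odot> x) \<odot> T z"
  shows "T (jpow x n \<odot> z) = jpow x n \<odot> T z"
proof (induction n arbitrary: z rule: less_induct)
  case (less n)
  consider "n = 0" | "n = 1" | k where "n = k + 2"
    by (metis One_nat_def add_2_eq_Suc' not0_implies_Suc)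
  then show ?case
  proof cases
    case 3
    have "T (((x \<odot> x) \<odot> jpow x k) \<odot> z) = ((x \<odot> x) \<odot> jpow x k) \<odot> T z"
      unfolding mult_square_mult[of x "jpow x k"]
      using less[of k] less[of "Suc k"] 3 T
      by (simp add: linear_add[OF T(1)] linear_diff[OF T(1)] linear_cmul[OF T(1)])
    then show ?thesis using 3 square_mult_jpow by simp
  qed (auto simp: T)
qed

lemma mult_ev_commute: "x \<odot> (ev x p \<odot> z) = ev x p \<odot> (x \<odot> z)"
proof -
  have "x \<odot> (v \<odot> z) = v \<odot> (x \<odot> z)" if "v \<in> span (range (jpow x))" for v
    using that
  proof (induction rule: span_induct_alt)
    case (step c w v)
    then obtain n where w: "w = jpow x n" by auto
    have "x \<odot> (w \<odot> z) = w \<odot> (x \<odot> z)" unfolding w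
      by (rule jpow_commutes) (use jordan_identity in \<open>auto simp: linear_mult\<close>)
    with step show ?case by (simp add: mult_distribs)
  qed simp
  then show ?thesis using ev_in_span_jpow by blast
qed

text \<open>Power associativity. Multiplication by x commutes with multiplication by a polynomial in
  x, so the factor x can be moved across a product.\<close>

lemma ev_mult: "ev x (p * q) = ev x p \<odot> ev x q"
proof (induction p)
  case (pCons a p)
  have "x \<odot> (ev x p \<odot> ev x q) = (x \<odot> ev x p) \<odot> ev x q"
    using mult_ev_commute[of x q "ev x p"] mult_commute by metis
  with pCons show ?case by (simp add: ev_add ev_smult mult_distribs)
qed simp

lemma ev_degree_less_sum:
  assumes "degree p < n" shows "ev x p = (\<Sum>i<n. coeff p i *\<^sub>R jpow x i)"
proof -
  have "p = (\<Sum>i<n. monom (coeff p i) i)"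
    using assms by (intro poly_eqI) (auto simp: coeff_sum coeff_eq_0 if_distrib[of "\<lambda>f. f _"] sum.delta cong: if_cong)
  then show ?thesis by (metis (no_types, lifting) ev_monom ev_sum sum.cong)
qed

text \<open>Linear dependence is a property of the set of powers, in which equal powers collapse;
  two equal powers are treated separately and give a difference of monomials.\<close>

lemma annihilating_poly: "\<exists>p. p \<noteq> 0 \<and> ev x p = 0"
proof (cases "inj_on (jpow x) {..DIM('a)}")
  case True
  then have "dependent (jpow x ` {..DIM('a)})"
    by (intro dependent_biggerset) (auto simp: card_image)
  then obtain c where c: "(\<Sum>v\<in>jpow x ` {..DIM('a)}. c v *\<^sub>R v) = 0" "\<exists>v\<in>jpow x ` {..DIM('a)}. c v \<noteq> 0"
    by (auto simp: dependent_finite)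
  let ?p = "\<Sum>i\<le>DIM('a). monom (c (jpow x i)) i"
  have "ev x ?p = 0"
    using c(1) True by (simp add: ev_sum ev_monom sum.reindex)
  moreover from c(2) obtain i where "i \<le> DIM('a)" "c (jpow x i) \<noteq> 0" by auto
  then have "coeff ?p i \<noteq> 0" by (simp add: coeff_sum)
  ultimately show ?thesis by (metis coeff_0)
next
  case False
  then obtain i j where "i \<noteq> j" "jpow x i = jpow x j" by (auto simp: inj_on_def)
  then have "ev x (monom 1 i - monom 1 j) = 0" "coeff (monom 1 i - monom 1 j :: real poly) i \<noteq> 0"
    by (auto simp: ev_diff ev_monom)
  then show ?thesis by (metis coeff_0)
qed

end


section \<open>Spectral decomposition\<close>

lemma prod_linear_factors_dvd:
  fixes q :: "real poly"
  assumes "finite S" "\<And>a. a \<in> S \<Longrightarrow> poly q a = 0"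
  shows "(\<Prod>a\<in>S. [:- a, 1:]) dvd q"
  using assms
proof (induction S rule: finite_induct)
  case (insert a S)
  then obtain r where r: "q = (\<Prod>b\<in>S. [:- b, 1:]) * r" by (auto elim: dvdE)
  have "poly (\<Prod>b\<in>S. [:- b, 1:]) a \<noteq> 0"
    using insert by (auto simp: poly_prod)
  then have "poly r a = 0" using insert.prems[of a] r by simp
  then have "[:- a, 1:] dvd r" by (simp add: poly_eq_0_iff_dvd)
  then show ?case
    unfolding r prod.insert[OF insert.hyps] mult.commute[of _ r] by (intro mult_dvd_mono) auto
qed simp

lemma interpolating_poly:
  assumes "finite S"
  shows "\<exists>l :: real poly. poly l a = 1 \<and> (\<forall>b\<in>S. b \<noteq> a \<longrightarrow> poly l b = 0)"
proof -
  let ?l = "\<Prod>b\<in>S - {a}. [:- b, 1:]"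
  have "poly ?l a \<noteq> 0" "\<forall>b\<in>S - {a}. poly ?l b = 0"
    using assms by (auto simp: poly_prod)
  then have "poly (smult (1 / poly ?l a) ?l) a = 1 \<and> (\<forall>b\<in>S. b \<noteq> a \<longrightarrow> poly (smult (1 / poly ?l a) ?l) b = 0)"
    by auto
  then show ?thesis by blast
qed

context formally_real_jordan_algebra
begin

text \<open>A Jordan frame without primitivity and over any index type: eigenvalues, natural
  numbers, the idempotents themselves and a disjoint union all occur as indices below.\<close>

definition complete_system :: "'i set \<Rightarrow> ('i \<Rightarrow> 'a) \<Rightarrow> bool" where
  "complete_system I e \<longleftrightarrow> finite I \<and> (\<forall>i\<in>I. e i \<odot> e i = e i \<and> e i \<noteq> 0) \<and>
     (\<forall>i\<in>I. \<forall>j\<in>I. i \<noteq> j \<longrightarrow> e i \<odot> e j = 0) \<and> (\<Sum>i\<in>I. e i) = u"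

lemma complete_systemD:
  assumes "complete_system I e"
  shows "finite I" "i \<in> I \<Longrightarrow> e i \<odot> e i = e i" "i \<in> I \<Longrightarrow> e i \<noteq> 0"
    "i \<in> I \<Longrightarrow> j \<in> I \<Longrightarrow> i \<noteq> j \<Longrightarrow> e i \<odot> e j = 0" "(\<Sum>i\<in>I. e i) = u"
  using assms by (auto simp: complete_system_def)

lemma complete_system_mult:
  assumes "complete_system I e" "k \<in> I" "J \<subseteq> I"
  shows "e k \<odot> (\<Sum>i\<in>J. c i *\<^sub>R e i) = (if k \<in> J then c k *\<^sub>R e k else 0)"
proof -
  have "e k \<odot> (\<Sum>i\<in>J. c i *\<^sub>R e i) = (\<Sum>i\<in>J. if i = k then c k *\<^sub>R e k else 0)"
    unfolding mult_sum_right using assms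
    by (intro sum.cong) (auto simp: mult_distribs complete_systemD)
  then show ?thesis
    using finite_subset[OF assms(3)] complete_systemD(1)[OF assms(1)] by simp
qed

lemma complete_system_mult_sums:
  assumes "complete_system I e" "J \<subseteq> I" "K \<subseteq> I"
  shows "(\<Sum>i\<in>J. c i *\<^sub>R e i) \<odot> (\<Sum>i\<in>K. d i *\<^sub>R e i) = (\<Sum>i\<in>J \<inter> K. (c i * d i) *\<^sub>R e i)"
proof -
  have fin: "finite J" using assms complete_systemD(1) finite_subset by blast
  have "(\<Sum>i\<in>J. c i *\<^sub>R e i) \<odot> (\<Sum>i\<in>K. d i *\<^sub>R e i)
      = (\<Sum>i\<in>J. c i *\<^sub>R (if i \<in> K then d i *\<^sub>R e i else 0))"
    unfolding mult_sum_left using assms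
    by (intro sum.cong) (auto simp: mult_distribs complete_system_mult subset_iff)
  also have "\<dots> = (\<Sum>i\<in>J \<inter> K. (c i * d i) *\<^sub>R e i)"
    using fin by (intro sum.mono_neutral_cong_right) auto
  finally show ?thesis .
qed

lemma complete_system_sum_idempotent:
  assumes "complete_system I e" "J \<subseteq> I"
  shows "(\<Sum>i\<in>J. e i) \<odot> (\<Sum>i\<in>J. e i) = (\<Sum>i\<in>J. e i)"
  using complete_system_mult_sums[OF assms(1,2,2), of "\<lambda>_. 1" "\<lambda>_. 1"] by simp

lemma complete_system_sum_nonzero:
  assumes "complete_system I e" "J \<subseteq> I" "J \<noteq> {}"
  shows "(\<Sum>i\<in>J. e i) \<noteq> 0"
proof
  assume 0: "(\<Sum>i\<in>J. e i) = 0"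
  obtain k where "k \<in> J" using assms by auto
  then show False
    using complete_system_mult[OF assms(1) _ assms(2), of k "\<lambda>_. 1"] 0 assms complete_systemD(3)[OF assms(1)]
    by (auto simp: subset_iff)
qed

lemma complete_system_nonempty: "complete_system I e \<Longrightarrow> I \<noteq> {}"
  using complete_systemD(5) unit_nonzero by fastforce

lemma ev_complete_system:
  assumes "complete_system I e"
  shows "ev (\<Sum>i\<in>I. c i *\<^sub>R e i) p = (\<Sum>i\<in>I. poly p (c i) *\<^sub>R e i)"
proof (induction p)
  case (pCons a p)
  then show ?case
    using complete_system_mult_sums[OF assms order_refl order_refl, of c "\<lambda>i. poly p (c i)"]
      complete_systemD(5)[OF assms]
    by (simp add: scaleR_add_left sum.distrib flip: scaleR_sum_right)
qed simp

text \<open>A polynomial that is 1 at l and 0 at all other coefficients of both sides, evaluated at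
  the common element, gives both spectral idempotents.\<close>

lemma spectral_unique:
  assumes e: "complete_system I e" and f: "complete_system J f"
    and eq: "(\<Sum>i\<in>I. c i *\<^sub>R e i) = (\<Sum>j\<in>J. d j *\<^sub>R f j)"
  shows "(\<Sum>i\<in>{i\<in>I. c i = l}. e i) = (\<Sum>j\<in>{j\<in>J. d j = l}. f j)"
proof -
  have fin: "finite I" "finite J" using e f complete_systemD(1) by blast+
  obtain p :: "real poly" where p: "poly p l = 1" "\<And>b. b \<in> c ` I \<union> d ` J \<Longrightarrow> b \<noteq> l \<Longrightarrow> poly p b = 0"
    using interpolating_poly[of "c ` I \<union> d ` J" l] fin by auto
  have "(\<Sum>i\<in>I. poly p (c i) *\<^sub>R e i) = (\<Sum>i\<in>{i\<in>I. c i = l}. e i)"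
    using fin p by (intro sum.mono_neutral_cong_right) auto
  moreover have "(\<Sum>j\<in>J. poly p (d j) *\<^sub>R f j) = (\<Sum>j\<in>{j\<in>J. d j = l}. f j)"
    using fin p by (intro sum.mono_neutral_cong_right) auto
  ultimately show ?thesis
    using ev_complete_system[OF e, of c p] ev_complete_system[OF f, of d p] eq by simp
qed

lemma spectral_values_unique:
  assumes e: "complete_system I e" and f: "complete_system J f"
    and eq: "(\<Sum>i\<in>I. c i *\<^sub>R e i) = (\<Sum>j\<in>J. d j *\<^sub>R f j)"
  shows "c ` I = d ` J"
proof -
  have "c ` I \<subseteq> d ` J" if e: "complete_system I e" and f: "complete_system J f"
    and eq: "(\<Sum>i\<in>I. c i *\<^sub>R e i) = (\<Sum>j\<in>J. d j *\<^sub>R f j)"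
    for I :: "'k set" and J :: "'l set" and e f c d
  proof
    fix l assume "l \<in> c ` I"
    then have "(\<Sum>i\<in>{i\<in>I. c i = l}. e i) \<noteq> 0"
      by (intro complete_system_sum_nonzero[OF e]) auto
    then have "(\<Sum>j\<in>{j\<in>J. d j = l}. f j) \<noteq> 0"
      using spectral_unique[OF e f eq] by simp
    then have "{j\<in>J. d j = l} \<noteq> {}" by (metis sum.empty)
    then show "l \<in> d ` J" by auto
  qed
  from this[OF e f eq] this[OF f e eq[symmetric]] show ?thesis by blast
qed

text \<open>A real polynomial annihilating \<open>x\<close> of least degree has only simple real roots, since a
  nonreal or a multiple root would produce a nontrivial vanishing sum of squares.\<close>
lemma annihilating_product:
  "\<exists>S. finite S \<and> ev x (\<Prod>a\<in>S. [:- a, 1:]) = 0"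
proof -
  obtain q where q: "q \<noteq> 0" "ev x q = 0" and min: "\<And>p. p \<noteq> 0 \<Longrightarrow> ev x p = 0 \<Longrightarrow> degree q \<le> degree p"
    using ex_has_least_nat[of "\<lambda>p. p \<noteq> 0 \<and> ev x p = 0" _ degree] annihilating_poly[of x] by blast
  define S where "S = {a. poly q a = 0}"
  have fin: "finite S" unfolding S_def using q(1) poly_roots_finite by blast
  define s where "s = (\<Prod>a\<in>S. [:- a, 1:])"
  have "s dvd q" unfolding s_def using fin by (intro prod_linear_factors_dvd) (auto simp: S_def)
  then obtain r where r: "q = s * r" by (auto elim: dvdE)
  have "degree r = 0"
  proof (rule ccontr)
    assume "degree r \<noteq> 0"
    then obtain z where z: "poly (map_poly complex_of_real r) z = 0"
      using fundamental_theorem_of_algebra[of "map_poly complex_of_real r"]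
      by (auto simp: constant_degree degree_map_poly)
    show False
    proof (cases "Im z = 0")
      case False
      obtain r' where r': "r = [:(Re z)\<^sup>2 + (Im z)\<^sup>2, - 2 * Re z, 1:] * r'"
        using quadratic_dvd_poly[OF z False] by (auto elim: dvdE)
      let ?w = "s * r'"
      have w0: "?w \<noteq> 0" using q(1) r r' by auto
      \<comment> \<open>The quadratic factor is (X - Re z)^2 + (Im z)^2. With w the cofactor of it
        in q, multiplying by w^2 shows that q w, which vanishes at x, is a sum of two
        squares.\<close>
      define A B where "A = [:- Re z, 1:] * ?w" and "B = [:Im z:] * ?w"
      have "B * B + A * A
          = ([:- Re z, 1:] * [:- Re z, 1:] + [:Im z:] * [:Im z:]) * (?w * ?w)"
        unfolding A_def B_def by (simp only: algebra_simps)
      also have "[:- Re z, 1:] * [:- Re z, 1:] + [:Im z:] * [:Im z:] = [:(Re z)\<^sup>2 + (Im z)\<^sup>2, - 2 * Re z, 1:]"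
        by (simp add: power2_eq_square)
      also have "\<dots> * (?w * ?w) = q * ?w"
        unfolding r r' by (simp only: mult_ac)
      finally have "ev x (B * B + A * A) = ev x q \<odot> ev x ?w" by (simp only: ev_mult)
      then have "ev x B \<odot> ev x B + ev x A \<odot> ev x A = 0"
        using q(2) by (simp add: ev_add ev_mult)
      then have "ev x B = 0" by (rule square_sum_zeroD)
      then have "ev x ?w = 0" using False by (simp add: B_def ev_smult)
      then have "degree q \<le> degree ?w" using min w0 by blast
      moreover have "degree q = 2 + degree ?w"
      proof -
        have "q = [:(Re z)\<^sup>2 + (Im z)\<^sup>2, - 2 * Re z, 1:] * ?w"
          unfolding r r' by (simp only: mult_ac)
        then have "degree q = degree [:(Re z)\<^sup>2 + (Im z)\<^sup>2, - 2 * Re z, 1:] + degree ?w"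
          using w0 degree_mult_eq[of "[:(Re z)\<^sup>2 + (Im z)\<^sup>2, - 2 * Re z, 1:]" ?w] by (simp only:) simp
        then show ?thesis by simp
      qed
      ultimately show False by simp
    next
      case True
      define a where "a = Re z"
      have za: "z = complex_of_real a" using True by (simp add: a_def complex_eq_iff)
      have "poly (map_poly complex_of_real r) (complex_of_real a) = complex_of_real (poly r a)"
        by (induction r) (simp_all add: map_poly_pCons)
      then have ra: "poly r a = 0" using z za by simp
      then obtain r' where r': "r = [:- a, 1:] * r'" by (auto simp: poly_eq_0_iff_dvd elim: dvdE)
      have "a \<in> S" using ra r by (simp add: S_def)
      then have "poly s a = 0" using fin by (auto simp: s_def poly_prod)
      then obtain s' where s': "s = [:- a, 1:] * s'" by (auto simp: poly_eq_0_iff_dvd elim: dvdE)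
      \<comment> \<open>As a is at least a double root, the cofactor w of X - a in q is still
        divisible by X - a, so that w^2 is a multiple of q.\<close>
      let ?w = "[:- a, 1:] * (s' * r')"
      have "?w * ?w = q * (s' * r')" unfolding r r' s' by (simp only: mult_ac)
      then have "ev x ?w \<odot> ev x ?w = 0" using q(2) by (metis ev_mult mult_zero(2))
      then have "ev x ?w = 0" by (rule square_zeroD)
      moreover have w0: "?w \<noteq> 0"
      proof -
        have "s' \<noteq> 0" "r' \<noteq> 0" using q(1) r r' s' by auto
        then show ?thesis by (simp only: mult_eq_0_iff pCons_eq_0_iff) simp
      qed
      ultimately have "degree q \<le> degree ?w" using min by blast
      moreover have "q = [:- a, 1:] * ?w" unfolding r r' s' by (simp only: mult_ac)
      then have "degree q = degree [:- a, 1:] + degree ?w"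
        using w0 degree_mult_eq[of "[:- a, 1:]" ?w] by (simp only:) simp
      then have "degree q = 1 + degree ?w" by simp
      ultimately show False by simp
    qed
  qed
  then obtain c where "r = [:c:]" by (meson degree_eq_zeroE)
  with q r have "ev x s = 0" by (auto simp: ev_smult)
  with fin show ?thesis unfolding s_def by blast
qed

text \<open>At x, polynomials count only through their values on S. So the Lagrange polynomials of S
  behave like indicator functions and give orthogonal idempotents with sum u.\<close>

theorem spectral_decomposition:
  "\<exists>S e. complete_system S e \<and> x = (\<Sum>a\<in>S. a *\<^sub>R e a)"
proof -
  obtain S where S: "finite S" "ev x (\<Prod>a\<in>S. [:- a, 1:]) = 0"
    using annihilating_product by blast
  have ev_eq: "ev x p = ev x q" if "\<And>a. a \<in> S \<Longrightarrow> poly p a = poly q a" for p q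
  proof -
    have "(\<Prod>a\<in>S. [:- a, 1:]) dvd p - q"
      using S that by (intro prod_linear_factors_dvd) auto
    then have "ev x (p - q) = 0" using S(2) by (auto simp: ev_mult elim: dvdE)
    then show ?thesis by (simp add: ev_diff)
  qed
  obtain l where l: "\<And>a. poly (l a) a = 1" "\<And>a b. b \<in> S \<Longrightarrow> b \<noteq> a \<Longrightarrow> poly (l a) b = (0::real)"
    using interpolating_poly[OF S(1)] by metis
  have ldelta: "poly (l a) b = (if b = a then 1 else 0)" if "b \<in> S" for a b
    using l that by auto
  define e where "e a = ev x (l a)" for a
  have idem: "e a \<odot> e a = e a" for a
    unfolding e_def ev_mult[symmetric] using ldelta by (intro ev_eq) auto
  have orth: "e a \<odot> e b = 0" if "a \<noteq> b" for a b
    using ev_eq[of "l a * l b" 0] ldelta that by (auto simp: e_def ev_mult)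
  have sum_u: "(\<Sum>a\<in>S. e a) = u"
    using ev_eq[of "\<Sum>a\<in>S. l a" 1] ldelta S(1) by (auto simp: e_def ev_sum poly_sum)
  have sum_x: "(\<Sum>a\<in>S. a *\<^sub>R e a) = x"
  proof -
    have "poly (\<Sum>a\<in>S. smult a (l a)) b = poly [:0, 1:] b" if "b \<in> S" for b
    proof -
      have "(\<Sum>a\<in>S. a * poly (l a) b) = (\<Sum>a\<in>S. if a = b then b else 0)"
        using ldelta[OF that] by (intro sum.cong) auto
      then show ?thesis using that S(1) by (simp add: poly_sum)
    qed
    from ev_eq[OF this] show ?thesis by (simp add: e_def ev_sum ev_smult)
  qed
  let ?S = "{a\<in>S. e a \<noteq> 0}"
  have "(\<Sum>a\<in>?S. e a) = (\<Sum>a\<in>S. e a)" "(\<Sum>a\<in>?S. a *\<^sub>R e a) = (\<Sum>a\<in>S. a *\<^sub>R e a)"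
    by (rule sum.mono_neutral_left; use S(1) in force)+
  then have "complete_system ?S e \<and> x = (\<Sum>a\<in>?S. a *\<^sub>R e a)"
    using idem orth S(1) sum_u sum_x by (simp add: complete_system_def)
  then show ?thesis by blast
qed

section \<open>The trace form and the cone of squares\<close>

definition tau :: "'a \<Rightarrow> 'a \<Rightarrow> real" where
  "tau x y = optrace (m (x \<odot> y))"

lemma tau_commute: "tau x y = tau y x"
  by (simp add: tau_def mult_commute)

lemma bilinear_tau: "bilinear tau"
proof -
  have "tau (x + y) z = tau x z + tau y z" for x y z
  proof -
    have "m ((x + y) \<odot> z) = (\<lambda>v. (x \<odot> z) \<odot> v + (y \<odot> z) \<odot> v)"
      by (rule ext) (simp add: mult_distribs)
    then show ?thesis by (simp add: tau_def optrace_add)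
  qed
  moreover have "tau (c *\<^sub>R x) z = c *\<^sub>R tau x z" for c x z
  proof -
    have "m ((c *\<^sub>R x) \<odot> z) = (\<lambda>v. c *\<^sub>R ((x \<odot> z) \<odot> v))"
      by (rule ext) (simp add: mult_distribs)
    then show ?thesis by (simp add: tau_def optrace_scaleR)
  qed
  ultimately have "linear (\<lambda>x. tau x z)" for z by (intro linearI) auto
  moreover from this have "linear (tau z)" for z using tau_commute[of z] by presburger
  ultimately show ?thesis by (simp add: bilinear_def eta_contract_eq)
qed

lemma bounded_bilinear_tau: "bounded_bilinear tau"
  using bilinear_tau by (simp add: bilinear_conv_bounded_bilinear)

lemmas tendsto_tau [tendsto_intros] = bounded_bilinear.tendsto[OF bounded_bilinear_tau]
lemmas continuous_on_tau [continuous_intros] = bounded_bilinear.continuous_on[OF bounded_bilinear_tau]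

lemma linear_tau: "linear (tau x)"
  using bilinear_tau by (simp add: bilinear_def)

lemma linear_tau_left: "linear (\<lambda>x. tau x y)"
  using bilinear_tau by (simp add: bilinear_def)

lemmas tau_distribs =
  linear_add[OF linear_tau] linear_add[OF linear_tau_left]
  linear_diff[OF linear_tau] linear_diff[OF linear_tau_left]
  linear_cmul[OF linear_tau] linear_cmul[OF linear_tau_left]
  linear_neg[OF linear_tau] linear_neg[OF linear_tau_left]

lemmas tau_zero [simp] = linear_0[OF linear_tau] linear_0[OF linear_tau_left]

lemma tau_sum_right: "tau x (\<Sum>i\<in>I. f i) = (\<Sum>i\<in>I. tau x (f i))"
  by (rule linear_sum[OF linear_tau])

lemma tau_sum_left: "tau (\<Sum>i\<in>I. f i) x = (\<Sum>i\<in>I. tau (f i) x)"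
  using linear_sum[OF linear_tau_left] by fast

text \<open>The difference of the two sides is the trace of a commutator, by \<open>mult_difference\<close>.\<close>
lemma tau_assoc: "tau (x \<odot> w) y = tau x (w \<odot> y)"
proof -
  have lin: "linear (\<lambda>z. a \<odot> (b \<odot> z))" for a b
    using linear_compose[OF linear_mult linear_mult] by (simp add: o_def)
  have cyc: "optrace (\<lambda>z. a \<odot> (b \<odot> (c \<odot> z))) = optrace (\<lambda>z. c \<odot> (a \<odot> (b \<odot> z)))" for a b c
    using optrace_comp_commute[OF lin linear_mult] .
  have "tau (x \<odot> w) y - tau x (w \<odot> y)
      = optrace (\<lambda>z. ((x \<odot> w) \<odot> y) \<odot> z - (x \<odot> (w \<odot> y)) \<odot> z)"
    by (simp add: tau_def optrace_diff)
  also have "\<dots> = 0"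
    unfolding mult_difference by (simp add: optrace_diff cyc[of _ _ w])
  finally show ?thesis by simp
qed

lemma tau_mult_swap: "tau (w \<odot> x) y = tau x (w \<odot> y)"
  using tau_assoc mult_commute by metis

lemma tau_unit: "tau (x \<odot> y) u = tau x y"
  by (simp add: tau_def)

section \<open>Peirce decomposition for an idempotent\<close>

lemma idempotent_cubic:
  assumes "c \<odot> c = c"
  shows "2 *\<^sub>R (c \<odot> (c \<odot> (c \<odot> z))) = 3 *\<^sub>R (c \<odot> (c \<odot> z)) - c \<odot> z"
proof -
  \<comment> \<open>The operator identity for multiplication by
    \<open>(x \<odot> x) \<odot> y\<close> at \<open>x = y = c\<close>.\<close>
  have "c \<odot> z = 2 *\<^sub>R (c \<odot> (c \<odot> z)) + c \<odot> (c \<odot> z) - 2 *\<^sub>R (c \<odot> (c \<odot> (c \<odot> z)))"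
    using mult_square_mult[of c c z] assms by simp
  moreover have "3 *\<^sub>R v = 2 *\<^sub>R v + v" for v :: 'a
    using scaleR_add_left[of 2 1 v] by simp
  ultimately show ?thesis by (simp add: algebra_simps)
qed

lemma Uop_idempotent:
  assumes "c \<odot> c = c"
  shows "Uop m c z = 2 *\<^sub>R (c \<odot> (c \<odot> z)) - c \<odot> z"
  using assms by (simp add: Uop_def)

lemma linear_Uop: "linear (Uop m c)"
  by (rule linearI) (simp_all add: Uop_def mult_distribs scaleR_add_right scaleR_diff_right)

text \<open>By the cubic relation, multiplication by c can only have the eigenvalues 0, 1/2 and 1.
  \<open>Uop m c\<close> is the polynomial 2 t^2 - t in it, with values 0, 0, 1 there, so it
  projects onto the eigenspace of 1.\<close>

lemma mult_Uop:
  assumes "c \<odot> c = c" shows "c \<odot> Uop m c z = Uop m c z"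
proof -
  have "3 *\<^sub>R v = 2 *\<^sub>R v + v" for v :: 'a
    using scaleR_add_left[of 2 1 v] by simp
  then show ?thesis
    using idempotent_cubic[OF assms, of z]
    by (simp add: Uop_idempotent[OF assms] mult_distribs)
qed

lemma Uop_fixed:
  assumes "c \<odot> c = c" "c \<odot> z = z" shows "Uop m c z = z"
  using assms by (simp add: Uop_idempotent scaleR_2)

text \<open>H is the polynomial 4 t - 4 t^2 in multiplication by c, the projection onto the
  eigenspace of 1/2. Thus the trace is the dimension of the 1-space, which contains c, plus half
  that of the 1/2-space. A uniform bound, rather than mere positivity, keeps limits of nonzero
  idempotents nonzero.\<close>

lemma tau_idempotent_unit_ge_1:
  assumes c: "c \<odot> c = c" and "c \<noteq> 0"
  shows "1 \<le> tau c u"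
proof -
  define H where "H z = 4 *\<^sub>R (c \<odot> z) - 4 *\<^sub>R (c \<odot> (c \<odot> z))" for z
  have linH: "linear H"
    by (rule linearI) (simp_all add: H_def mult_distribs algebra_simps)
  have HH: "H (H z) = H z" for z
  proof (rule euclidean_eqI)
    fix b :: 'a
    show "H (H z) \<bullet> b = H z \<bullet> b"
      using idempotent_cubic[OF c, of z, THEN arg_cong[of _ _ "\<lambda>v. v \<bullet> b"]]
        idempotent_cubic[OF c, of "c \<odot> z", THEN arg_cong[of _ _ "\<lambda>v. v \<bullet> b"]]
      by (simp add: H_def mult_distribs inner_simps)
  qed
  have UU: "Uop m c (Uop m c z) = Uop m c z" for z
    using c by (simp add: Uop_fixed mult_Uop)
  have mc: "m c = (\<lambda>z. Uop m c z + (1/2) *\<^sub>R H z)"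
  proof
    fix z show "m c z = Uop m c z + (1/2) *\<^sub>R H z"
      by (simp add: Uop_idempotent[OF c] H_def scaleR_diff_right scaleR_2)
  qed
  have "tau c u = optrace (m c)" by (simp add: tau_def)
  also have "\<dots> = optrace (\<lambda>z. Uop m c z + (1/2) *\<^sub>R H z)" by (rule arg_cong[OF mc])
  also have "\<dots> = optrace (Uop m c) + 1/2 * optrace H" by (simp only: optrace_add optrace_scaleR)
  also have "\<dots> = dim (range (Uop m c)) + 1/2 * dim (range H)"
    using optrace_projection[OF linear_Uop UU] optrace_projection[OF linH HH] by simp
  finally have "dim (range (Uop m c)) \<le> tau c u" by simp
  moreover have "dim (range (Uop m c)) \<noteq> 0"
  proof -
    have "c \<in> range (Uop m c)" using Uop_fixed[OF c c] by (metis rangeI)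
    then show ?thesis using assms(2) by (auto simp: dim_eq_0)
  qed
  ultimately show ?thesis by linarith
qed

lemma tau_idempotent_self: "c \<odot> c = c \<Longrightarrow> tau c c = tau c u"
  using tau_unit[of c c] by simp

text \<open>In a spectral decomposition, \<open>tau x x\<close> is the sum of the squared
  eigenvalues with weights \<open>tau (e a) u\<close>, all at least 1.\<close>

lemma tau_self_nonneg: "0 \<le> tau x x"
  and tau_self_zeroD: "tau x x = 0 \<Longrightarrow> x = 0"
proof -
  obtain S e where e: "complete_system S e" and x: "x = (\<Sum>a\<in>S. a *\<^sub>R e a)"
    using spectral_decomposition by blast
  have fin: "finite S" using e complete_systemD by blast
  have "x \<odot> x = (\<Sum>a\<in>S. (a * a) *\<^sub>R e a)"
    using complete_system_mult_sums[OF e order_refl order_refl, of "\<lambda>a. a" "\<lambda>a. a"] x by simp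
  then have tau: "tau x x = (\<Sum>a\<in>S. a * a * tau (e a) u)"
    using tau_unit[of x x] by (simp add: tau_sum_left tau_distribs)
  have pos: "0 < tau (e a) u" if "a \<in> S" for a
    using tau_idempotent_unit_ge_1[of "e a"] complete_systemD[OF e] that by force
  then show "0 \<le> tau x x" unfolding tau by (intro sum_nonneg) (auto simp: less_imp_le)
  assume "tau x x = 0"
  then have "\<forall>a\<in>S. a * a * tau (e a) u = 0"
    unfolding tau using fin pos by (subst (asm) sum_nonneg_eq_0_iff) (auto simp: less_imp_le)
  then have "\<forall>a\<in>S. a = 0" using pos by force
  then show "x = 0" unfolding x by (intro sum.neutral) auto
qed

section \<open>The self-dual cone of squares\<close>

definition cone :: "'a set" where
  "cone = {a \<odot> a |a. True}"

lemma jle_iff: "jle m x y \<longleftrightarrow> y - x \<in> cone"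
  by (simp add: jle_def cone_def)

lemma idempotent_in_cone: "c \<odot> c = c \<Longrightarrow> c \<in> cone"
  unfolding cone_def by (metis (mono_tags, lifting) mem_Collect_eq)

text \<open>Multiplication by c is self-adjoint for \<open>tau\<close> with eigenvalues in {0, 1/2,
  1}. Instead of diagonalizing, the cubic relation links the moments ?t, ?a, ?b, ?d of its first
  four powers; the squares of \<open>c \<odot> x\<close> and of
  \<open>c \<odot> x - c \<odot> (c \<odot> x)\<close> then give ?b \<le> ?a and ?t = 3 ?a - 2 ?b
  \<ge> ?a \<ge> 0.\<close>

lemma tau_mult_idempotent_nonneg:
  assumes c: "c \<odot> c = c" shows "0 \<le> tau (c \<odot> x) x"
proof -
  let ?a = "tau (c \<odot> x) (c \<odot> x)" and ?t = "tau (c \<odot> x) x"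
  let ?b = "tau (c \<odot> x) (c \<odot> (c \<odot> x))" and ?d = "tau (c \<odot> (c \<odot> x)) (c \<odot> (c \<odot> x))"
  have "2 * ?b = 3 * ?a - ?t"
    using idempotent_cubic[OF c, of x, THEN arg_cong[of _ _ "\<lambda>v. tau v x"]]
    by (simp add: tau_distribs tau_mult_swap)
  moreover have "2 * ?d = 3 * ?b - ?a"
    using idempotent_cubic[OF c, of x, THEN arg_cong[of _ _ "\<lambda>v. tau v (c \<odot> x)"]]
    by (simp add: tau_distribs tau_mult_swap[of c "c \<odot> (c \<odot> x)"] tau_commute[of "c \<odot> (c \<odot> x)" "c \<odot> x"])
  moreover have "0 \<le> ?a" by (rule tau_self_nonneg)
  moreover have "0 \<le> ?a - 2 * ?b + ?d"
    using tau_self_nonneg[of "c \<odot> x - c \<odot> (c \<odot> x)"] tau_commute[of "c \<odot> (c \<odot> x)" "c \<odot> x"]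
    by (simp add: tau_distribs)
  ultimately show ?thesis by linarith
qed

lemma tau_combination:
  assumes e: "complete_system I e" and i: "i \<in> I"
  shows "tau (\<Sum>j\<in>I. c j *\<^sub>R e j) (e i) = c i * tau (e i) u"
  using complete_system_mult[OF e i order_refl, of c] i tau_unit[of "e i" "\<Sum>j\<in>I. c j *\<^sub>R e j"]
  by (simp add: tau_commute[of _ "e i"] tau_distribs)

lemma combination_in_coneI:
  assumes e: "complete_system I e" and "\<And>i. i \<in> I \<Longrightarrow> 0 \<le> c i"
  shows "(\<Sum>i\<in>I. c i *\<^sub>R e i) \<in> cone"
proof -
  have "(\<Sum>i\<in>I. sqrt (c i) *\<^sub>R e i) \<odot> (\<Sum>i\<in>I. sqrt (c i) *\<^sub>R e i) = (\<Sum>i\<in>I. c i *\<^sub>R e i)"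
    using complete_system_mult_sums[OF e order_refl order_refl, of "\<lambda>i. sqrt (c i)" "\<lambda>i. sqrt (c i)"] assms(2)
    by simp
  then show ?thesis unfolding cone_def by (metis (mono_tags, lifting) mem_Collect_eq)
qed

text \<open>A square is a nonnegative combination of idempotents by the spectral theorem, so the
  previous positivity extends to it.\<close>

lemma tau_mult_cone_nonneg:
  assumes "y \<in> cone" shows "0 \<le> tau (y \<odot> x) x"
proof -
  obtain a where y: "y = a \<odot> a" using assms by (auto simp: cone_def)
  obtain S e where e: "complete_system S e" and a: "a = (\<Sum>l\<in>S. l *\<^sub>R e l)"
    using spectral_decomposition by blast
  have "y = (\<Sum>l\<in>S. (l * l) *\<^sub>R e l)"
    using complete_system_mult_sums[OF e order_refl order_refl, of "\<lambda>l. l" "\<lambda>l. l"] a y by simp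
  then have "tau (y \<odot> x) x = (\<Sum>l\<in>S. l * l * tau (e l \<odot> x) x)"
    by (simp add: mult_sum_left tau_sum_left mult_distribs tau_distribs)
  also have "\<dots> \<ge> 0"
    using tau_mult_idempotent_nonneg complete_systemD(2)[OF e] by (intro sum_nonneg) auto
  finally show ?thesis .
qed

lemma combination_in_coneD:
  assumes e: "complete_system I e" and i: "i \<in> I"
    and "0 \<le> tau (\<Sum>j\<in>I. c j *\<^sub>R e j) (e i)"
  shows "0 \<le> c i"
proof -
  have "0 < tau (e i) u"
    using tau_idempotent_unit_ge_1[of "e i"] complete_systemD[OF e] i by force
  then show ?thesis using assms(3) unfolding tau_combination[OF e i] by (simp add: zero_le_mult_iff)
qed

text \<open>Testing y against its own spectral idempotents shows that all its eigenvalues are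
  nonnegative, and their square roots then give a root of y.\<close>

lemma cone_dualI:
  assumes "\<And>c. c \<odot> c = c \<Longrightarrow> 0 \<le> tau y c"
  shows "y \<in> cone"
proof -
  obtain S e where e: "complete_system S e" and y: "y = (\<Sum>l\<in>S. l *\<^sub>R e l)"
    using spectral_decomposition by blast
  have "0 \<le> l" if "l \<in> S" for l
    using combination_in_coneD[OF e that, of "\<lambda>l. l"] assms complete_systemD(2)[OF e that] y by simp
  then show ?thesis unfolding y by (intro combination_in_coneI[OF e]) auto
qed

lemma tau_cone_nonneg:
  assumes "y \<in> cone" "z \<in> cone" shows "0 \<le> tau y z"
proof -
  obtain a where "z = a \<odot> a" using assms by (auto simp: cone_def)
  then show ?thesis using tau_mult_cone_nonneg[OF assms(1), of a] by (simp add: tau_assoc)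
qed

lemma cone_iff: "y \<in> cone \<longleftrightarrow> (\<forall>c. c \<odot> c = c \<longrightarrow> 0 \<le> tau y c)"
  using cone_dualI tau_cone_nonneg idempotent_in_cone by blast

lemma cone_scaleR: "x \<in> cone \<Longrightarrow> 0 \<le> c \<Longrightarrow> c *\<^sub>R x \<in> cone"
  by (simp add: cone_iff tau_distribs)

lemma closed_cone: "closed cone"
proof -
  have "cone = (\<Inter>c\<in>{c. c \<odot> c = c}. {y. 0 \<le> tau y c})" by (auto simp: cone_iff)
  moreover have "closed {y. 0 \<le> tau y c}" for c
    by (intro closed_Collect_le continuous_intros)
  ultimately show ?thesis by auto
qed

text \<open>The form \<open>tau (y \<odot> x) x\<close> is nonnegative and vanishes at
  \<open>x = c\<close>, so c is a minimum and the derivative there is zero. In the direction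
  \<open>y \<odot> c\<close> this derivative is 2 s, with s the \<open>tau\<close>-square of
  \<open>y \<odot> c\<close>.\<close>

lemma mult_eq_0_if_tau_eq_0:
  assumes y: "y \<in> cone" and c: "c \<odot> c = c" and 0: "tau y c = 0"
  shows "y \<odot> c = 0"
proof -
  define s where "s = tau (y \<odot> c) (y \<odot> c)"
  define \<beta> where "\<beta> = tau (y \<odot> (y \<odot> c)) (y \<odot> c)"
  have "\<beta> \<ge> 0" unfolding \<beta>_def using tau_mult_cone_nonneg[OF y] .
  have yc: "tau (y \<odot> c) c = 0" using 0 c tau_assoc by simp
  have quad: "0 \<le> 2 * t * s + t * t * \<beta>" for t
  proof -
    have "0 \<le> tau (y \<odot> (c + t *\<^sub>R (y \<odot> c))) (c + t *\<^sub>R (y \<odot> c))"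
      using tau_mult_cone_nonneg[OF y] .
    also have "\<dots> = 2 * t * s + t * t * \<beta>"
      using yc tau_mult_swap[of y "y \<odot> c" c] tau_commute
      by (simp add: mult_distribs tau_distribs s_def \<beta>_def algebra_simps)
    finally show ?thesis .
  qed
  have "s = 0"
  proof (rule ccontr)
    assume "s \<noteq> 0"
    \<comment> \<open>Small enough for the linear term to win over the quadratic one; the 1 keeps
      the denominator positive when \<beta> is 0.\<close>
    define t where "t = - s / (\<beta> + 1)"
    have t: "t * (\<beta> + 1) = - s" using \<open>\<beta> \<ge> 0\<close> by (simp add: t_def)
    have "0 \<le> (2 * t * s + t * t * \<beta>) * (\<beta> + 1)\<^sup>2"
      by (rule mult_nonneg_nonneg[OF quad]) simp
    also have "\<dots> = 2 * s * (t * (\<beta> + 1)) * (\<beta> + 1) + (t * (\<beta> + 1)) * (t * (\<beta> + 1)) * \<beta>"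
      by (simp only: power2_eq_square algebra_simps)
    also have "\<dots> = - (s\<^sup>2 * (\<beta> + 2))"
      unfolding t by (simp add: power2_eq_square algebra_simps)
    also have "\<dots> < 0" using \<open>s \<noteq> 0\<close> \<open>\<beta> \<ge> 0\<close> by (simp add: zero_less_mult_iff)
    finally show False by simp
  qed
  then show ?thesis unfolding s_def by (rule tau_self_zeroD)
qed

text \<open>Two instances of the linearized identity place the product both in the 0-eigenspace and
  in the 1-eigenspace of p.\<close>

lemma peirce_1_0:
  assumes "p \<odot> p = p" "p \<odot> z = z" "p \<odot> w = 0" shows "z \<odot> w = 0"
proof -
  have "p \<odot> (z \<odot> w) = 0"
    using jordan_linearized[of p z w] assms by (simp add: scaleR_2)
  moreover have "p \<odot> (w \<odot> z) = w \<odot> z"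
    using jordan_linearized[of p w z] assms by (simp add: scaleR_2)
  ultimately show ?thesis using mult_commute[of z w] by simp
qed

lemma tau_Uop:
  assumes "p \<odot> p = p" shows "tau (Uop m p x) y = tau x (Uop m p y)"
  using assms by (simp add: Uop_idempotent tau_distribs tau_mult_swap)

lemma complement_idempotent:
  assumes "p \<odot> p = p" shows "(u - p) \<odot> (u - p) = u - p"
  using assms by (simp add: mult_distribs)

text \<open>With z the compression, \<open>z \<odot> z\<close> is \<open>tau\<close>-orthogonal to
  \<open>u - p\<close>, so every spectral idempotent of z with nonzero eigenvalue is orthogonal to
  \<open>u - p\<close> and thus fixed by p. On such an idempotent e, self-adjointness of
  \<open>Uop m p\<close> gives \<open>tau z e = tau y e\<close>, which is nonnegative.\<close>

lemma Uop_cone: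
  assumes p: "p \<odot> p = p" and y: "y \<in> cone"
  shows "Uop m p y \<in> cone"
proof -
  let ?q = "u - p"
  define z where "z = Uop m p y"
  have q: "?q \<odot> ?q = ?q" using complement_idempotent[OF p] .
  obtain S e where e: "complete_system S e" and z: "z = (\<Sum>l\<in>S. l *\<^sub>R e l)"
    using spectral_decomposition by blast
  have idem: "e l \<odot> e l = e l" if "l \<in> S" for l
    by (rule complete_systemD(2)[OF e that])
  have zz: "z \<odot> z = (\<Sum>l\<in>S. (l * l) *\<^sub>R e l)"
    using complete_system_mult_sums[OF e order_refl order_refl, of "\<lambda>l. l" "\<lambda>l. l"]
    unfolding z[symmetric] by simp
  have "(\<Sum>l\<in>S. (l * l) * tau (e l) ?q) = tau (z \<odot> z) ?q"
    unfolding zz tau_sum_left by (simp add: linear_cmul[OF linear_tau_left])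
  also have "\<dots> = 0"
    using mult_Uop[OF p, of y] by (simp add: z_def tau_assoc linear_diff[OF linear_mult] mult_commute[of "Uop m p y" p])
  finally have sum0: "(\<Sum>l\<in>S. (l * l) * tau (e l) ?q) = 0" .
  have "0 \<le> tau (e l) ?q" if "l \<in> S" for l
    by (rule tau_cone_nonneg[OF idempotent_in_cone[OF idem[OF that]] idempotent_in_cone[OF q]])
  then have "0 \<le> (l * l) * tau (e l) ?q" if "l \<in> S" for l
    using that by simp
  then have zero: "(l * l) * tau (e l) ?q = 0" if "l \<in> S" for l
    using sum_nonneg_0[OF complete_systemD(1)[OF e] _ sum0 that] by blast
  have nonneg: "0 \<le> l" if l: "l \<in> S" "tau (e l) ?q = 0" for l
  proof -
    have "e l \<odot> ?q = 0"
      by (rule mult_eq_0_if_tau_eq_0[OF idempotent_in_cone[OF idem[OF l(1)]] q l(2)])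
    then have "p \<odot> e l = e l" by (simp add: linear_diff[OF linear_mult] mult_commute[of p])
    then have "tau z (e l) = tau y (e l)" using p by (simp add: z_def tau_Uop Uop_fixed)
    then have "0 \<le> tau z (e l)"
      using tau_cone_nonneg[OF y idempotent_in_cone[OF idem[OF l(1)]]] by simp
    then show ?thesis using combination_in_coneD[OF e l(1), of "\<lambda>l. l"] z by simp
  qed
  have "0 \<le> l" if "l \<in> S" for l
    using zero[OF that] nonneg[OF that] by (cases "l = 0") auto
  then show ?thesis unfolding z_def[symmetric] z by (intro combination_in_coneI[OF e]) auto
qed

end


section \<open>Rank and Jordan frames\<close>

text \<open>As each property is inherited by further subsequences, finitely many successive
  refinements suffice and no diagonal sequence is taken.\<close>

lemma common_subsequence:
  fixes P :: "'i \<Rightarrow> (nat \<Rightarrow> nat) \<Rightarrow> bool"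
  assumes "finite I"
    and ex: "\<And>i (s :: nat \<Rightarrow> nat). i \<in> I \<Longrightarrow> strict_mono s \<Longrightarrow> \<exists>t. strict_mono t \<and> P i (s \<circ> t)"
    and sub: "\<And>i s (t :: nat \<Rightarrow> nat). i \<in> I \<Longrightarrow> strict_mono t \<Longrightarrow> P i s \<Longrightarrow> P i (s \<circ> t)"
  shows "\<exists>s. strict_mono s \<and> (\<forall>i\<in>I. P i s)"
  using assms
proof (induction I rule: finite_induct)
  case empty
  have "strict_mono (id :: nat \<Rightarrow> nat)" by (rule strict_mono_id)
  then show ?case by blast
next
  case (insert i I)
  then obtain s where s: "strict_mono s" "\<forall>j\<in>I. P j s" by auto
  obtain t where t: "strict_mono t" "P i (s \<circ> t)" using insert.prems(1)[of i s] s(1) by blast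
  have "strict_mono (s \<circ> t)" using s t by (simp add: strict_mono_o)
  moreover have "\<forall>j\<in>insert i I. P j (s \<circ> t)" using insert.prems(2) s t by blast
  ultimately show ?case by blast
qed

lemma bounded_common_subsequence:
  fixes f :: "'i \<Rightarrow> nat \<Rightarrow> 'a::heine_borel"
  assumes "finite I" "\<And>i. i \<in> I \<Longrightarrow> bounded (range (f i))"
  shows "\<exists>s l. strict_mono s \<and> (\<forall>i\<in>I. (\<lambda>k. f i (s k)) \<longlonglongrightarrow> l i)"
proof -
  have "\<exists>s. strict_mono s \<and> (\<forall>i\<in>I. \<exists>l. (\<lambda>k. f i (s k)) \<longlonglongrightarrow> l)"
  proof (rule common_subsequence[OF assms(1)])
    fix i and s :: "nat \<Rightarrow> nat" assume i: "i \<in> I" and "strict_mono s"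
    have "bounded (range (f i \<circ> s))" using assms(2)[OF i] by (rule bounded_subset) auto
    then obtain l t where "strict_mono t" "((f i \<circ> s) \<circ> t) \<longlonglongrightarrow> l"
      using bounded_imp_convergent_subsequence by blast
    then show "\<exists>t. strict_mono t \<and> (\<exists>l. (\<lambda>k. f i ((s \<circ> t) k)) \<longlonglongrightarrow> l)"
      by (auto simp: o_def)
  next
    fix i and s t :: "nat \<Rightarrow> nat" assume t: "strict_mono t" and "\<exists>l. (\<lambda>k. f i (s k)) \<longlonglongrightarrow> l"
    then obtain l where "(\<lambda>k. f i (s k)) \<longlonglongrightarrow> l" by blast
    from LIMSEQ_subseq_LIMSEQ[OF this t] show "\<exists>l. (\<lambda>k. f i ((s \<circ> t) k)) \<longlonglongrightarrow> l"
      by (auto simp: o_def)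
  qed
  then show ?thesis by metis
qed

text \<open>Elimination with a pivot that is itself polynomial, to avoid determinants.\<close>
lemma finite_dependent_polynomial_family:
  fixes v :: "nat \<Rightarrow> real \<Rightarrow> 'a::euclidean_space"
  assumes "\<And>i. i < r \<Longrightarrow> polynomial_function (v i)"
    and "\<And>c. (\<Sum>i<r. c i *\<^sub>R v i t0) = 0 \<Longrightarrow> \<forall>i<r. c i = 0"
  shows "finite {t. \<exists>c. (\<Sum>i<r. c i *\<^sub>R v i t) = 0 \<and> (\<exists>i<r. c i \<noteq> 0)}"
  using assms
proof (induction r arbitrary: v)
  case (Suc r)
  \<comment> \<open>Pairing with b makes the pivot a nonzero polynomial, since its value at t0 is
    the squared norm of b. Each \<open>w i t\<close> is the combination of \<open>v i t\<close> and
    \<open>v r t\<close> orthogonal to b, formed without dividing by the pivot.\<close>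
  define b where "b = v r t0"
  define a where "a t = v r t \<bullet> b" for t
  define w where "w i t = a t *\<^sub>R v i t - (v i t \<bullet> b) *\<^sub>R v r t" for i t
  have comb: "(\<Sum>i<r. c i *\<^sub>R w i t)
      = (\<Sum>i<Suc r. (if i < r then a t * c i else - (\<Sum>i<r. c i * (v i t \<bullet> b))) *\<^sub>R v i t)" for c t
    by (simp add: w_def scaleR_diff_right sum_subtractf scaleR_sum_left mult.commute)
  have "b \<noteq> 0"
  proof
    assume "b = 0"
    then have "(\<Sum>i<Suc r. (if i = r then 1 else 0) *\<^sub>R v i t0) = 0"
      by (intro sum.neutral) (auto simp: b_def)
    from Suc.prems(2)[OF this] show False by auto
  qed
  then have a0: "a t0 \<noteq> 0" by (simp add: a_def b_def)
  have poly_inner: "polynomial_function (\<lambda>t. v i t \<bullet> b)" if "i < Suc r" for i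
    using Suc.prems(1)[OF that] by (intro polynomial_function_inner) auto
  have poly_a: "real_polynomial_function a"
    using poly_inner[of r] by (simp add: a_def[abs_def] real_polynomial_function_eq)
  have "finite {t. a t = 0}"
  proof -
    obtain c n where a: "a = (\<lambda>t. \<Sum>i\<le>n. c i * t ^ i)"
      using poly_a by (auto simp: real_polynomial_function_iff_sum)
    have "\<exists>i\<le>n. c i \<noteq> 0"
    proof (rule ccontr)
      assume "\<not> ?thesis"
      then have "a t0 = 0" unfolding a by (intro sum.neutral) auto
      then show False using a0 by simp
    qed
    then show ?thesis unfolding a by (simp add: polyfun_finite_roots)
  qed
  moreover have "finite {t. \<exists>c. (\<Sum>i<r. c i *\<^sub>R w i t) = 0 \<and> (\<exists>i<r. c i \<noteq> 0)}"
  proof (rule Suc.IH)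
    fix i assume "i < r"
    then show "polynomial_function (w i)"
      unfolding w_def[abs_def] a_def using Suc.prems(1) poly_inner
      by (intro polynomial_function_diff polynomial_function_mult) auto
  next
    fix c assume "(\<Sum>i<r. c i *\<^sub>R w i t0) = 0"
    note zero = Suc.prems(2)[OF this[unfolded comb], rule_format]
    show "\<forall>i<r. c i = 0"
    proof (intro allI impI)
      fix i assume "i < r"
      then show "c i = 0" using zero[of i] a0 by simp
    qed
  qed
  moreover have "{t. \<exists>c. (\<Sum>i<Suc r. c i *\<^sub>R v i t) = 0 \<and> (\<exists>i<Suc r. c i \<noteq> 0)}
      \<subseteq> {t. a t = 0} \<union> {t. \<exists>c. (\<Sum>i<r. c i *\<^sub>R w i t) = 0 \<and> (\<exists>i<r. c i \<noteq> 0)}"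
  proof clarify
    fix t c j assume sum0: "(\<Sum>i<Suc r. c i *\<^sub>R v i t) = 0" and j: "j < Suc r" "c j \<noteq> 0"
      and no: "\<nexists>c. (\<Sum>i<r. c i *\<^sub>R w i t) = 0 \<and> (\<exists>i<r. c i \<noteq> 0)"
    have "(\<Sum>i<Suc r. c i *\<^sub>R v i t) \<bullet> b = 0" using sum0 by simp
    then have piv: "c r * a t = - (\<Sum>i<r. c i * (v i t \<bullet> b))"
      by (simp add: inner_add_left inner_sum_left a_def)
    have "(\<Sum>i<r. c i *\<^sub>R w i t) = a t *\<^sub>R (\<Sum>i<Suc r. c i *\<^sub>R v i t)"
      unfolding comb piv[symmetric] by (simp add: scaleR_add_right scaleR_sum_right mult.commute)
    with sum0 no have "\<forall>i<r. c i = 0" by auto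
    with piv j show "a t = 0" by (auto simp: less_Suc_eq)
  qed
  ultimately show ?case by (meson finite_UnI finite_subset)
qed simp

context formally_real_jordan_algebra
begin

section \<open>Refining complete systems until they are primitive\<close>

lemma complete_system_inj: "complete_system I e \<Longrightarrow> inj_on e I"
  by (metis complete_systemD(2,3,4) inj_onI)

lemma complete_system_reindex:
  assumes "bij_betw f J I"
  shows "complete_system J (\<lambda>j. e (f j)) \<longleftrightarrow> complete_system I e"
proof -
  have I: "I = f ` J" and inj: "inj_on f J" using assms by (auto simp: bij_betw_def)
  have "(\<Sum>i\<in>I. e i) = (\<Sum>j\<in>J. e (f j))" unfolding I using sum.reindex[OF inj, of e] by (simp add: o_def)
  moreover have "finite I \<longleftrightarrow> finite J" using assms bij_betw_finite by blast
  ultimately show ?thesis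
    unfolding complete_system_def by (auto simp: I inj_on_eq_iff[OF inj])
qed

lemma complete_system_image:
  assumes "complete_system I e" shows "complete_system (e ` I) (\<lambda>x. x)"
  using complete_system_reindex[of e I "e ` I" "\<lambda>x. x"] complete_system_inj[OF assms] assms
  by (simp add: bij_betw_def)

lemma complete_system_card_le_dim:
  assumes "complete_system I e" shows "card I \<le> DIM('a)"
proof -
  let ?F = "e ` I"
  have F: "complete_system ?F (\<lambda>x. x)" by (rule complete_system_image[OF assms])
  have "independent ?F"
  proof (rule independent_if_scalars_zero)
    show "finite ?F" using F complete_systemD by blast
    fix c x assume "(\<Sum>x\<in>?F. c x *\<^sub>R x) = 0" "x \<in> ?F"
    then show "c x = 0"
      using complete_system_mult[OF F, of x ?F c] complete_systemD(3)[OF F] by auto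
  qed
  then show ?thesis
    using independent_bound card_image[OF complete_system_inj[OF assms]] by metis
qed

text \<open>Taken over all complete systems, so that it bounds every one of them at once; that each
  primitive system attains the maximum is proved only later.\<close>

definition jrank :: nat where
  "jrank = Max {card F |F. complete_system F (\<lambda>x. x)}"

lemma jrank_set: "finite {card F |F. complete_system F (\<lambda>x. x)}"
  "{card F |F. complete_system F (\<lambda>x. x)} \<noteq> {}"
proof -
  have "{card F |F. complete_system F (\<lambda>x. x)} \<subseteq> {..DIM('a)}"
    using complete_system_card_le_dim by auto
  then show "finite {card F |F. complete_system F (\<lambda>x. x)}" by (rule finite_subset) simp
  have "complete_system {u} (\<lambda>x. x)" using unit_nonzero by (simp add: complete_system_def)
  then show "{card F |F. complete_system F (\<lambda>x. x)} \<noteq> {}" by blast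
qed

lemma card_le_jrank:
  assumes "complete_system I e" shows "card I \<le> jrank"
proof -
  have "card (e ` I) \<le> jrank"
    unfolding jrank_def using jrank_set complete_system_image[OF assms] by (intro Max_ge) auto
  then show ?thesis using card_image[OF complete_system_inj[OF assms]] by simp
qed

lemma jrank_attained: "\<exists>F. complete_system F (\<lambda>x. x) \<and> card F = jrank"
  using Max_in[OF jrank_set] unfolding jrank_def by auto

text \<open>The two summands of p lie in its 1-space, hence are orthogonal to the other members,
  which lie in its 0-space. Both inherit the coefficient of p, so the represented element is
  unchanged.\<close>

lemma complete_system_split:
  assumes F: "complete_system F (\<lambda>x. x)" and p: "p \<in> F" "\<not> primitive_idempotent m p"
  shows "\<exists>G d. complete_system G (\<lambda>x. x) \<and> card G = Suc (card F) \<and>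
    (\<Sum>e\<in>G. d e *\<^sub>R e) = (\<Sum>e\<in>F. c e *\<^sub>R e)"
proof -
  have pp: "p \<odot> p = p" "p \<noteq> 0" and fin: "finite F" using complete_systemD[OF F] p by blast+
  then obtain q r where qr: "q \<odot> q = q" "r \<odot> r = r" "q \<noteq> 0" "r \<noteq> 0" "q \<odot> r = 0" "p = q + r"
    using p(2) unfolding primitive_idempotent_def idempotent_def by blast
  have rq: "r \<odot> q = 0" using qr mult_commute by metis
  have pq: "p \<odot> q = q" and pr: "p \<odot> r = r" using qr rq by (simp_all add: mult_distribs)
  have "q \<noteq> r" using qr by auto
  have ps: "p \<odot> s = 0" if "s \<in> F - {p}" for s using complete_systemD(4)[OF F p(1)] that by auto
  have qs: "q \<odot> s = 0" "s \<odot> q = 0" and rs: "r \<odot> s = 0" "s \<odot> r = 0" if "s \<in> F - {p}" for s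
    using peirce_1_0[OF pp(1) pq ps[OF that]] peirce_1_0[OF pp(1) pr ps[OF that]] mult_commute by metis+
  have notin: "q \<notin> F - {p}" "r \<notin> F - {p}" using ps pq pr qr by force+
  let ?G = "insert q (insert r (F - {p}))"
  have card: "card ?G = Suc (card F)"
    using fin notin \<open>q \<noteq> r\<close> p(1) card_gt_0_iff[of F] by auto
  let ?d = "\<lambda>e. if e = q \<or> e = r then c p else c e"
  have "(\<Sum>e\<in>F - {p}. ?d e *\<^sub>R e) = (\<Sum>e\<in>F - {p}. c e *\<^sub>R e)"
    using notin by (intro sum.cong) auto
  then have sum_d: "(\<Sum>e\<in>?G. ?d e *\<^sub>R e) = (\<Sum>e\<in>F. c e *\<^sub>R e)"
    using fin notin \<open>q \<noteq> r\<close> p(1) qr(6)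
    by (simp add: sum.remove[of F p] scaleR_add_right add.assoc)
  have sum_u: "(\<Sum>e\<in>?G. e) = u"
    using fin notin \<open>q \<noteq> r\<close> p(1) qr(6) complete_systemD(5)[OF F]
    by (simp add: sum.remove[of F p] add.assoc)
  have "complete_system ?G (\<lambda>x. x)"
    unfolding complete_system_def sum_u
    using fin qr rq qs rs complete_systemD[OF F] by auto
  with card sum_d show ?thesis by (intro exI[of _ ?G] exI[of _ ?d]) simp
qed

text \<open>Among the systems in which x is a combination take one with the most members: splitting
  a member that is not primitive would enlarge it.\<close>

lemma frame_decomposition_set:
  "\<exists>F c. complete_system F (\<lambda>x. x) \<and> (\<forall>e\<in>F. primitive_idempotent m e) \<and> x = (\<Sum>e\<in>F. c e *\<^sub>R e)"
proof -
  let ?P = "\<lambda>F. complete_system F (\<lambda>x. x) \<and> (\<exists>c. x = (\<Sum>e\<in>F. c e *\<^sub>R e))"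
  obtain S e where e: "complete_system S e" "x = (\<Sum>a\<in>S. a *\<^sub>R e a)"
    using spectral_decomposition by blast
  have "x = (\<Sum>v\<in>e ` S. inv_into S e v *\<^sub>R v)"
    using complete_system_inj[OF e(1)] e(2) by (simp add: sum.reindex)
  then have "?P (e ` S)" using complete_system_image[OF e(1)] by blast
  moreover have "\<forall>F. ?P F \<longrightarrow> card F < Suc jrank"
    using card_le_jrank by (metis less_Suc_eq_le)
  ultimately obtain F where F: "?P F" and max: "\<forall>G. ?P G \<longrightarrow> card G \<le> card F"
    using ex_has_greatest_nat[of ?P "e ` S" card "Suc jrank"] by auto
  then obtain c where c: "x = (\<Sum>e\<in>F. c e *\<^sub>R e)" by blast
  have "primitive_idempotent m p" if pF: "p \<in> F" for p
  proof (rule ccontr)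
    assume np: "\<not> primitive_idempotent m p"
    obtain G d where G: "complete_system G (\<lambda>x. x)" "card G = Suc (card F)"
        "(\<Sum>e\<in>G. d e *\<^sub>R e) = (\<Sum>e\<in>F. c e *\<^sub>R e)"
      using complete_system_split[OF conjunct1[OF F] pF np, of c] by (elim exE conjE)
    then have "card G \<le> card F" using max c by metis
    then show False using G(2) by simp
  qed
  with F c show ?thesis by blast
qed

lemma jordan_frame_iff:
  "jordan_frame m u n p \<longleftrightarrow> complete_system {..<n} p \<and> (\<forall>i<n. primitive_idempotent m (p i))"
  by (auto simp: jordan_frame_def complete_system_def primitive_idempotent_def idempotent_def)

lemma primitive_if_card_jrank:
  assumes e: "complete_system I e" "card I = jrank" and i: "i \<in> I"
  shows "primitive_idempotent m (e i)"
proof (rule ccontr)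
  assume "\<not> ?thesis"
  then obtain G where "complete_system G (\<lambda>x. x)" "card G = Suc (card (e ` I))"
    using complete_system_split[OF complete_system_image[OF e(1)]] i by blast
  then show False
    using card_le_jrank[of G "\<lambda>x. x"] e(2) card_image[OF complete_system_inj[OF e(1)]] by simp
qed

lemma primitive_sum_singleton:
  assumes e: "complete_system I e" and J: "J \<subseteq> I" and prim: "primitive_idempotent m (\<Sum>i\<in>J. e i)"
  shows "\<exists>i. J = {i}"
proof -
  have "J \<noteq> {}" using prim by (auto simp: primitive_idempotent_def)
  then obtain i where i: "i \<in> J" by blast
  have fin: "finite J" using J complete_systemD(1)[OF e] finite_subset by blast
  have "J - {i} = {}"
  proof (rule ccontr)
    assume ne: "J - {i} \<noteq> {}"
    let ?r = "\<Sum>j\<in>J - {i}. e j"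
    have iI: "i \<in> I" and sub: "J - {i} \<subseteq> I" using i J by auto
    have "?r \<odot> ?r = ?r" "?r \<noteq> 0"
      using complete_system_sum_idempotent[OF e sub] complete_system_sum_nonzero[OF e sub ne] by auto
    moreover have "e i \<odot> ?r = 0"
      using complete_system_mult[OF e iI sub, of "\<lambda>_. 1"] by simp
    moreover have "(\<Sum>j\<in>J. e j) = e i + ?r" using fin i by (rule sum.remove)
    ultimately show False
      using prim complete_systemD(2,3)[OF e iI]
      unfolding primitive_idempotent_def idempotent_def by blast
  qed
  then show ?thesis using i by blast
qed

section \<open>Compactness of complete systems\<close>

lemma complete_system_limit:
  fixes e :: "nat \<Rightarrow> 'i \<Rightarrow> 'a"
  assumes e: "\<And>k. complete_system I (e k)" and lim: "\<And>i. i \<in> I \<Longrightarrow> (\<lambda>k. e k i) \<longlonglongrightarrow> p i"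
  shows "complete_system I p"
proof -
  have "finite I" using e[of 0] by (rule complete_systemD)
  moreover have "p i \<odot> p i = p i" if "i \<in> I" for i
  proof -
    have "(\<lambda>k. e k i \<odot> e k i) \<longlonglongrightarrow> p i \<odot> p i" using lim[OF that] by (intro tendsto_intros)
    then show ?thesis
      using complete_systemD(2)[OF e that] lim[OF that] LIMSEQ_unique by auto
  qed
  \<comment> \<open>The only condition that is not closed; it survives the limit by the uniform
    lower bound 1 for \<open>tau\<close>.\<close>
  moreover have "p i \<noteq> 0" if "i \<in> I" for i
  proof -
    have "(\<lambda>k. tau (e k i) u) \<longlonglongrightarrow> tau (p i) u" using lim[OF that] by (intro tendsto_intros)
    moreover have "1 \<le> tau (e k i) u" for k
      using tau_idempotent_unit_ge_1 complete_systemD(2,3)[OF e that] by blast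
    ultimately have "1 \<le> tau (p i) u" by (intro LIMSEQ_le_const) auto
    then show ?thesis by auto
  qed
  moreover have "p i \<odot> p j = 0" if "i \<in> I" "j \<in> I" "i \<noteq> j" for i j
  proof -
    have "(\<lambda>k. e k i \<odot> e k j) \<longlonglongrightarrow> p i \<odot> p j" using lim that by (intro tendsto_intros) auto
    then show ?thesis using complete_systemD(4)[OF e that] by (simp add: LIMSEQ_const_iff)
  qed
  moreover have "(\<Sum>i\<in>I. p i) = u"
  proof -
    have "(\<lambda>k. \<Sum>i\<in>I. e k i) \<longlonglongrightarrow> (\<Sum>i\<in>I. p i)" using lim by (intro tendsto_sum) auto
    then show ?thesis using complete_systemD(5)[OF e] by (simp add: LIMSEQ_const_iff)
  qed
  ultimately show ?thesis by (simp add: complete_system_def)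
qed

lemma tau_coercive: "\<exists>\<delta>>0. \<forall>x. \<delta> * (norm x)\<^sup>2 \<le> tau x x"
proof -
  have "compact (sphere (0::'a) 1)" "sphere (0::'a) 1 \<noteq> {}" by (auto simp: sphere_eq_empty)
  moreover have "continuous_on (sphere (0::'a) 1) (\<lambda>x. tau x x)" by (intro continuous_intros)
  ultimately obtain z where z: "z \<in> sphere 0 1" "\<forall>x\<in>sphere 0 1. tau z z \<le> tau x x"
    using continuous_attains_inf by blast
  have "z \<noteq> 0" using z(1) by auto
  then have pos: "0 < tau z z" using tau_self_nonneg[of z] tau_self_zeroD[of z] by fastforce
  have "tau z z * (norm x)\<^sup>2 \<le> tau x x" for x
  proof (cases "x = 0")
    case False
    then have "tau z z \<le> tau ((1 / norm x) *\<^sub>R x) ((1 / norm x) *\<^sub>R x)" using z(2) by auto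
    also have "\<dots> = tau x x / (norm x)\<^sup>2" by (simp add: tau_distribs power2_eq_square)
    finally show ?thesis using False by (simp add: field_simps)
  qed simp
  with pos show ?thesis by blast
qed

lemma bounded_if_tau_bounded:
  assumes "\<And>x. x \<in> X \<Longrightarrow> tau x x \<le> B" shows "bounded X"
proof -
  obtain \<delta> where \<delta>: "\<delta> > 0" "\<And>x. \<delta> * (norm x)\<^sup>2 \<le> tau x x" using tau_coercive by blast
  have "norm x \<le> sqrt (B / \<delta>)" if "x \<in> X" for x
  proof (rule real_le_rsqrt)
    show "(norm x)\<^sup>2 \<le> B / \<delta>"
      using \<delta>(2)[of x] assms[OF that] \<delta>(1) by (simp add: field_simps)
  qed
  then show ?thesis unfolding bounded_iff by blast
qed

text \<open>Both c and \<open>u - c\<close> lie in the cone, so \<open>tau c c = tau c u\<close> is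
  at most \<open>tau u u\<close>.\<close>

lemma bounded_idempotents: "bounded {c. c \<odot> c = c}"
proof (rule bounded_if_tau_bounded)
  fix c assume "c \<in> {c. c \<odot> c = c}"
  then have c: "c \<odot> c = c" by simp
  have "0 \<le> tau (u - c) u"
    using tau_cone_nonneg[OF idempotent_in_cone idempotent_in_cone, OF complement_idempotent[OF c], of u] by simp
  then show "tau c c \<le> tau u u" using tau_idempotent_self[OF c] by (simp add: tau_distribs)
qed

lemma complete_systems_subsequence:
  fixes e :: "nat \<Rightarrow> 'i \<Rightarrow> 'a"
  assumes e: "\<And>k. complete_system I (e k)"
  shows "\<exists>s p. strict_mono s \<and> (\<forall>i\<in>I. (\<lambda>k. e (s k) i) \<longlonglongrightarrow> p i) \<and> complete_system I p"
proof -
  have bnd: "bounded (range (\<lambda>k. e k i))" if "i \<in> I" for i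
    by (rule bounded_subset[OF bounded_idempotents]) (use complete_systemD(2)[OF e that] in auto)
  have "\<exists>s p. strict_mono s \<and> (\<forall>i\<in>I. (\<lambda>k. e (s k) i) \<longlonglongrightarrow> p i)"
    by (rule bounded_common_subsequence[OF complete_systemD(1)[OF e] bnd])
  then obtain s p where s: "strict_mono s" "\<forall>i\<in>I. (\<lambda>k. e (s k) i) \<longlonglongrightarrow> p i"
    by (elim exE conjE)
  moreover have "complete_system I p"
    by (rule complete_system_limit[where e = "\<lambda>k. e (s k)", OF e]) (use s(2) in blast)
  ultimately show ?thesis by (intro exI conjI)
qed

section \<open>All primitive systems have the same size\<close>

lemma polynomial_function_jordan_mult:
  assumes "polynomial_function f" "polynomial_function g"
  shows "polynomial_function (\<lambda>t. f t \<odot> g t)"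
proof -
  have "(\<lambda>t. f t \<odot> g t)
      = (\<lambda>t. \<Sum>i\<in>Basis. \<Sum>j\<in>Basis. ((f t \<bullet> i) * (g t \<bullet> j)) *\<^sub>R (i \<odot> j))"
  proof
    fix t
    have "f t \<odot> g t = (\<Sum>i\<in>Basis. (f t \<bullet> i) *\<^sub>R i) \<odot> (\<Sum>j\<in>Basis. (g t \<bullet> j) *\<^sub>R j)"
      by (simp add: euclidean_representation)
    also have "\<dots> = (\<Sum>i\<in>Basis. \<Sum>j\<in>Basis. ((f t \<bullet> i) * (g t \<bullet> j)) *\<^sub>R (i \<odot> j))"
      by (simp add: mult_sum_left mult_sum_right mult_distribs scaleR_sum_right)
        (subst sum.swap, simp add: mult.commute)
    finally show "f t \<odot> g t = (\<Sum>i\<in>Basis. \<Sum>j\<in>Basis. ((f t \<bullet> i) * (g t \<bullet> j)) *\<^sub>R (i \<odot> j))" .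
  qed
  moreover have "polynomial_function (\<lambda>t. (f t \<bullet> i) * (g t \<bullet> j))" for i j
  proof -
    have "polynomial_function (\<lambda>t. (f t \<bullet> i) *\<^sub>R (g t \<bullet> j))"
      using assms by (intro polynomial_function_mult polynomial_function_inner) auto
    then show ?thesis by simp
  qed
  ultimately show ?thesis
    by (auto intro!: polynomial_function_sum polynomial_function_mult)
qed

lemma polynomial_function_jpow:
  "polynomial_function (\<lambda>t. jpow (y + t *\<^sub>R d) n)"
proof (induction n)
  case (Suc n)
  have "polynomial_function (\<lambda>t. y + t *\<^sub>R d)"
    by (intro polynomial_function_add polynomial_function_mult) auto
  then show ?case using Suc by (auto intro: polynomial_function_jordan_mult)
qed simp

text \<open>A relation among the powers below r is a polynomial of degree less than r that vanishes
  at the r distinct eigenvalues.\<close>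

lemma distinct_combination_powers_independent:
  assumes e: "complete_system {..<r} e" and "(\<Sum>i<r. c i *\<^sub>R jpow (\<Sum>i<r. real i *\<^sub>R e i) i) = 0"
  shows "\<forall>i<r. c i = 0"
proof -
  let ?x = "\<Sum>i<r. real i *\<^sub>R e i" and ?q = "\<Sum>i<r. monom (c i) i"
  have "ev ?x ?q = 0" using assms(2) by (simp add: ev_sum ev_monom)
  then have zero: "(\<Sum>i<r. poly ?q (real i) *\<^sub>R e i) = 0" by (simp add: ev_complete_system[OF e])
  have root: "poly ?q (real i) = 0" if "i < r" for i
    using complete_system_mult[OF e, of i "{..<r}" "\<lambda>i. poly ?q (real i)"] zero that
      complete_systemD(3)[OF e] by auto
  have "?q = 0"
  proof (cases "r = 0")
    case False
    have "degree ?q \<le> r - 1"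
      by (rule degree_sum_le) (auto intro: order_trans[OF degree_monom_le])
    then have "degree ?q < card (real ` {..<r})"
      using False by (simp add: card_image)
    then show ?thesis
      using root by (intro poly_eqI_degree[of "real ` {..<r}"]) auto
  qed simp
  then have "coeff ?q i = 0" for i by simp
  then show ?thesis by (simp add: coeff_sum if_distrib sum.delta' cong: if_cong) (metis lessThan_iff)
qed

text \<open>Perturbing \<open>y = \<Sum>j j f\<^sub>j\<close> slightly towards an element with \<open>jrank\<close> distinct eigenvalues
  gives elements with \<open>jrank\<close> distinct eigenvalues; a limit of their spectral idempotents refines
  the system of the \<open>f\<^sub>j\<close>, hence agrees with it if these are primitive.\<close>
theorem card_primitive_system:
  assumes f: "complete_system I f" and prim: "\<And>i. i \<in> I \<Longrightarrow> primitive_idempotent m (f i)"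
  shows "card I = jrank"
proof -
  define r where "r = jrank"
  define k where "k = card I"
  obtain h where h: "bij_betw h {..<k} I"
    using complete_systemD(1)[OF f] ex_bij_betw_nat_finite[of I] by (auto simp: k_def atLeast0LessThan)
  define q where "q j = f (h j)" for j
  have q: "complete_system {..<k} q" unfolding q_def using complete_system_reindex[OF h] f by blast
  have qprim: "primitive_idempotent m (q j)" if "j < k" for j
    unfolding q_def using prim bij_betwE[OF h] that by auto
  obtain G where G: "complete_system G (\<lambda>x. x)" "card G = r" using jrank_attained r_def by blast
  then obtain p where p: "bij_betw p {..<r} G"
    using complete_systemD(1)[OF G(1)] ex_bij_betw_nat_finite[of G] by (auto simp: atLeast0LessThan)
  have pcs: "complete_system {..<r} p" using complete_system_reindex[OF p, of "\<lambda>x. x"] G(1) by simp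
  define x where "x = (\<Sum>i<r. real i *\<^sub>R p i)"
  define y where "y = (\<Sum>j<k. real j *\<^sub>R q j)"
  \<comment> \<open>The line from y at parameter 0 to x at parameter 1. Dependence of the first r
    powers fails at 1, hence at all but finitely many parameters.\<close>
  define z where "z t = y + t *\<^sub>R (x - y)" for t
  define bad where "bad = {t. \<exists>c. (\<Sum>i<r. c i *\<^sub>R jpow (z t) i) = 0 \<and> (\<exists>i<r. c i \<noteq> 0)}"
  have "finite bad"
    unfolding bad_def z_def
  proof (rule finite_dependent_polynomial_family[of _ _ 1])
    show "polynomial_function (\<lambda>t. jpow (y + t *\<^sub>R (x - y)) i)" for i
      by (rule polynomial_function_jpow)
    show "\<forall>i<r. c i = 0" if "(\<Sum>i<r. c i *\<^sub>R jpow (y + 1 *\<^sub>R (x - y)) i) = 0" for c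
      using distinct_combination_powers_independent[OF pcs, of c] that by (simp add: x_def)
  qed
  have decomp: "\<exists>E l. complete_system {..<r} E \<and> z t = (\<Sum>i<r. l i *\<^sub>R E i)" if "t \<notin> bad" for t
  proof -
    obtain S e where e: "complete_system S e" and zt: "z t = (\<Sum>a\<in>S. a *\<^sub>R e a)"
      using spectral_decomposition by blast
    have fin: "finite S" using complete_systemD(1)[OF e] .
    \<comment> \<open>With fewer than r eigenvalues, the product of the linear factors would be a
      relation among the first r powers.\<close>
    have "r \<le> card S"
    proof (rule ccontr)
      assume less: "\<not> ?thesis"
      let ?s = "\<Prod>a\<in>S. [:- a, 1:]"
      have deg: "degree ?s = card S" using fin by (simp add: degree_prod_eq_sum_degree)
      have "ev (z t) ?s = (\<Sum>a\<in>S. poly ?s a *\<^sub>R e a)" unfolding zt by (rule ev_complete_system[OF e])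
      also have "\<dots> = 0" using fin by (intro sum.neutral) (auto simp: poly_prod)
      finally have "(\<Sum>i<r. coeff ?s i *\<^sub>R jpow (z t) i) = 0"
        using ev_degree_less_sum[of ?s r "z t"] deg less by simp
      moreover have "coeff ?s (card S) \<noteq> 0"
      proof -
        have "?s \<noteq> 0" using fin by (simp add: prod_zero_iff)
        then show ?thesis using deg by (metis leading_coeff_neq_0)
      qed
      ultimately show False using that less unfolding bad_def by auto
    qed
    then have card: "card S = r" using card_le_jrank[OF e] r_def by simp
    obtain l where l: "bij_betw l {..<r} S"
      using ex_bij_betw_nat_finite[OF fin] card by (auto simp: atLeast0LessThan)
    have "z t = (\<Sum>i<r. l i *\<^sub>R e (l i))"
      unfolding zt using sum.reindex_bij_betw[OF l, of "\<lambda>a. a *\<^sub>R e a"] by simp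
    moreover have "complete_system {..<r} (\<lambda>i. e (l i))"
      using complete_system_reindex[OF l] e by blast
    ultimately show ?thesis by blast
  qed
  obtain t where t: "t \<longlonglongrightarrow> 0" "\<And>n. t n \<notin> bad"
  proof -
    have "eventually (\<lambda>t. \<forall>b\<in>bad. t \<noteq> b) (at (0::real))"
      using \<open>finite bad\<close> by (intro eventually_ball_finite) (auto simp: eventually_neq_at_within)
    then have "eventually (\<lambda>t. t \<notin> bad) (at (0::real))"
      by (rule eventually_mono) auto
    moreover have "filterlim (\<lambda>n. inverse (real (Suc n))) (at 0) sequentially"
      using LIMSEQ_inverse_real_of_nat by (simp add: filterlim_at)
    ultimately have "eventually (\<lambda>n. inverse (real (Suc n)) \<notin> bad) sequentially"
      by (rule eventually_compose_filterlim)
    then obtain N where N: "\<And>n. n \<ge> N \<Longrightarrow> inverse (real (Suc n)) \<notin> bad"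
      by (auto simp: eventually_sequentially)
    then show thesis
      by (intro that[OF LIMSEQ_ignore_initial_segment[OF LIMSEQ_inverse_real_of_nat, of N]] N) simp
  qed
  obtain E l where El: "\<And>n. complete_system {..<r} (E n)" "\<And>n. z (t n) = (\<Sum>i<r. l n i *\<^sub>R E n i)"
    using decomp[OF t(2)] by metis
  obtain s E0 where s: "strict_mono s" "\<forall>i\<in>{..<r}. (\<lambda>n. E (s n) i) \<longlonglongrightarrow> E0 i" and E0: "complete_system {..<r} E0"
    using complete_systems_subsequence[of "{..<r}" E] El(1) by blast
  have "(\<lambda>n. t (s n)) \<longlonglongrightarrow> 0" using LIMSEQ_subseq_LIMSEQ[OF t(1) s(1)] by (simp add: o_def)
  then have zlim: "(\<lambda>n. z (t (s n))) \<longlonglongrightarrow> y" unfolding z_def by (auto intro!: tendsto_eq_intros)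
  \<comment> \<open>Convergence of the idempotents alone does not give that of the coefficients; it
    follows by expressing each as a quotient with denominator at least 1.\<close>
  define l0 where "l0 i = tau y (E0 i) / tau (E0 i) u" for i
  have pos: "1 \<le> tau (E0 i) u" if "i < r" for i
    using tau_idempotent_unit_ge_1 complete_systemD(2,3)[OF E0] that by blast
  have llim: "(\<lambda>n. l (s n) i) \<longlonglongrightarrow> l0 i" if "i < r" for i
  proof -
    have "1 \<le> tau (E (s n) i) u" for n
      using tau_idempotent_unit_ge_1 complete_systemD(2,3)[OF El(1)] that by blast
    then have "l (s n) i = tau (z (t (s n))) (E (s n) i) / tau (E (s n) i) u" for n
      using tau_combination[OF El(1)[of "s n"], of i "l (s n)"] that El(2)[of "s n"]
      by (metis divide_eq_eq lessThan_iff not_one_le_zero)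
    moreover have "(\<lambda>n. tau (z (t (s n))) (E (s n) i) / tau (E (s n) i) u) \<longlonglongrightarrow> l0 i"
      unfolding l0_def using zlim s(2) that pos[OF that] by (intro tendsto_intros) auto
    ultimately show ?thesis by simp
  qed
  have "(\<lambda>n. z (t (s n))) \<longlonglongrightarrow> (\<Sum>i<r. l0 i *\<^sub>R E0 i)"
    unfolding El(2) using llim s(2) by (intro tendsto_intros) auto
  with zlim have "y = (\<Sum>i<r. l0 i *\<^sub>R E0 i)" using LIMSEQ_unique by blast
  then have eq: "(\<Sum>i<r. l0 i *\<^sub>R E0 i) = (\<Sum>j<k. real j *\<^sub>R q j)" by (simp add: y_def)
  \<comment> \<open>The coefficients of the q j in y are distinct, so the spectral idempotent for j
    is q j itself. It is the sum of a block of E0, and primitivity allows only one member per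
    block.\<close>
  have single: "\<exists>i. {i\<in>{..<r}. l0 i = real j} = {i}" if "j < k" for j
  proof (rule primitive_sum_singleton[OF E0])
    have "{j'\<in>{..<k}. real j' = real j} = {j}" using that by auto
    then have "(\<Sum>i\<in>{i\<in>{..<r}. l0 i = real j}. E0 i) = q j"
      using spectral_unique[OF E0 q eq, of "real j"] by simp
    then show "primitive_idempotent m (\<Sum>i\<in>{i\<in>{..<r}. l0 i = real j}. E0 i)" using qprim[OF that] by simp
  qed auto
  have "l0 ` {..<r} = real ` {..<k}" using spectral_values_unique[OF E0 q eq] .
  then have cover: "{..<r} = (\<Union>j\<in>{..<k}. {i\<in>{..<r}. l0 i = real j})" by auto
  have "card {..<r} = (\<Sum>j<k. card {i\<in>{..<r}. l0 i = real j})"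
    by (subst cover, rule card_UN_disjoint) auto
  also have "\<dots> = (\<Sum>j<k. 1)" using single by (intro sum.cong) (auto simp: card_1_singleton_iff)
  finally show ?thesis by (simp add: r_def k_def)
qed

lemma jordan_frame_card: "jordan_frame m u n p \<Longrightarrow> n = jrank"
  using card_primitive_system[of "{..<n}" p] by (simp add: jordan_frame_iff)

lemma jordan_frame_if_complete_system: "complete_system {..<jrank} p \<Longrightarrow> jordan_frame m u jrank p"
  by (simp add: jordan_frame_iff primitive_if_card_jrank)

theorem frame_decomposition:
  "\<exists>p c. jordan_frame m u jrank p \<and> x = (\<Sum>i<jrank. c i *\<^sub>R p i)"
proof -
  obtain F c where F: "complete_system F (\<lambda>x. x)" "\<forall>e\<in>F. primitive_idempotent m e" "x = (\<Sum>e\<in>F. c e *\<^sub>R e)"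
    using frame_decomposition_set by blast
  then have "card F = jrank" using card_primitive_system by blast
  then obtain p where p: "bij_betw p {..<jrank} F"
    using ex_bij_betw_nat_finite[OF complete_systemD(1)[OF F(1)]] by (auto simp: atLeast0LessThan)
  have "complete_system {..<jrank} p" using complete_system_reindex[OF p, of "\<lambda>x. x"] F(1) by simp
  moreover have "x = (\<Sum>i<jrank. c (p i) *\<^sub>R p i)"
    unfolding F(3) using sum.reindex_bij_betw[OF p, of "\<lambda>e. c e *\<^sub>R e"] by simp
  ultimately show ?thesis
    using jordan_frame_if_complete_system[of p] by (intro exI[of _ p] exI[of _ "\<lambda>i. c (p i)"]) simp
qed

section \<open>Eigenvalues, multiplicities and the trace\<close>

lemma jspectrum_combination:
  assumes "jordan_frame m u n p"
  shows "jspectrum m u (\<Sum>i<n. c i *\<^sub>R p i) = c ` {..<n}"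
proof -
  have "d ` {..<k} = c ` {..<n}"
    if "jordan_frame m u k q" "(\<Sum>i<n. c i *\<^sub>R p i) = (\<Sum>i<k. d i *\<^sub>R q i)" for k q d
    using spectral_values_unique[of "{..<n}" p "{..<k}" q c d] that assms by (simp add: jordan_frame_iff)
  then show ?thesis using assms unfolding jspectrum_def by blast
qed

text \<open>The members of p and of q with coefficient l have the same sum E. Exchanging this part
  of p for that of q gives another primitive system, which has as many members as p.\<close>

lemma multiplicity_unique:
  assumes p: "jordan_frame m u n p" and q: "jordan_frame m u k q"
    and eq: "(\<Sum>i<n. c i *\<^sub>R p i) = (\<Sum>j<k. d j *\<^sub>R q j)"
  shows "card {i\<in>{..<n}. c i = l} = card {j\<in>{..<k}. d j = l}"
proof -
  have cp: "complete_system {..<n} p" and cq: "complete_system {..<k} q"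
    using p q by (auto simp: jordan_frame_iff)
  let ?A = "{i\<in>{..<n}. c i = l}" and ?A' = "{i\<in>{..<n}. c i \<noteq> l}" and ?B = "{j\<in>{..<k}. d j = l}"
  let ?E = "\<Sum>i\<in>?A. p i"
  have E: "?E = (\<Sum>j\<in>?B. q j)" by (rule spectral_unique[OF cp cq eq])
  have EE: "?E \<odot> ?E = ?E" by (rule complete_system_sum_idempotent[OF cp]) auto
  have Ep: "?E \<odot> p i = 0" if "i \<in> ?A'" for i
    using complete_system_mult[OF cp, of i ?A "\<lambda>_. 1"] that mult_commute by auto
  have Eq: "?E \<odot> q j = q j" if "j \<in> ?B" for j
    using complete_system_mult[OF cq, of j ?B "\<lambda>_. 1"] that mult_commute E by auto
  have qp: "q j \<odot> p i = 0" "p i \<odot> q j = 0" if "i \<in> ?A'" "j \<in> ?B" for i j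
    using peirce_1_0[OF EE Eq[OF that(2)] Ep[OF that(1)]] mult_commute by metis+
  \<comment> \<open>A disjoint sum of indices, since the same number may index members taken from p
    and from q.\<close>
  let ?I = "?B <+> ?A'" and ?e = "case_sum q p"
  have "(\<Sum>s\<in>?I. ?e s) = (\<Sum>j\<in>?B. q j) + (\<Sum>i\<in>?A'. p i)"
    by (simp add: sum.Plus)
  also have "\<dots> = (\<Sum>i\<in>?A \<union> ?A'. p i)"
    unfolding E[symmetric] by (subst sum.union_disjoint) auto
  also have "?A \<union> ?A' = {..<n}" by auto
  finally have "(\<Sum>s\<in>?I. ?e s) = u" using complete_systemD(5)[OF cp] by simp
  then have "complete_system ?I ?e"
    using qp complete_systemD[OF cp] complete_systemD[OF cq]
    unfolding complete_system_def by (auto split: sum.splits)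
  moreover have "primitive_idempotent m (?e s)" if "s \<in> ?I" for s
    using p q that by (auto simp: jordan_frame_iff)
  ultimately have "card ?I = jrank" by (rule card_primitive_system)
  then have "card ?B + card ?A' = n" using jordan_frame_card[OF p] by (simp add: card_Plus)
  moreover have "card ?A + card ?A' = card (?A \<union> ?A')" by (rule card_Un_disjoint[symmetric]) auto
  moreover have "?A \<union> ?A' = {..<n}" by auto
  ultimately show ?thesis by simp
qed

text \<open>Regrouping by eigenvalue expresses the sum through the eigenvalues and their
  multiplicities, which do not depend on the frame.\<close>

lemma jtrace_combination:
  assumes p: "jordan_frame m u n p"
  shows "jtrace m u (\<Sum>i<n. c i *\<^sub>R p i) = (\<Sum>i<n. c i)"
proof -
  have "(\<Sum>j<k. d j) = (\<Sum>i<n. c i)"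
    if q: "jordan_frame m u k q" and eq: "(\<Sum>i<n. c i *\<^sub>R p i) = (\<Sum>j<k. d j *\<^sub>R q j)" for k q d
  proof -
    have img: "c ` {..<n} = d ` {..<k}"
      using spectral_values_unique[of "{..<n}" p "{..<k}" q c d] p q eq by (simp add: jordan_frame_iff)
    have count: "(\<Sum>i<n. b i) = (\<Sum>l\<in>b ` {..<n}. l * card {i\<in>{..<n}. b i = l})" for b :: "nat \<Rightarrow> real" and n
    proof -
      have "(\<Sum>i<n. b i) = (\<Sum>l\<in>b ` {..<n}. \<Sum>i\<in>{i\<in>{..<n}. b i = l}. b i)"
        by (rule sum.image_gen) simp
      also have "\<dots> = (\<Sum>l\<in>b ` {..<n}. l * card {i\<in>{..<n}. b i = l})"
        by (intro sum.cong refl) (simp add: mult.commute)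
      finally show ?thesis .
    qed
    show ?thesis unfolding count[of c] count[of d] img multiplicity_unique[OF p q eq] ..
  qed
  then show ?thesis using p unfolding jtrace_def by (intro some_equality) blast+
qed

lemma jrank_pos: "0 < jrank"
proof -
  obtain p where "jordan_frame m u jrank p" using frame_decomposition by blast
  then show ?thesis using complete_system_nonempty[of "{..<jrank}" p] by (auto simp: jordan_frame_iff)
qed

lemma Tu_translate: "\<exists>a. x + a *\<^sub>R u \<in> Tu m u"
proof -
  obtain p c where p: "jordan_frame m u jrank p" and x: "x = (\<Sum>i<jrank. c i *\<^sub>R p i)"
    using frame_decomposition by blast
  define a where "a = - (\<Sum>i<jrank. c i) / jrank"
  have "x + a *\<^sub>R u = (\<Sum>i<jrank. (c i + a) *\<^sub>R p i)"
    unfolding x using complete_systemD(5)[of "{..<jrank}" p] p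
    by (simp add: jordan_frame_iff scaleR_add_left sum.distrib flip: scaleR_sum_right)
  then have "jtrace m u (x + a *\<^sub>R u) = (\<Sum>i<jrank. c i + a)"
    using jtrace_combination[OF p] by simp
  also have "\<dots> = 0" unfolding sum.distrib a_def using jrank_pos by simp
  finally show ?thesis unfolding Tu_def by blast
qed

end


context formally_real_jordan_algebra
begin

section \<open>States and support functions\<close>

text \<open>The normalized positive functionals on \<open>U_p(A)\<close>, represented through
  \<open>tau\<close> by elements of its cone.\<close>

definition states :: "'a \<Rightarrow> 'a set" where
  "states p = {y \<in> cone. p \<odot> y = y \<and> tau y u = 1}"

definition support :: "'a \<Rightarrow> 'a \<Rightarrow> real" where
  "support p z = Sup ((\<lambda>y. tau y z) ` states p)"

lemma continuous_on_jordan_mult [continuous_intros]: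
  "continuous_on S f \<Longrightarrow> continuous_on S g \<Longrightarrow> continuous_on S (\<lambda>x. f x \<odot> g x)"
  by (rule bounded_bilinear.continuous_on[OF bounded_bilinear_mult])

text \<open>The numbers \<open>l * tau (e l) u\<close> are weights with sum 1, and
  \<open>tau (e l) u \<ge> 1\<close> gives \<open>l \<le> 1\<close>; \<open>tau y y\<close> is the
  weighted mean of the eigenvalues l.\<close>

lemma tau_state_le_1:
  assumes "y \<in> states p" shows "tau y y \<le> 1"
proof -
  have y: "y \<in> cone" "tau y u = 1" using assms by (auto simp: states_def)
  obtain S e where e: "complete_system S e" and yS: "y = (\<Sum>l\<in>S. l *\<^sub>R e l)"
    using spectral_decomposition by blast
  have fin: "finite S" using complete_systemD(1)[OF e] .
  have pos: "1 \<le> tau (e l) u" if "l \<in> S" for l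
    by (rule tau_idempotent_unit_ge_1[OF complete_systemD(2,3)[OF e that]])
  have nonneg: "0 \<le> l" if "l \<in> S" for l
    using combination_in_coneD[OF e that, of "\<lambda>l. l"] yS
      tau_cone_nonneg[OF y(1) idempotent_in_cone[OF complete_systemD(2)[OF e that]]] by simp
  have sum1: "(\<Sum>l\<in>S. l * tau (e l) u) = 1"
    using y(2) unfolding yS by (simp add: tau_sum_left tau_distribs)
  have le1: "l \<le> 1" if "l \<in> S" for l
  proof -
    have "l \<le> l * tau (e l) u" using pos[OF that] nonneg[OF that] by (simp add: mult_le_cancel_left1)
    also have "\<dots> \<le> (\<Sum>l\<in>S. l * tau (e l) u)"
      using fin that nonneg pos by (intro member_le_sum) (force intro: mult_nonneg_nonneg order_trans[OF zero_le_one])+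
    finally show ?thesis using sum1 by simp
  qed
  have "tau y y = (\<Sum>l\<in>S. l * tau y (e l))"
    by (subst (2) yS) (simp add: tau_sum_right tau_distribs)
  also have "\<dots> = (\<Sum>l\<in>S. l * (l * tau (e l) u))"
    using tau_combination[OF e, of _ "\<lambda>l. l"] yS by (intro sum.cong) auto
  also have "\<dots> \<le> (\<Sum>l\<in>S. l * tau (e l) u)"
  proof (rule sum_mono)
    fix l assume l: "l \<in> S"
    have "0 \<le> l * tau (e l) u" using nonneg[OF l] pos[OF l] by (intro mult_nonneg_nonneg) auto
    then show "l * (l * tau (e l) u) \<le> l * tau (e l) u"
      using le1[OF l] by (simp add: mult_left_le_one_le nonneg[OF l])
  qed
  finally show ?thesis using sum1 by simp
qed

lemma compact_states: "compact (states p)"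
proof -
  have "states p = cone \<inter> {y. p \<odot> y = y} \<inter> {y. tau y u = 1}" by (auto simp: states_def)
  moreover have "closed {y. p \<odot> y = y}" "closed {y. tau y u = 1}"
    by (intro closed_Collect_eq continuous_intros)+
  ultimately have "closed (states p)" using closed_cone by auto
  moreover have "bounded (states p)" using tau_state_le_1 by (rule bounded_if_tau_bounded)
  ultimately show ?thesis by (simp add: compact_eq_bounded_closed)
qed

lemma normalize_state:
  assumes "y \<in> cone" "p \<odot> y = y" "0 < tau y u"
  shows "(1 / tau y u) *\<^sub>R y \<in> states p"
  using assms by (auto simp: states_def cone_scaleR mult_distribs tau_distribs)

lemma states_nonempty:
  assumes "p \<odot> p = p" "p \<noteq> 0" shows "states p \<noteq> {}"
  using normalize_state[OF idempotent_in_cone, of p p] tau_idempotent_unit_ge_1[OF assms] assms by auto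

lemma bounded_tau_states: "bounded ((\<lambda>y. tau y z) ` states p)"
  by (intro compact_imp_bounded compact_continuous_image continuous_intros compact_states)

lemma tau_le_support: "y \<in> states p \<Longrightarrow> tau y z \<le> support p z"
  unfolding support_def
  by (intro cSup_upper bounded_imp_bdd_above bounded_tau_states) auto

lemma support_attained:
  assumes "p \<odot> p = p" "p \<noteq> 0"
  shows "\<exists>y\<in>states p. support p z = tau y z"
proof -
  have "continuous_on (states p) (\<lambda>y. tau y z)" by (intro continuous_intros)
  then obtain y where y: "y \<in> states p" "\<forall>y'\<in>states p. tau y' z \<le> tau y z"
    using continuous_attains_sup[OF compact_states states_nonempty[OF assms]] by blast
  have "support p z = tau y z"
    unfolding support_def using y by (intro cSup_eq_maximum) auto
  with y show ?thesis by blast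
qed

lemma tau_state_projection:
  assumes "y \<in> states p" shows "tau y (p \<odot> z) = tau y z"
  using assms tau_mult_swap[of p y z] by (simp add: states_def)

lemma tau_state_unit: "y \<in> states p \<Longrightarrow> tau y u = 1"
  by (simp add: states_def)

lemma support_cong:
  assumes "\<And>y. y \<in> states p \<Longrightarrow> tau y z = tau y w" shows "support p z = support p w"
  unfolding support_def using assms by (metis (no_types, lifting) image_cong)

text \<open>Cone duality inside \<open>U_p(A)\<close>: z lies below \<open>l *\<^sub>R p\<close>
  exactly if no state exceeds l on z. The set whose infimum is taken is therefore a closed
  half-line.\<close>

lemma jLambda_eq_support:
  assumes p: "p \<odot> p = p" "p \<noteq> 0" and z: "p \<odot> z = z"
  shows "jLambda m p z = support p z"
proof -
  have "jle m z (l *\<^sub>R p) \<longleftrightarrow> support p z \<le> l" for l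
  proof
    assume "jle m z (l *\<^sub>R p)"
    then have c: "l *\<^sub>R p - z \<in> cone" by (simp add: jle_iff)
    obtain y where y: "y \<in> states p" "support p z = tau y z" using support_attained[OF p] by blast
    have "y \<in> cone" using y(1) by (simp add: states_def)
    then have "0 \<le> tau y (l *\<^sub>R p - z)" using c by (rule tau_cone_nonneg)
    also have "\<dots> = l - tau y z"
      using tau_state_projection[OF y(1), of u] tau_state_unit[OF y(1)] by (simp add: tau_distribs)
    finally show "support p z \<le> l" using y(2) by simp
  next
    assume l: "support p z \<le> l"
    have "l *\<^sub>R p - z \<in> cone"
    proof (rule cone_dualI)
      fix c assume c: "c \<odot> c = c"
      \<comment> \<open>The tested element lies in \<open>U_p(A)\<close>, so an arbitrary test
        idempotent may be compressed to it and then normalized to a state; if its trace is 0, the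
        compression is 0.\<close>
      let ?w = "Uop m p c"
      have w: "?w \<in> cone" "p \<odot> ?w = ?w"
        using Uop_cone[OF p(1) idempotent_in_cone[OF c]] mult_Uop[OF p(1)] by auto
      have "Uop m p (l *\<^sub>R p - z) = l *\<^sub>R p - z"
        using p z by (intro Uop_fixed) (simp_all add: mult_distribs)
      then have eq: "tau (l *\<^sub>R p - z) c = tau (l *\<^sub>R p - z) ?w"
        using tau_Uop[OF p(1), of "l *\<^sub>R p - z" c] by simp
      show "0 \<le> tau (l *\<^sub>R p - z) c"
      proof (cases "tau ?w u = 0")
        case True
        then have "?w \<odot> u = 0" by (intro mult_eq_0_if_tau_eq_0 w) simp
        then show ?thesis using eq by simp
      next
        case False
        moreover have "0 \<le> tau ?w u"
          by (rule tau_cone_nonneg[OF w(1) idempotent_in_cone]) simp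
        ultimately have pos: "0 < tau ?w u" by simp
        have st: "(1 / tau ?w u) *\<^sub>R ?w \<in> states p" by (rule normalize_state[OF w pos])
        have "tau ((1 / tau ?w u) *\<^sub>R ?w) z \<le> l"
          using tau_le_support[OF st] l by (rule order_trans)
        then have "tau ?w z \<le> l * tau ?w u" using pos by (simp add: tau_distribs field_simps)
        moreover have "tau ?w p = tau ?w u" using w(2) tau_mult_swap[of p ?w u] by simp
        ultimately show ?thesis unfolding eq
          by (simp add: tau_distribs tau_commute[of _ ?w])
      qed
    qed
    then show "jle m z (l *\<^sub>R p)" by (simp add: jle_iff)
  qed
  then have "{l. jle m z (l *\<^sub>R p)} = {support p z..}" by auto
  then show ?thesis by (simp add: jLambda_def)
qed

text \<open>States supported on the idempotent take the same value on v and on its compression. From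
  here on \<open>Uop\<close> disappears from the formula for horofunctions.\<close>

lemma jLambda_Uop_combination:
  assumes e: "complete_system N p" and I: "I \<subseteq> N" "I \<noteq> {}"
  shows "jLambda m (\<Sum>i\<in>I. p i) (Uop m (\<Sum>i\<in>I. p i) v + (\<Sum>i\<in>I. c i *\<^sub>R p i))
    = support (\<Sum>i\<in>I. p i) (v + (\<Sum>i\<in>I. c i *\<^sub>R p i))"
proof -
  let ?p = "\<Sum>i\<in>I. p i" and ?c = "\<Sum>i\<in>I. c i *\<^sub>R p i"
  have p: "?p \<odot> ?p = ?p" "?p \<noteq> 0"
    using complete_system_sum_idempotent[OF e I(1)] complete_system_sum_nonzero[OF e I] by auto
  have "?p \<odot> ?c = ?c"
    using complete_system_mult_sums[OF e I(1) I(1), of "\<lambda>_. 1" c] by simp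
  then have "jLambda m ?p (Uop m ?p v + ?c) = support ?p (Uop m ?p v + ?c)"
    using mult_Uop[OF p(1)] by (intro jLambda_eq_support p) (simp add: mult_distribs)
  also have "\<dots> = support ?p (v + ?c)"
  proof (rule support_cong)
    fix y assume y: "y \<in> states ?p"
    then have "tau y (Uop m ?p v) = tau y v"
      using tau_Uop[OF p(1), of y v] Uop_fixed[OF p(1), of y] by (simp add: states_def)
    then show "tau y (Uop m ?p v + ?c) = tau y (v + ?c)" by (simp add: tau_distribs)
  qed
  finally show ?thesis .
qed

lemma support_translate:
  assumes "p \<odot> p = p" "p \<noteq> 0"
  shows "support p (z + a *\<^sub>R u) = support p z + a"
proof (rule antisym)
  obtain y where "y \<in> states p" "support p (z + a *\<^sub>R u) = tau y (z + a *\<^sub>R u)"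
    using support_attained[OF assms] by blast
  then show "support p (z + a *\<^sub>R u) \<le> support p z + a"
    using tau_le_support[of y p z] by (simp add: tau_distribs tau_state_unit)
next
  obtain y where "y \<in> states p" "support p z = tau y z"
    using support_attained[OF assms] by blast
  then show "support p z + a \<le> support p (z + a *\<^sub>R u)"
    using tau_le_support[of y p "z + a *\<^sub>R u"] by (simp add: tau_distribs tau_state_unit)
qed

lemma support_unit_translate: "support u (z + a *\<^sub>R u) = support u z + a"
  by (simp add: support_translate unit_nonzero)

lemma support_add_le: "support u (z + w) \<le> support u z + support u w"
proof -
  obtain y where "y \<in> states u" "support u (z + w) = tau y (z + w)"
    using support_attained[of u] unit_nonzero by auto
  then show ?thesis using tau_le_support[of y u z] tau_le_support[of y u w] by (simp add: tau_distribs)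
qed

lemma support_unit_bound: "\<exists>C>0. \<forall>z. support u z \<le> C * norm z"
proof -
  obtain B where B: "\<And>y. y \<in> states u \<Longrightarrow> norm y \<le> B"
    using compact_imp_bounded[OF compact_states[of u]] unfolding bounded_iff by blast
  obtain K where K: "K > 0" "\<And>x y. norm (tau x y) \<le> norm x * norm y * K"
    using bounded_bilinear.pos_bounded[OF bounded_bilinear_tau] by blast
  have "support u z \<le> (\<bar>B\<bar> * K + 1) * norm z" for z
  proof -
    obtain y where y: "y \<in> states u" "support u z = tau y z"
      using support_attained[of u] unit_nonzero by auto
    have "tau y z \<le> norm y * norm z * K" using K(2)[of y z] by simp
    also have "\<dots> \<le> \<bar>B\<bar> * norm z * K"
      using B[OF y(1)] K(1) by (intro mult_right_mono) auto
    also have "\<dots> \<le> (\<bar>B\<bar> * K + 1) * norm z" by (simp add: algebra_simps)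
    finally show ?thesis using y(2) by simp
  qed
  moreover have "0 < \<bar>B\<bar> * K + 1" using K(1) by (simp add: add_nonneg_pos)
  ultimately show ?thesis by blast
qed

section \<open>The variation norm through support functions\<close>

lemma support_complete_system:
  assumes e: "complete_system I e"
  shows "support u (\<Sum>i\<in>I. c i *\<^sub>R e i) = Max (c ` I)"
proof (rule antisym)
  let ?x = "\<Sum>i\<in>I. c i *\<^sub>R e i"
  have fin: "finite I" and ne: "I \<noteq> {}" using complete_systemD(1)[OF e] complete_system_nonempty[OF e] by auto
  obtain y where y: "y \<in> states u" "support u ?x = tau y ?x"
    using support_attained[of u] unit_nonzero by auto
  have yc: "y \<in> cone" and y1: "tau y u = 1" using y(1) by (auto simp: states_def)
  have "tau y ?x = (\<Sum>i\<in>I. c i * tau y (e i))" by (simp add: tau_sum_right tau_distribs)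
  also have "\<dots> \<le> (\<Sum>i\<in>I. Max (c ` I) * tau y (e i))"
    using fin tau_cone_nonneg[OF yc idempotent_in_cone[OF complete_systemD(2)[OF e]]]
    by (intro sum_mono mult_right_mono) auto
  also have "\<dots> = Max (c ` I) * tau y (\<Sum>i\<in>I. e i)" by (simp add: tau_sum_right sum_distrib_left)
  also have "\<dots> = Max (c ` I)" using complete_systemD(5)[OF e] y1 by simp
  finally show "support u ?x \<le> Max (c ` I)" using y(2) by simp
  have "Max (c ` I) \<in> c ` I" using fin ne by (intro Max_in) auto
  then obtain i where i: "i \<in> I" "c i = Max (c ` I)" by auto
  have ei: "e i \<odot> e i = e i" "e i \<noteq> 0" using complete_systemD(2,3)[OF e i(1)] by auto
  have pos: "0 < tau (e i) u" using tau_idempotent_unit_ge_1[OF ei] by simp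
  have "(1 / tau (e i) u) *\<^sub>R e i \<in> states u"
    using pos by (intro normalize_state idempotent_in_cone ei) auto
  from tau_le_support[OF this, of ?x] show "Max (c ` I) \<le> support u ?x"
    using tau_combination[OF e i(1), of c] i(2) pos by (simp add: tau_distribs tau_commute[of "e i"])
qed

lemma Max_uminus:
  fixes c :: "'i \<Rightarrow> real"
  assumes "finite I" "I \<noteq> {}" shows "Max ((\<lambda>i. - c i) ` I) = - Min (c ` I)"
  using minus_Min_eq_Max[of "c ` I"] assms by (simp add: image_image)

lemma varnorm_eq_support: "varnorm m u w = support u w + support u (- w)"
proof -
  obtain p c where p: "jordan_frame m u jrank p" and w: "w = (\<Sum>i<jrank. c i *\<^sub>R p i)"
    using frame_decomposition by blast
  have e: "complete_system {..<jrank} p" using p by (simp add: jordan_frame_iff)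
  have "support u (- w) = Max ((\<lambda>i. - c i) ` {..<jrank})"
    using support_complete_system[OF e, of "\<lambda>i. - c i"] by (simp add: w sum_negf)
  then have "support u (- w) = - Min (c ` {..<jrank})"
    using Max_uminus[of "{..<jrank}" c] jrank_pos by (simp add: lessThan_empty_iff)
  then show ?thesis
    using support_complete_system[OF e, of c] jspectrum_combination[OF p, of c] by (simp add: varnorm_def w)
qed

lemma varnorm_combination:
  assumes e: "complete_system I e"
  shows "varnorm m u (\<Sum>i\<in>I. c i *\<^sub>R e i) = Max (c ` I) - Min (c ` I)"
  using support_complete_system[OF e, of "\<lambda>i. - c i"] support_complete_system[OF e, of c]
    Max_uminus[of I c] complete_systemD(1)[OF e] complete_system_nonempty[OF e]
  by (simp add: varnorm_eq_support sum_negf)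

lemma varnorm_translate: "varnorm m u (w + a *\<^sub>R u) = varnorm m u w"
  using support_unit_translate[of w a] support_unit_translate[of "- w" "- a"]
  by (simp add: varnorm_eq_support)

lemma varnorm_minus: "varnorm m u (- w) = varnorm m u w"
  by (simp add: varnorm_eq_support)

lemma varnorm_add_le: "varnorm m u (v + w) \<le> varnorm m u v + varnorm m u w"
  using support_add_le[of v w] support_add_le[of "- v" "- w"] by (simp add: varnorm_eq_support)

lemma varnorm_bound: "\<exists>C>0. \<forall>z. varnorm m u z \<le> C * norm z"
proof -
  obtain C where "C > 0" and C: "\<And>z. support u z \<le> C * norm z" using support_unit_bound by blast
  have "varnorm m u z \<le> 2 * C * norm z" for z
    using C[of z] C[of "- z"] by (simp add: varnorm_eq_support)
  with \<open>C > 0\<close> show ?thesis by (intro exI[of _ "2 * C"]) auto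
qed

lemma varnorm_diff_le: "\<bar>varnorm m u v - varnorm m u w\<bar> \<le> varnorm m u (v - w)"
  using varnorm_add_le[of "v - w" w] varnorm_add_le[of "w - v" v] varnorm_minus[of "v - w"] by simp

lemma tendsto_varnorm:
  assumes "(x \<longlongrightarrow> y) F" shows "((\<lambda>k. varnorm m u (x k)) \<longlongrightarrow> varnorm m u y) F"
proof -
  obtain C where C: "C > 0" "\<And>z. varnorm m u z \<le> C * norm z" using varnorm_bound by blast
  have "((\<lambda>k. C * norm (x k - y)) \<longlongrightarrow> C * norm (y - y)) F" using assms by (intro tendsto_intros)
  then have "((\<lambda>k. C * norm (x k - y)) \<longlongrightarrow> 0) F" by simp
  then have "((\<lambda>k. varnorm m u (x k) - varnorm m u y) \<longlongrightarrow> 0) F"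
    by (rule Lim_null_comparison[rotated]) (simp add: order_trans[OF varnorm_diff_le C(2)])
  then show ?thesis by (simp add: LIM_zero_cancel)
qed

lemma gfun_translate: "gfun m u (w + a *\<^sub>R u) v = gfun m u w v"
  using varnorm_translate[of "v - w" "- a"] by (simp add: gfun_def varnorm_translate diff_diff_eq)

lemma gfun_lipschitz: "\<bar>gfun m u w v - gfun m u w v'\<bar> \<le> varnorm m u (v - v')"
  using varnorm_diff_le[of "v - w" "v' - w"] by (simp add: gfun_def)

lemma tendsto_gfun:
  assumes "(x \<longlongrightarrow> y) F" shows "((\<lambda>k. gfun m u (x k) v) \<longlongrightarrow> gfun m u y v) F"
  unfolding gfun_def using assms by (intro tendsto_diff tendsto_varnorm tendsto_const)

text \<open>For the upper bound, states maximizing along the sequence cannot charge a direction whose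
  coefficient tends to minus infinity, so every limit of them is a state of \<open>A(p\<^sub>I)\<close>.\<close>
lemma support_limit:
  fixes P :: "nat \<Rightarrow> 'i \<Rightarrow> 'a"
  assumes P: "\<And>k. complete_system N (P k)" and lim: "\<And>i. i \<in> N \<Longrightarrow> (\<lambda>k. P k i) \<longlonglongrightarrow> p i"
    and I: "I \<subseteq> N" "I \<noteq> {}"
    and conv: "\<And>i. i \<in> I \<Longrightarrow> (\<lambda>k. c k i) \<longlonglongrightarrow> c' i"
    and bot: "\<And>i. i \<in> N - I \<Longrightarrow> filterlim (\<lambda>k. c k i) at_bot sequentially"
  shows "(\<lambda>k. support u (v + (\<Sum>i\<in>N. c k i *\<^sub>R P k i)))
    \<longlonglongrightarrow> support (\<Sum>i\<in>I. p i) (v + (\<Sum>i\<in>I. c' i *\<^sub>R p i))"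
proof -
  let ?pI = "\<Sum>i\<in>I. p i"
  define R where "R = support ?pI (v + (\<Sum>i\<in>I. c' i *\<^sub>R p i))"
  have p: "complete_system N p" using P lim by (rule complete_system_limit)
  have fin: "finite N" "finite I" using complete_systemD(1)[OF p] I finite_subset by auto
  have pI: "?pI \<odot> ?pI = ?pI" "?pI \<noteq> 0"
    using complete_system_sum_idempotent[OF p I(1)] complete_system_sum_nonzero[OF p I] by auto
  define X where "X k = v + (\<Sum>i\<in>N. c k i *\<^sub>R P k i)" for k
  have tauX: "tau y (X k) = tau y v + (\<Sum>i\<in>I. c k i * tau y (P k i)) + (\<Sum>i\<in>N - I. c k i * tau y (P k i))" for y k
    using fin I by (simp add: X_def tau_distribs tau_sum_right sum.subset_diff)
  have "(\<lambda>k. support u (X k)) \<longlonglongrightarrow> R"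
  proof (rule order_tendstoI)
    fix a assume "a < R"
    obtain y where y: "y \<in> states ?pI" "R = tau y (v + (\<Sum>i\<in>I. c' i *\<^sub>R p i))"
      using support_attained[OF pI] unfolding R_def by blast
    have yc: "y \<in> cone" "?pI \<odot> y = y" "tau y u = 1" using y(1) by (auto simp: states_def)
    define Q where "Q k = (\<Sum>i\<in>I. P k i)" for k
    \<comment> \<open>The maximizing state y is adapted to the limit system only. Its compression by
      \<open>Q k\<close> annihilates all \<open>P k i\<close> outside I, so the diverging
      coefficients drop out; it converges to y and is normalized below.\<close>
    define w where "w k = Uop m (Q k) y" for k
    have Q: "Q k \<odot> Q k = Q k" for k
      unfolding Q_def by (rule complete_system_sum_idempotent[OF P I(1)])
    have Qlim: "Q \<longlonglongrightarrow> ?pI" unfolding Q_def using lim I by (intro tendsto_sum) auto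
    have "w \<longlonglongrightarrow> Uop m ?pI y"
      unfolding w_def Uop_def using Qlim by (intro tendsto_intros)
    then have wlim: "w \<longlonglongrightarrow> y" using Uop_fixed[OF pI(1) yc(2)] by simp
    have wu: "(\<lambda>k. tau (w k) u) \<longlonglongrightarrow> 1" using tendsto_tau[OF wlim tendsto_const, of u] yc(3) by simp
    have w0: "tau (w k) (P k i) = 0" if "i \<in> N - I" for i k
    proof -
      have "Q k \<odot> P k i = 0"
        using complete_system_mult[OF P _ I(1), of i k "\<lambda>_. 1"] that mult_commute by (auto simp: Q_def)
      then have "w k \<odot> P k i = 0"
        using peirce_1_0[OF Q mult_Uop[OF Q]] by (simp add: w_def)
      then show ?thesis by (metis tau_unit tau_zero(2))
    qed
    define f where "f k = (tau (w k) v + (\<Sum>i\<in>I. c k i * tau (w k) (P k i))) / tau (w k) u" for k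
    have "f \<longlonglongrightarrow> (tau y v + (\<Sum>i\<in>I. c' i * tau y (p i))) / 1"
      unfolding f_def using wu wlim conv lim I by (intro tendsto_intros) auto
    also have "(tau y v + (\<Sum>i\<in>I. c' i * tau y (p i))) / 1 = R"
      by (simp add: y(2) tau_distribs tau_sum_right)
    finally have "eventually (\<lambda>k. a < f k) sequentially" using \<open>a < R\<close> by (rule order_tendstoD)
    moreover have "eventually (\<lambda>k. 0 < tau (w k) u) sequentially"
      using wu by (rule order_tendstoD) simp
    ultimately show "eventually (\<lambda>k. a < support u (X k)) sequentially"
    proof eventually_elim
      case (elim k)
      have "w k \<in> cone" unfolding w_def by (rule Uop_cone[OF Q yc(1)])
      then have "(1 / tau (w k) u) *\<^sub>R w k \<in> states u" using elim by (intro normalize_state) auto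
      from tau_le_support[OF this, of "X k"] have "f k \<le> support u (X k)"
        by (simp add: linear_cmul[OF linear_tau_left] tauX w0 f_def add_divide_distrib sum_divide_distrib)
      with elim show ?case by simp
    qed
  next
    fix a assume a: "R < a"
    show "eventually (\<lambda>k. support u (X k) < a) sequentially"
    proof (rule ccontr)
      assume "\<not> ?thesis"
      then obtain s :: "nat \<Rightarrow> nat" where s: "strict_mono s" "\<And>k. a \<le> support u (X (s k))"
        using not_eventually_sequentiallyD by (metis not_le)
      have "\<exists>y\<in>states u. support u (X (s k)) = tau y (X (s k))" for k
        using support_attained[of u] unit_nonzero by auto
      then obtain y where y: "\<And>k. y k \<in> states u" "\<And>k. support u (X (s k)) = tau (y k) (X (s k))"
        by metis
      obtain y0 t where y0: "y0 \<in> states u" and t: "strict_mono t" and ylim: "(y \<circ> t) \<longlonglongrightarrow> y0"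
        using compact_states[of u] y(1) unfolding compact_def by blast
      define r where "r = s \<circ> t"
      define Y where "Y k = y (t k)" for k
      have r: "strict_mono r" unfolding r_def using s(1) t by (rule strict_mono_o)
      have ge: "a \<le> tau (Y k) (X (r k))" for k using s(2)[of "t k"] y(2)[of "t k"] by (simp add: Y_def r_def)
      have Ycone: "Y k \<in> cone" for k using y(1)[of "t k"] by (simp add: states_def Y_def)
      have Ylim: "Y \<longlonglongrightarrow> y0" using ylim by (simp add: Y_def[abs_def] o_def)
      have y0c: "y0 \<in> cone" "tau y0 u = 1" using y0 by (auto simp: states_def)
      have Plim: "(\<lambda>k. P (r k) i) \<longlonglongrightarrow> p i" if "i \<in> N" for i
        using LIMSEQ_subseq_LIMSEQ[OF lim[OF that] r] by (simp add: o_def)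
      have clim: "(\<lambda>k. c (r k) i) \<longlonglongrightarrow> c' i" if "i \<in> I" for i
        using LIMSEQ_subseq_LIMSEQ[OF conv[OF that] r] by (simp add: o_def)
      have cbot: "filterlim (\<lambda>k. c (r k) i) at_bot sequentially" if "i \<in> N - I" for i
        using filterlim_compose[OF bot[OF that] filterlim_subseq[OF r]] by (simp add: o_def)
      \<comment> \<open>The part of the value that stays bounded. The remaining terms are eventually
        nonpositive, as nonnegative weights with coefficients tending to minus infinity.\<close>
      define B where "B k = tau (Y k) v + (\<Sum>i\<in>I. c (r k) i * tau (Y k) (P (r k) i))" for k
      define b where "b = tau y0 v + (\<Sum>i\<in>I. c' i * tau y0 (p i))"
      have Blim: "B \<longlonglongrightarrow> b"
        unfolding B_def b_def using Ylim Plim clim I by (intro tendsto_intros) auto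
      have tauYP: "0 \<le> tau (Y k) (P (r k) i)" if "i \<in> N" for i k
        by (rule tau_cone_nonneg[OF Ycone idempotent_in_cone[OF complete_systemD(2)[OF P that]]])
      have "eventually (\<lambda>k. \<forall>i\<in>N - I. c (r k) i \<le> 0) sequentially"
        using fin cbot by (intro eventually_ball_finite) (auto simp: filterlim_at_bot)
      then have ev_nonpos: "eventually (\<lambda>k. \<forall>i\<in>N - I. c (r k) i * tau (Y k) (P (r k) i) \<le> 0) sequentially"
        by eventually_elim (use tauYP in \<open>auto simp: mult_nonpos_nonneg\<close>)
      \<comment> \<open>A positive limit weight would drive the term of i to minus infinity with no
        other term to compensate, contradicting the lower bound a.\<close>
      have "tau y0 (p i) = 0" if i: "i \<in> N - I" for i
      proof (rule ccontr)
        assume ne: "tau y0 (p i) \<noteq> 0"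
        have iN: "i \<in> N" using i by simp
        have tlim: "(\<lambda>k. tau (Y k) (P (r k) i)) \<longlonglongrightarrow> tau y0 (p i)"
          using Ylim Plim[OF iN] by (rule tendsto_tau)
        have "0 \<le> tau y0 (p i)"
          by (rule tau_cone_nonneg[OF y0c(1) idempotent_in_cone[OF complete_systemD(2)[OF p iN]]])
        with ne have "0 < tau y0 (p i)" by simp
        then have "filterlim (\<lambda>k. tau (Y k) (P (r k) i) * c (r k) i) at_bot sequentially"
          by (rule filterlim_tendsto_pos_mult_at_bot[OF tlim _ cbot[OF i]])
        then have "eventually (\<lambda>k. tau (Y k) (P (r k) i) * c (r k) i \<le> a - b - 1) sequentially"
          by (simp add: filterlim_at_bot)
        moreover have "eventually (\<lambda>k. B k < b + 1) sequentially"
          using Blim by (rule order_tendstoD) simp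
        ultimately have "eventually (\<lambda>k. False) sequentially"
          using ev_nonpos
        proof eventually_elim
          case (elim k)
          have "(\<Sum>j\<in>N - I. c (r k) j * tau (Y k) (P (r k) j))
              = c (r k) i * tau (Y k) (P (r k) i) + (\<Sum>j\<in>N - I - {i}. c (r k) j * tau (Y k) (P (r k) j))"
            using fin i by (intro sum.remove) auto
          also have "(\<Sum>j\<in>N - I - {i}. c (r k) j * tau (Y k) (P (r k) j)) \<le> 0"
            using elim(3) by (intro sum_nonpos) auto
          finally have "tau (Y k) (X (r k)) \<le> B k + tau (Y k) (P (r k) i) * c (r k) i"
            by (simp add: tauX B_def mult.commute)
          with elim(1,2) ge[of k] show ?case by simp
        qed
        then show False by simp
      qed
      then have "tau y0 (\<Sum>i\<in>N - I. p i) = 0" by (simp add: tau_sum_right)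
      then have "y0 \<odot> (\<Sum>i\<in>N - I. p i) = 0"
        by (intro mult_eq_0_if_tau_eq_0 y0c complete_system_sum_idempotent[OF p]) auto
      \<comment> \<open>No weight outside I means that y0 annihilates the complement of ?pI, hence
        is fixed by ?pI.\<close>
      moreover have "u = ?pI + (\<Sum>i\<in>N - I. p i)"
        using complete_systemD(5)[OF p] fin I sum.subset_diff[of I N p] by (simp add: add.commute)
      ultimately have "?pI \<odot> y0 = y0"
        by (metis add.right_neutral mult_commute mult_distribs(1) unit_right)
      then have "y0 \<in> states ?pI" using y0c by (simp add: states_def)
      from tau_le_support[OF this, of "v + (\<Sum>i\<in>I. c' i *\<^sub>R p i)"] have "b \<le> R"
        by (simp add: R_def b_def tau_distribs tau_sum_right)
      moreover have "eventually (\<lambda>k. a \<le> B k) sequentially"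
        using ev_nonpos
      proof eventually_elim
        case (elim k)
        then have "(\<Sum>j\<in>N - I. c (r k) j * tau (Y k) (P (r k) j)) \<le> 0" by (intro sum_nonpos) auto
        then show ?case using ge[of k] by (simp add: tauX B_def)
      qed
      then have "a \<le> b" using Blim by (intro tendsto_lowerbound) auto
      ultimately show False using a by simp
    qed
  qed
  then show ?thesis by (simp add: X_def R_def)
qed

end


section \<open>Horofunctions\<close>

lemma tendsto_fun_componentwise:
  fixes f :: "'b \<Rightarrow> 'i \<Rightarrow> 'c::topological_space"
  assumes "\<And>i. ((\<lambda>k. f k i) \<longlongrightarrow> l i) F"
  shows "(f \<longlongrightarrow> l) F"
proof -
  have "limitin (product_topology (\<lambda>_. euclidean) UNIV) f l F"
    using assms by (simp add: limitin_componentwise)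
  then show ?thesis by (simp add: euclidean_product_topology)
qed

text \<open>Sequential compactness of [0,\<infinity>], for finitely many sequences at once.\<close>

lemma nonneg_common_subsequence:
  fixes A :: "(nat \<Rightarrow> real) set"
  assumes "finite A" and nonneg: "\<And>f k. f \<in> A \<Longrightarrow> 0 \<le> f k"
  shows "\<exists>s. strict_mono s \<and>
    (\<forall>f\<in>A. (\<exists>l. (\<lambda>k. f (s k)) \<longlonglongrightarrow> l) \<or> filterlim (\<lambda>k. f (s k)) at_top sequentially)"
proof (rule common_subsequence[OF assms(1)])
  fix f and s :: "nat \<Rightarrow> nat" assume f: "f \<in> A" and s: "strict_mono s"
  show "\<exists>t. strict_mono t \<and> ((\<exists>l. (\<lambda>k. f ((s \<circ> t) k)) \<longlonglongrightarrow> l) \<or>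
    filterlim (\<lambda>k. f ((s \<circ> t) k)) at_top sequentially)"
  proof (cases "filterlim (\<lambda>k. f (s k)) at_top sequentially")
    case True
    then show ?thesis by (intro exI[of _ id]) (simp add: strict_mono_id)
  next
    case False
    then obtain Z where "\<not> eventually (\<lambda>k. Z \<le> f (s k)) sequentially" by (auto simp: filterlim_at_top)
    then obtain t :: "nat \<Rightarrow> nat" where t: "strict_mono t" "\<And>k. \<not> Z \<le> f (s (t k))"
      using not_eventually_sequentiallyD by blast
    have "norm (f (s (t k))) \<le> Z" for k using t(2)[of k] nonneg[OF f, of "s (t k)"] by simp
    then have "bounded (range (\<lambda>k. f (s (t k))))" by (auto simp: bounded_iff)
    then obtain l t' where t': "strict_mono t'" "((\<lambda>k. f (s (t k))) \<circ> t') \<longlonglongrightarrow> l"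
      using bounded_imp_convergent_subsequence by blast
    have "strict_mono (t \<circ> t')" using t(1) t'(1) by (rule strict_mono_o)
    moreover have "(\<lambda>k. f ((s \<circ> (t \<circ> t')) k)) \<longlonglongrightarrow> l" using t'(2) by (simp add: o_def)
    ultimately show ?thesis by blast
  qed
next
  fix f and s t :: "nat \<Rightarrow> nat"
  assume t: "strict_mono t"
    and "(\<exists>l. (\<lambda>k. f (s k)) \<longlonglongrightarrow> l) \<or> filterlim (\<lambda>k. f (s k)) at_top sequentially"
  then show "(\<exists>l. (\<lambda>k. f ((s \<circ> t) k)) \<longlonglongrightarrow> l) \<or> filterlim (\<lambda>k. f ((s \<circ> t) k)) at_top sequentially"
    using LIMSEQ_subseq_LIMSEQ[OF _ t, of "\<lambda>k. f (s k)"]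
      filterlim_compose[OF _ filterlim_subseq[OF t], of "\<lambda>k. f (s k)" at_top]
    by (auto simp: o_def)
qed

lemma filterlim_affine_at_bot:
  assumes "0 < b" shows "filterlim (\<lambda>k. a - b * real k) at_bot sequentially"
proof -
  have "filterlim (\<lambda>k. - a + b * real k) at_top sequentially"
    using assms
    by (intro filterlim_tendsto_add_at_top[OF tendsto_const]
        filterlim_tendsto_pos_mult_at_top[OF tendsto_const] filterlim_real_sequentially)
  then show ?thesis by (simp add: filterlim_uminus_at_bot)
qed

context formally_real_jordan_algebra
begin

section \<open>Rays and the functions they converge to\<close>

definition horo :: "('i \<Rightarrow> 'a) \<Rightarrow> 'i set \<Rightarrow> 'i set \<Rightarrow> ('i \<Rightarrow> real) \<Rightarrow> 'a \<Rightarrow> real" where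
  "horo p I J \<alpha> v = support (\<Sum>i\<in>I. p i) (- v + (\<Sum>i\<in>I. (- \<alpha> i) *\<^sub>R p i))
     + support (\<Sum>j\<in>J. p j) (v + (\<Sum>j\<in>J. (- \<alpha> j) *\<^sub>R p j))"

text \<open>The extremes move apart at speed 1/2 each, giving unit speed for the norm, and the gaps
  \<alpha> to them stay fixed. Indices outside I and J remain at 0, far from both. The ray is moved
  into \<open>Tu m u\<close> only later.\<close>

definition ray :: "('i \<Rightarrow> 'a) \<Rightarrow> 'i set \<Rightarrow> 'i set \<Rightarrow> 'i set \<Rightarrow> ('i \<Rightarrow> real) \<Rightarrow> real \<Rightarrow> 'a" where
  "ray p N I J \<alpha> t = (\<Sum>i\<in>N. (if i \<in> I then t / 2 - \<alpha> i else if i \<in> J then \<alpha> i - t / 2 else 0) *\<^sub>R p i)"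

definition horo_data :: "'i set \<Rightarrow> ('i \<Rightarrow> 'a) \<Rightarrow> 'i set \<Rightarrow> 'i set \<Rightarrow> ('i \<Rightarrow> real) \<Rightarrow> bool" where
  "horo_data N p I J \<alpha> \<longleftrightarrow> complete_system N p \<and> I \<subseteq> N \<and> J \<subseteq> N \<and> I \<inter> J = {} \<and> I \<noteq> {} \<and> J \<noteq> {} \<and>
     Min (\<alpha> ` I) = 0 \<and> Min (\<alpha> ` J) = 0"

lemma horo_dataD:
  assumes "horo_data N p I J \<alpha>"
  shows "complete_system N p" "I \<subseteq> N" "J \<subseteq> N" "I \<inter> J = {}" "I \<noteq> {}" "J \<noteq> {}"
    "finite N" "\<And>i. i \<in> I \<union> J \<Longrightarrow> 0 \<le> \<alpha> i" "\<exists>i\<in>I. \<alpha> i = 0" "\<exists>j\<in>J. \<alpha> j = 0"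
proof -
  show d: "complete_system N p" "I \<subseteq> N" "J \<subseteq> N" "I \<inter> J = {}" "I \<noteq> {}" "J \<noteq> {}"
    using assms by (auto simp: horo_data_def)
  show "finite N" using d complete_systemD(1) by blast
  then have fin: "finite I" "finite J" using d finite_subset by blast+
  have mins: "Min (\<alpha> ` I) = 0" "Min (\<alpha> ` J) = 0" using assms by (auto simp: horo_data_def)
  show "0 \<le> \<alpha> i" if "i \<in> I \<union> J" for i
    using that mins fin Min_le[of "\<alpha> ` I" "\<alpha> i"] Min_le[of "\<alpha> ` J" "\<alpha> i"] by auto
  show "\<exists>i\<in>I. \<alpha> i = 0" "\<exists>j\<in>J. \<alpha> j = 0"
    using mins Min_in[of "\<alpha> ` I"] Min_in[of "\<alpha> ` J"] fin d by auto
qed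

lemma jLambda_sum_eq_horo:
  assumes e: "complete_system N p" and I: "I \<subseteq> N" "I \<noteq> {}" and J: "J \<subseteq> N" "J \<noteq> {}"
  shows "jLambda m (\<Sum>i\<in>I. p i) (- Uop m (\<Sum>i\<in>I. p i) v - (\<Sum>i\<in>I. \<alpha> i *\<^sub>R p i))
       + jLambda m (\<Sum>j\<in>J. p j) (Uop m (\<Sum>j\<in>J. p j) v - (\<Sum>j\<in>J. \<alpha> j *\<^sub>R p j))
       = horo p I J \<alpha> v"
  using jLambda_Uop_combination[OF e I, of "- v" "\<lambda>i. - \<alpha> i"]
    jLambda_Uop_combination[OF e J, of v "\<lambda>i. - \<alpha> i"]
  by (simp add: horo_def linear_neg[OF linear_Uop] sum_negf)

lemma horo_translate:
  assumes "horo_data N p I J \<alpha>"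
  shows "horo p I J \<alpha> (v + a *\<^sub>R u) = horo p I J \<alpha> v"
proof -
  note d = horo_dataD[OF assms]
  have "support (\<Sum>i\<in>I. p i) (z + b *\<^sub>R u) = support (\<Sum>i\<in>I. p i) z + b"
    "support (\<Sum>i\<in>J. p i) (z + b *\<^sub>R u) = support (\<Sum>i\<in>J. p i) z + b" for z b
    using complete_system_sum_idempotent[OF d(1)] complete_system_sum_nonzero[OF d(1)] d
    by (simp_all add: support_translate)
  from this(1)[of "- v + (\<Sum>i\<in>I. (- \<alpha> i) *\<^sub>R p i)" "- a"] this(2)[of "v + (\<Sum>i\<in>J. (- \<alpha> i) *\<^sub>R p i)" a]
  show ?thesis by (simp add: horo_def algebra_simps)
qed

lemma varnorm_combination_eqI:
  assumes e: "complete_system N e"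
    and "\<And>i. i \<in> N \<Longrightarrow> c i \<le> M" "\<And>i. i \<in> N \<Longrightarrow> l \<le> c i"
    and "\<exists>i\<in>N. c i = M" "\<exists>i\<in>N. c i = l"
  shows "varnorm m u (\<Sum>i\<in>N. c i *\<^sub>R e i) = M - l"
proof -
  have "Max (c ` N) = M" "Min (c ` N) = l"
    using assms complete_systemD(1)[OF e] by (auto intro!: Max_eqI Min_eqI)
  then show ?thesis using varnorm_combination[OF e] by simp
qed

text \<open>Before t reaches every \<alpha> i, a coefficient may overshoot the opposite end of the
  interval from -t/2 to t/2. Differences along the ray are free of \<alpha> and satisfy the
  analogous equation for all parameters.\<close>

lemma varnorm_ray:
  assumes d: "horo_data N p I J \<alpha>" and t: "\<And>i. i \<in> I \<union> J \<Longrightarrow> \<alpha> i \<le> t"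
  shows "varnorm m u (ray p N I J \<alpha> t) = t"
proof -
  note d = horo_dataD[OF d]
  obtain i j where ij: "i \<in> I" "\<alpha> i = 0" "j \<in> J" "\<alpha> j = 0" using d by blast
  have "0 \<le> t" using t[of i] ij by simp
  have "varnorm m u (ray p N I J \<alpha> t) = t / 2 - (- (t / 2))"
    unfolding ray_def
  proof (rule varnorm_combination_eqI[OF d(1)])
    show "\<exists>i\<in>N. (if i \<in> I then t / 2 - \<alpha> i else if i \<in> J then \<alpha> i - t / 2 else 0) = t / 2"
      using ij d(2) by (intro bexI[of _ i]) auto
    show "\<exists>i\<in>N. (if i \<in> I then t / 2 - \<alpha> i else if i \<in> J then \<alpha> i - t / 2 else 0) = - (t / 2)"
      using ij d(3,4) by (intro bexI[of _ j]) auto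
    fix k
    show "(if k \<in> I then t / 2 - \<alpha> k else if k \<in> J then \<alpha> k - t / 2 else 0) \<le> t / 2"
      "- (t / 2) \<le> (if k \<in> I then t / 2 - \<alpha> k else if k \<in> J then \<alpha> k - t / 2 else 0)"
      using t[of k] d(8)[of k] \<open>0 \<le> t\<close> by auto
  qed
  then show ?thesis by simp
qed

lemma varnorm_ray_diff:
  assumes d: "horo_data N p I J \<alpha>" and "s \<le> t"
  shows "varnorm m u (ray p N I J \<alpha> t - ray p N I J \<alpha> s) = t - s"
proof -
  note d = horo_dataD[OF d]
  obtain i j where ij: "i \<in> I" "j \<in> J" using d by blast
  define r where "r = (t - s) / 2"
  have r: "0 \<le> r" using assms(2) by (simp add: r_def)
  let ?c = "\<lambda>i. if i \<in> I then r else if i \<in> J then - r else 0"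
  have "ray p N I J \<alpha> t - ray p N I J \<alpha> s = (\<Sum>i\<in>N. ?c i *\<^sub>R p i)"
    unfolding ray_def sum_subtractf[symmetric] scaleR_diff_left[symmetric]
    by (intro sum.cong) (auto simp: r_def diff_divide_distrib)
  also have "varnorm m u \<dots> = r - (- r)"
  proof (rule varnorm_combination_eqI[OF d(1)])
    show "\<exists>i\<in>N. ?c i = r" using ij d(2) by (intro bexI[of _ i]) auto
    show "\<exists>i\<in>N. ?c i = - r" using ij d(3,4) by (intro bexI[of _ j]) auto
    show "?c k \<le> r" "- r \<le> ?c k" for k using r by auto
  qed
  finally show ?thesis by (simp add: r_def)
qed

text \<open>Compressed to either Peirce space, the argument of the support function is the scalar
  -t/2, because the \<alpha> of the ray cancel those in the formula.\<close>

lemma horo_ray: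
  assumes d: "horo_data N p I J \<alpha>"
  shows "horo p I J \<alpha> (ray p N I J \<alpha> t) = - t"
proof -
  note d = horo_dataD[OF d]
  let ?z = "ray p N I J \<alpha> t"
  have half: "support (\<Sum>i\<in>K. p i) (z + (\<Sum>i\<in>K. (- \<alpha> i) *\<^sub>R p i)) = - (t / 2)"
    if K: "K \<subseteq> N" "K \<noteq> {}" and z: "z = (\<Sum>i\<in>N. c i *\<^sub>R p i)" "\<And>i. i \<in> K \<Longrightarrow> c i = \<alpha> i - t / 2" for K z c
  proof -
    let ?q = "\<Sum>i\<in>K. p i"
    have q: "?q \<odot> ?q = ?q" "?q \<noteq> 0"
      using complete_system_sum_idempotent[OF d(1) K(1)] complete_system_sum_nonzero[OF d(1) K] by auto
    have "?q \<odot> (z + (\<Sum>i\<in>K. (- \<alpha> i) *\<^sub>R p i)) = ?q \<odot> z + ?q \<odot> (\<Sum>i\<in>K. (- \<alpha> i) *\<^sub>R p i)"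
      by (rule mult_distribs)
    also have "?q \<odot> z = (\<Sum>i\<in>K. c i *\<^sub>R p i)"
      using complete_system_mult_sums[OF d(1) K(1) order_refl, of "\<lambda>_. 1" c] K(1) z(1)
      by (simp add: Int_absorb2)
    also have "?q \<odot> (\<Sum>i\<in>K. (- \<alpha> i) *\<^sub>R p i) = (\<Sum>i\<in>K. (- \<alpha> i) *\<^sub>R p i)"
      using complete_system_mult_sums[OF d(1) K(1) K(1), of "\<lambda>_. 1" "\<lambda>i. - \<alpha> i"] by simp
    also have "(\<Sum>i\<in>K. c i *\<^sub>R p i) + (\<Sum>i\<in>K. (- \<alpha> i) *\<^sub>R p i) = (\<Sum>i\<in>K. (- (t / 2)) *\<^sub>R p i)"
      unfolding sum.distrib[symmetric] scaleR_add_left[symmetric] using z(2) by (intro sum.cong) auto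
    also have "\<dots> = (- (t / 2)) *\<^sub>R ?q" by (rule scaleR_sum_right[symmetric])
    finally have eq: "?q \<odot> (z + (\<Sum>i\<in>K. (- \<alpha> i) *\<^sub>R p i)) = ?q \<odot> (0 + (- (t / 2)) *\<^sub>R u)"
      by (simp add: linear_neg[OF linear_mult] linear_cmul[OF linear_mult])
    have "support ?q (z + (\<Sum>i\<in>K. (- \<alpha> i) *\<^sub>R p i)) = support ?q (0 + (- (t / 2)) *\<^sub>R u)"
    proof (rule support_cong)
      fix y assume y: "y \<in> states ?q"
      show "tau y (z + (\<Sum>i\<in>K. (- \<alpha> i) *\<^sub>R p i)) = tau y (0 + (- (t / 2)) *\<^sub>R u)"
        using tau_state_projection[OF y, of "z + (\<Sum>i\<in>K. (- \<alpha> i) *\<^sub>R p i)"]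
          tau_state_projection[OF y, of "0 + (- (t / 2)) *\<^sub>R u"]
        by (simp only: eq)
    qed
    also have "\<dots> = support ?q 0 + - (t / 2)" by (rule support_translate[OF q])
    also have "support ?q 0 = 0" using support_attained[OF q, of 0] by auto
    finally show ?thesis by simp
  qed
  have "support (\<Sum>i\<in>I. p i) (- ?z + (\<Sum>i\<in>I. (- \<alpha> i) *\<^sub>R p i)) = - (t / 2)"
    by (rule half[OF d(2,5), of _ "\<lambda>i. - (if i \<in> I then t / 2 - \<alpha> i else if i \<in> J then \<alpha> i - t / 2 else 0)"])
      (simp_all add: ray_def sum_negf)
  moreover have "support (\<Sum>i\<in>J. p i) (?z + (\<Sum>i\<in>J. (- \<alpha> i) *\<^sub>R p i)) = - (t / 2)"
    by (rule half[OF d(3,6), of _ "\<lambda>i. if i \<in> I then t / 2 - \<alpha> i else if i \<in> J then \<alpha> i - t / 2 else 0"])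
      (use d(4) in \<open>auto simp: ray_def\<close>)
  ultimately show ?thesis by (simp add: horo_def)
qed

lemma gfun_ray_limit:
  assumes d: "horo_data N p I J \<alpha>"
  shows "(\<lambda>k. gfun m u (ray p N I J \<alpha> (real k)) v) \<longlonglongrightarrow> horo p I J \<alpha> v"
proof -
  note hd = d and d = horo_dataD[OF d]
  define c where "c t i = (if i \<in> I then t / 2 - \<alpha> i else if i \<in> J then \<alpha> i - t / 2 else 0)" for t i
  have ray: "ray p N I J \<alpha> t = (\<Sum>i\<in>N. c t i *\<^sub>R p i)" for t by (simp add: ray_def c_def)
  have ray_neg: "(\<Sum>i\<in>N. (- c t i) *\<^sub>R p i) = - ray p N I J \<alpha> t" for t by (simp add: ray sum_negf)
  have shift: "(\<Sum>i\<in>N. (b i + a) *\<^sub>R p i) = (\<Sum>i\<in>N. b i *\<^sub>R p i) + a *\<^sub>R u" for a b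
    using complete_systemD(5)[OF d(1)] by (simp add: scaleR_add_left sum.distrib flip: scaleR_sum_right)
  \<comment> \<open>The norm k of the ray is shared equally: subtracting k/2 in each support
    function leaves bounded coefficients on I, respectively J, and sends all others to minus
    infinity.\<close>
  have limI: "(\<lambda>k. support u (- v + (\<Sum>i\<in>N. (c (real k) i + (- (real k / 2))) *\<^sub>R p i)))
      \<longlonglongrightarrow> support (\<Sum>i\<in>I. p i) (- v + (\<Sum>i\<in>I. (- \<alpha> i) *\<^sub>R p i))"
  proof (rule support_limit[OF d(1) tendsto_const d(2,5)])
    show "(\<lambda>k. c (real k) i + (- (real k / 2))) \<longlonglongrightarrow> - \<alpha> i" if "i \<in> I" for i
      using that by (simp add: c_def)
    show "filterlim (\<lambda>k. c (real k) i + (- (real k / 2))) at_bot sequentially" if "i \<in> N - I" for i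
      using that filterlim_affine_at_bot[of 1 "\<alpha> i"] filterlim_affine_at_bot[of "1/2" 0]
      by (cases "i \<in> J") (auto simp: c_def)
  qed
  have limJ: "(\<lambda>k. support u (v + (\<Sum>i\<in>N. (- c (real k) i + (- (real k / 2))) *\<^sub>R p i)))
      \<longlonglongrightarrow> support (\<Sum>i\<in>J. p i) (v + (\<Sum>i\<in>J. (- \<alpha> i) *\<^sub>R p i))"
  proof (rule support_limit[OF d(1) tendsto_const d(3,6)])
    show "(\<lambda>k. - c (real k) i + (- (real k / 2))) \<longlonglongrightarrow> - \<alpha> i" if "i \<in> J" for i
    proof -
      have "i \<notin> I" using that d(4) by auto
      then show ?thesis using that by (simp add: c_def)
    qed
    show "filterlim (\<lambda>k. - c (real k) i + (- (real k / 2))) at_bot sequentially" if "i \<in> N - J" for i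
      using that filterlim_affine_at_bot[of 1 "\<alpha> i"] filterlim_affine_at_bot[of "1/2" 0]
      by (cases "i \<in> I") (auto simp: c_def)
  qed
  have g: "gfun m u (ray p N I J \<alpha> (real k)) v
      = support u (- v + (\<Sum>i\<in>N. (c (real k) i + (- (real k / 2))) *\<^sub>R p i))
        + support u (v + (\<Sum>i\<in>N. (- c (real k) i + (- (real k / 2))) *\<^sub>R p i))"
    if "\<And>i. i \<in> I \<union> J \<Longrightarrow> \<alpha> i \<le> real k" for k
  proof -
    let ?r = "ray p N I J \<alpha> (real k)"
    have "support u (- v + (\<Sum>i\<in>N. (c (real k) i + (- (real k / 2))) *\<^sub>R p i)) = support u (- v + ?r) + (- (real k / 2))"
      unfolding shift ray[symmetric] add.assoc[symmetric] by (rule support_unit_translate)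
    moreover have "support u (v + (\<Sum>i\<in>N. (- c (real k) i + (- (real k / 2))) *\<^sub>R p i)) = support u (v + - ?r) + (- (real k / 2))"
      unfolding shift ray_neg add.assoc[symmetric] by (rule support_unit_translate)
    ultimately show ?thesis
      using varnorm_ray[OF hd that] by (simp add: gfun_def varnorm_eq_support[of "v - _"])
  qed
  have "eventually (\<lambda>k. \<forall>i\<in>I \<union> J. \<alpha> i \<le> real k) sequentially"
    using finite_subset[OF d(2,7)] finite_subset[OF d(3,7)] filterlim_real_sequentially
    by (intro eventually_ball_finite) (auto simp: filterlim_at_top)
  then have "eventually (\<lambda>k. support u (- v + (\<Sum>i\<in>N. (c (real k) i + (- (real k / 2))) *\<^sub>R p i))
        + support u (v + (\<Sum>i\<in>N. (- c (real k) i + (- (real k / 2))) *\<^sub>R p i))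
        = gfun m u (ray p N I J \<alpha> (real k)) v) sequentially"
  proof eventually_elim
    case (elim k)
    show ?case by (rule g[symmetric]) (use elim in blast)
  qed
  from Lim_transform_eventually[OF tendsto_add[OF limI limJ] this] show ?thesis by (simp add: horo_def)
qed

lemma horo_busemann:
  assumes d: "horo_data N p I J \<alpha>" and h: "\<And>v. v \<in> Tu m u \<Longrightarrow> h v = horo p I J \<alpha> v"
  shows "busemann_point m u h"
proof -
  note dd = horo_dataD[OF d]
  define a where "a t = (SOME a. ray p N I J \<alpha> t + a *\<^sub>R u \<in> Tu m u)" for t
  define \<gamma> where "\<gamma> t = ray p N I J \<alpha> t + a t *\<^sub>R u" for t
  have \<gamma>Tu: "\<gamma> t \<in> Tu m u" for t
    unfolding \<gamma>_def a_def by (rule someI_ex[OF Tu_translate])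
  have lim: "(\<lambda>k. gfun m u (\<gamma> (real k)) v) \<longlonglongrightarrow> horo p I J \<alpha> v" for v
    unfolding \<gamma>_def gfun_translate by (rule gfun_ray_limit[OF d])
  let ?G = "(\<lambda>w. restrict (gfun m u w) (Tu m u)) ` Tu m u"
  have "(\<lambda>k. restrict (gfun m u (\<gamma> (real k))) (Tu m u)) \<longlonglongrightarrow> restrict h (Tu m u)"
    by (rule tendsto_fun_componentwise) (auto simp: h lim)
  then have "restrict h (Tu m u) \<in> closure ?G"
    using \<gamma>Tu closure_subset[of ?G]
    by (intro Lim_in_closed_set[OF closed_closure]) (auto intro!: always_eventually)
  moreover have "restrict h (Tu m u) \<notin> ?G"
  proof
    assume "restrict h (Tu m u) \<in> ?G"
    then obtain w where w: "restrict h (Tu m u) = restrict (gfun m u w) (Tu m u)" by auto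
    \<comment> \<open>Any number beyond the norm of w works, since \<open>gfun m u w\<close> never
      falls below minus that norm.\<close>
    let ?t = "varnorm m u w + 1"
    have "horo p I J \<alpha> (\<gamma> ?t) = gfun m u w (\<gamma> ?t)"
      using fun_cong[OF w, of "\<gamma> ?t"] \<gamma>Tu h by simp
    moreover have "horo p I J \<alpha> (\<gamma> ?t) = - ?t"
      by (simp add: \<gamma>_def horo_translate[OF d] horo_ray[OF d])
    moreover have "0 \<le> varnorm m u (\<gamma> ?t - w)"
      using varnorm_diff_le[of "\<gamma> ?t" w] by linarith
    ultimately show False by (simp add: gfun_def)
  qed
  ultimately have "horofunction m u h" by (simp add: horofunction_def)
  \<comment> \<open>Natural parameters suffice and turn the limit along the path into that of a
    sequence. The path is an exact geodesic, so the threshold is 0 for every \<epsilon>.\<close>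
  moreover have "almost_geodesic m u (range real) \<gamma>"
    unfolding almost_geodesic_def
  proof (intro conjI allI impI)
    show "range real \<subseteq> {0..}" "0 \<in> range real" by auto
    show "\<not> bdd_above (range real)"
      by (auto simp: bdd_above_def) (meson not_le reals_Archimedean2)
    show "\<gamma> ` range real \<subseteq> Tu m u" using \<gamma>Tu by auto
    fix \<epsilon> :: real assume "0 < \<epsilon>"
    show "\<exists>N. \<forall>t\<in>range real. \<forall>s\<in>range real. s \<le> t \<and> N \<le> s \<longrightarrow>
        \<bar>varnorm m u (\<gamma> t - \<gamma> s) + varnorm m u (\<gamma> s - \<gamma> 0) - t\<bar> < \<epsilon>"
    proof (intro exI[of _ 0] ballI impI)
      fix t s :: real assume "s \<le> t \<and> 0 \<le> s"
      then have st: "s \<le> t" "0 \<le> s" by auto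
      have "\<gamma> t - \<gamma> s = (ray p N I J \<alpha> t - ray p N I J \<alpha> s) + (a t - a s) *\<^sub>R u" for t s
        by (simp add: \<gamma>_def algebra_simps)
      then have "varnorm m u (\<gamma> t - \<gamma> s) = t - s" "varnorm m u (\<gamma> s - \<gamma> 0) = s - 0"
        using varnorm_ray_diff[OF d] st by (simp_all add: varnorm_translate)
      then show "\<bar>varnorm m u (\<gamma> t - \<gamma> s) + varnorm m u (\<gamma> s - \<gamma> 0) - t\<bar> < \<epsilon>"
        using \<open>0 < \<epsilon>\<close> by simp
    qed
  qed
  moreover have "((\<lambda>t. gfun m u (\<gamma> t) v) \<longlongrightarrow> h v) (inf at_top (principal (range real)))"
    if v: "v \<in> Tu m u" for v
    unfolding tendsto_def
  proof (intro allI impI)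
    fix S assume "open S" "h v \<in> S"
    then have "eventually (\<lambda>k. gfun m u (\<gamma> (real k)) v \<in> S) sequentially"
      using lim[of v] h[OF v] by (simp add: tendsto_def)
    then obtain K where K: "\<And>k. K \<le> k \<Longrightarrow> gfun m u (\<gamma> (real k)) v \<in> S"
      by (auto simp: eventually_sequentially)
    show "eventually (\<lambda>t. gfun m u (\<gamma> t) v \<in> S) (inf at_top (principal (range real)))"
      unfolding eventually_inf_principal
      using eventually_ge_at_top[of "real K"] by eventually_elim (use K in auto)
  qed
  ultimately show ?thesis unfolding busemann_point_def by blast
qed

section \<open>Horofunctions as limits of sequences\<close>

lemma horofunction_approx:
  assumes "horofunction m u h" "finite F" "F \<subseteq> Tu m u" "0 < \<epsilon>"
  shows "\<exists>w\<in>Tu m u. \<forall>v\<in>F. \<bar>gfun m u w v - h v\<bar> < \<epsilon>"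
proof -
  let ?G = "(\<lambda>w. restrict (gfun m u w) (Tu m u)) ` Tu m u"
  let ?U = "\<Inter>v\<in>F. {f. \<bar>f v - h v\<bar> < \<epsilon>}"
  have "open ?U"
    using assms(2) by (intro open_INT ballI open_Collect_less continuous_intros) auto
  moreover have "restrict h (Tu m u) \<in> ?U" using assms(3,4) by auto
  moreover have "restrict h (Tu m u) \<in> closure ?G" using assms(1) by (simp add: horofunction_def)
  ultimately have "?G \<inter> ?U \<noteq> {}"
    unfolding closure_iff_nhds_not_empty by blast
  then obtain w where w: "w \<in> Tu m u" "restrict (gfun m u w) (Tu m u) \<in> ?U" by blast
  have "\<bar>gfun m u w v - h v\<bar> < \<epsilon>" if "v \<in> F" for v
  proof -
    have "\<bar>restrict (gfun m u w) (Tu m u) v - h v\<bar> < \<epsilon>" using w(2) that by blast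
    then show ?thesis using that assms(3) by (auto simp: restrict_apply')
  qed
  with w(1) show ?thesis by blast
qed

text \<open>A point of the closure gives approximation on finite sets only. Approximating on growing
  finite parts of a countable dense set is enough, as the functions share the Lipschitz constant 1
  for the variation norm.\<close>

lemma horofunction_sequence:
  assumes h: "horofunction m u h"
  shows "\<exists>w. (\<forall>k. w k \<in> Tu m u) \<and> (\<forall>v\<in>Tu m u. (\<lambda>k. gfun m u (w k) v) \<longlonglongrightarrow> h v)"
proof -
  obtain D :: "'a set" where D: "countable D" "\<And>X. open X \<Longrightarrow> X \<noteq> {} \<Longrightarrow> \<exists>d\<in>D. d \<in> X"
    by (rule countable_dense_setE) blast
  have "D \<noteq> {}" using D(2)[of UNIV] by auto
  \<comment> \<open>A dense sequence of A, moved into \<open>Tu m u\<close> along u, which the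
    variation norm does not see.\<close>
  define d where "d n = from_nat_into D n + (SOME a. from_nat_into D n + a *\<^sub>R u \<in> Tu m u) *\<^sub>R u" for n
  have dTu: "d n \<in> Tu m u" for n unfolding d_def by (rule someI_ex[OF Tu_translate])
  obtain C where C: "C > 0" "\<And>z. varnorm m u z \<le> C * norm z" using varnorm_bound by blast
  have dense: "\<exists>n. varnorm m u (v - d n) < \<epsilon>" if "0 < \<epsilon>" for v \<epsilon>
  proof -
    obtain e where e: "e \<in> D" "e \<in> ball v (\<epsilon> / C)"
    proof -
      have "0 < \<epsilon> / C" using \<open>0 < \<epsilon>\<close> C(1) by simp
      then have "ball v (\<epsilon> / C) \<noteq> {}" by (metis centre_in_ball empty_iff)
      then show thesis using D(2)[OF open_ball] that by blast
    qed
    obtain n where n: "from_nat_into D n = e"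
      using range_from_nat_into[OF \<open>D \<noteq> {}\<close> D(1)] e(1) by (metis imageE)
    define b where "b = (SOME a. e + a *\<^sub>R u \<in> Tu m u)"
    have "v - d n = (v - e) + (- b) *\<^sub>R u" by (simp add: d_def n b_def)
    then have "varnorm m u (v - d n) = varnorm m u (v - e)" by (simp only: varnorm_translate)
    also have "\<dots> \<le> C * norm (v - e)" by (rule C(2))
    also have "\<dots> < \<epsilon>" using e(2) C(1) by (simp add: dist_norm field_simps)
    finally show ?thesis by blast
  qed
  have "\<exists>w. w \<in> Tu m u \<and> (\<forall>v\<in>d ` {..k}. \<bar>gfun m u w v - h v\<bar> < inverse (real (Suc k)))" for k
    using horofunction_approx[OF h, of "d ` {..k}" "inverse (real (Suc k))"] dTu by auto
  then obtain w where w: "\<And>k. w k \<in> Tu m u"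
    "\<And>k n. n \<le> k \<Longrightarrow> \<bar>gfun m u (w k) (d n) - h (d n)\<bar> < inverse (real (Suc k))"
    by (metis atMost_iff imageI)
  have "(\<lambda>k. gfun m u (w k) v) \<longlonglongrightarrow> h v" if v: "v \<in> Tu m u" for v
  proof (rule tendstoI)
    fix \<epsilon> :: real assume "0 < \<epsilon>"
    then have e8: "0 < \<epsilon> / 8" by simp
    obtain n where n: "varnorm m u (v - d n) < \<epsilon> / 8" using dense[OF e8] by blast
    \<comment> \<open>One function close to h at both points passes its Lipschitz bound on to h, up
      to twice the error.\<close>
    obtain w' where "\<bar>gfun m u w' v - h v\<bar> < \<epsilon> / 8" "\<bar>gfun m u w' (d n) - h (d n)\<bar> < \<epsilon> / 8"
      using horofunction_approx[OF h, of "{v, d n}" "\<epsilon> / 8"] v dTu e8 by blast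
    then have hd: "\<bar>h v - h (d n)\<bar> < 3 * (\<epsilon> / 8)"
      using gfun_lipschitz[of w' v "d n"] n by linarith
    have "eventually (\<lambda>k. inverse (real (Suc k)) < \<epsilon> / 8) sequentially"
      by (rule order_tendstoD(2)[OF LIMSEQ_inverse_real_of_nat e8])
    then show "eventually (\<lambda>k. dist (gfun m u (w k) v) (h v) < \<epsilon>) sequentially"
      using eventually_ge_at_top[of n]
    proof eventually_elim
      case (elim k)
      then show ?case
        using w(2)[of n k] gfun_lipschitz[of "w k" v "d n"] n hd unfolding dist_real_def by linarith
    qed
  qed
  with w(1) show ?thesis by blast
qed

section \<open>Every horofunction has the stated form\<close>

theorem horofunction_imp_horo:
  assumes h: "horofunction m u h"
  shows "\<exists>p I J \<alpha>. horo_data {..<jrank} p I J \<alpha> \<and> (\<forall>v\<in>Tu m u. h v = horo p I J \<alpha> v)"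
proof -
  define N where "N = {..<jrank}"
  have finN: "finite N" and neN: "N \<noteq> {}" using jrank_pos by (auto simp: N_def lessThan_empty_iff)
  obtain w0 where w0: "\<forall>v\<in>Tu m u. (\<lambda>k. gfun m u (w0 k) v) \<longlonglongrightarrow> h v"
    using horofunction_sequence[OF h] by blast
  have "\<exists>p c. complete_system N p \<and> w0 k = (\<Sum>i\<in>N. c i *\<^sub>R p i)" for k
    using frame_decomposition[of "w0 k"] unfolding N_def jordan_frame_iff by blast
  then obtain P0 c0 where P0: "\<And>k. complete_system N (P0 k)" "\<And>k. w0 k = (\<Sum>i\<in>N. c0 k i *\<^sub>R P0 k i)"
    by metis
  obtain s0 p where s0: "strict_mono s0" and p0: "\<forall>i\<in>N. (\<lambda>k. P0 (s0 k) i) \<longlonglongrightarrow> p i" and p: "complete_system N p"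
    using complete_systems_subsequence[of N P0, OF P0(1)] by (elim exE conjE)
  define a0 where "a0 i k = Max (c0 (s0 k) ` N) - c0 (s0 k) i" for i k
  define b0 where "b0 i k = c0 (s0 k) i - Min (c0 (s0 k) ` N)" for i k
  define D0 where "D0 k = Max (c0 (s0 k) ` N) - Min (c0 (s0 k) ` N)" for k
  have a0: "0 \<le> a0 i k" and b0: "0 \<le> b0 i k" if "i \<in> N" for i k
    using finN that by (auto simp: a0_def b0_def)
  have D0: "0 \<le> D0 k" for k
  proof -
    obtain i where "i \<in> N" using neN by blast
    then show ?thesis using a0[of i k] b0[of i k] by (simp add: a0_def b0_def D0_def)
  qed
  have "\<exists>s. strict_mono s \<and> (\<forall>f\<in>a0 ` N \<union> b0 ` N \<union> {D0}.
      (\<exists>l. (\<lambda>k. f (s k)) \<longlonglongrightarrow> l) \<or> filterlim (\<lambda>k. f (s k)) at_top sequentially)"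
    using finN a0 b0 D0 by (intro nonneg_common_subsequence) auto
  then obtain s1 where s1: "strict_mono s1" and conv: "\<forall>f\<in>a0 ` N \<union> b0 ` N \<union> {D0}.
      (\<exists>l. (\<lambda>k. f (s1 k)) \<longlonglongrightarrow> l) \<or> filterlim (\<lambda>k. f (s1 k)) at_top sequentially"
    by blast
  define s where "s k = s0 (s1 k)" for k
  define w where "w k = w0 (s k)" for k
  define P where "P k = P0 (s k)" for k
  define a where "a i k = a0 i (s1 k)" for i k
  define b where "b i k = b0 i (s1 k)" for i k
  define D where "D k = D0 (s1 k)" for k
  define Mx where "Mx k = Max (c0 (s k) ` N)" for k
  define Mn where "Mn k = Min (c0 (s k) ` N)" for k
  have s: "strict_mono s" using strict_mono_o[OF s0 s1] by (simp add: s_def[abs_def] o_def)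
  have wh: "(\<lambda>k. gfun m u (w k) v) \<longlonglongrightarrow> h v" if "v \<in> Tu m u" for v
    using LIMSEQ_subseq_LIMSEQ[OF w0[rule_format, OF that] s] by (simp add: w_def o_def)
  have P: "complete_system N (P k)" for k unfolding P_def by (rule P0(1))
  have Plim: "(\<lambda>k. P k i) \<longlonglongrightarrow> p i" if "i \<in> N" for i
    using LIMSEQ_subseq_LIMSEQ[OF p0[rule_format, OF that] s1] by (simp add: P_def s_def o_def)
  have shift: "(\<Sum>i\<in>N. (f i + t) *\<^sub>R P k i) = (\<Sum>i\<in>N. f i *\<^sub>R P k i) + t *\<^sub>R u" for f t k
    using complete_systemD(5)[OF P] by (simp add: scaleR_add_left sum.distrib flip: scaleR_sum_right)
  have wa: "w k = (\<Sum>i\<in>N. (- a i k) *\<^sub>R P k i) + Mx k *\<^sub>R u" for k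
    unfolding shift[symmetric] by (simp add: w_def P_def P0(2) a_def a0_def Mx_def s_def)
  have wb: "w k = (\<Sum>i\<in>N. b i k *\<^sub>R P k i) + Mn k *\<^sub>R u" for k
    unfolding shift[symmetric] by (simp add: w_def P_def P0(2) b_def b0_def Mn_def s_def)
  have ab: "a i k + b i k = D k" for i k by (simp add: a_def b_def D_def a0_def b0_def D0_def)
  have nonneg: "0 \<le> a i k" "0 \<le> b i k" if "i \<in> N" for i k
    using a0[OF that] b0[OF that] by (auto simp: a_def b_def)
  have attained: "\<exists>i\<in>N. a i k = 0" "\<exists>i\<in>N. b i k = 0" for k
  proof -
    have "Max (c0 (s k) ` N) \<in> c0 (s k) ` N" "Min (c0 (s k) ` N) \<in> c0 (s k) ` N"
      using finN neN by (auto intro!: Max_in Min_in)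
    then obtain i j where "i \<in> N" "Max (c0 (s k) ` N) = c0 (s k) i" "j \<in> N" "Min (c0 (s k) ` N) = c0 (s k) j"
      by (elim imageE)
    then show "\<exists>i\<in>N. a i k = 0" "\<exists>i\<in>N. b i k = 0"
      by (auto simp: a_def b_def a0_def b0_def s_def)
  qed
  have a_alt: "(\<exists>l. a i \<longlonglongrightarrow> l) \<or> filterlim (a i) at_top sequentially"
    and b_alt: "(\<exists>l. b i \<longlonglongrightarrow> l) \<or> filterlim (b i) at_top sequentially" if "i \<in> N" for i
    using conv that by (auto simp: a_def[abs_def] b_def[abs_def])
  have D_alt: "(\<exists>l. D \<longlonglongrightarrow> l) \<or> filterlim D at_top sequentially"
    using conv by (auto simp: D_def[abs_def])
  \<comment> \<open>If the norms of the \<open>w k\<close> stayed bounded, all b would converge, and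
    modulo multiples of u so would the \<open>w k\<close>; then h would be the function
    \<open>gfun\<close> of their limit.\<close>
  have "\<not> (\<exists>l. D \<longlonglongrightarrow> l)"
  proof
    assume "\<exists>l. D \<longlonglongrightarrow> l"
    then obtain l where l: "D \<longlonglongrightarrow> l" by blast
    have "\<exists>l. b i \<longlonglongrightarrow> l" if i: "i \<in> N" for i
    proof (rule ccontr)
      assume "\<not> ?thesis"
      then have "filterlim (b i) at_top sequentially" using b_alt[OF i] by blast
      moreover have "eventually (\<lambda>k. b i k \<le> D k) sequentially"
      proof (intro always_eventually allI)
        show "b i k \<le> D k" for k using ab[of i k] nonneg(1)[OF i, of k] by simp
      qed
      ultimately have "filterlim D at_top sequentially" by (rule filterlim_at_top_mono)
      then show False using l not_tendsto_and_filterlim_at_infinity[of sequentially D l]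
          filterlim_at_top_imp_at_infinity by auto
    qed
    then obtain \<beta> where \<beta>: "\<And>i. i \<in> N \<Longrightarrow> b i \<longlonglongrightarrow> \<beta> i" by metis
    let ?x = "\<Sum>i\<in>N. \<beta> i *\<^sub>R p i"
    have xlim: "(\<lambda>k. \<Sum>i\<in>N. b i k *\<^sub>R P k i) \<longlonglongrightarrow> ?x"
      using \<beta> Plim by (intro tendsto_sum tendsto_scaleR) auto
    obtain t where t: "?x + t *\<^sub>R u \<in> Tu m u" using Tu_translate by blast
    have "h v = gfun m u (?x + t *\<^sub>R u) v" if "v \<in> Tu m u" for v
    proof -
      have "(\<lambda>k. gfun m u (w k) v) \<longlonglongrightarrow> gfun m u ?x v"
        unfolding wb gfun_translate by (rule tendsto_gfun[OF xlim])
      then show ?thesis using LIMSEQ_unique[OF wh[OF that]] gfun_translate by metis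
    qed
    then have "restrict h (Tu m u) = restrict (gfun m u (?x + t *\<^sub>R u)) (Tu m u)" by auto
    then show False using h t unfolding horofunction_def by blast
  qed
  then have Dinf: "filterlim D at_top sequentially" using D_alt by blast
  define I where "I = {i\<in>N. \<exists>l. a i \<longlonglongrightarrow> l}"
  define J where "J = {i\<in>N. \<exists>l. b i \<longlonglongrightarrow> l}"
  define \<alpha> where "\<alpha> i = (if i \<in> I then lim (a i) else lim (b i))" for i
  \<comment> \<open>No index stays close to both ends, because the two gaps add up to D, which
    diverges.\<close>
  have disj: "I \<inter> J = {}"
  proof (rule ccontr)
    assume "I \<inter> J \<noteq> {}"
    then obtain i l l' where "a i \<longlonglongrightarrow> l" "b i \<longlonglongrightarrow> l'" by (auto simp: I_def J_def)
    then have "(\<lambda>k. a i k + b i k) \<longlonglongrightarrow> l + l'" by (rule tendsto_add)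
    then have "D \<longlonglongrightarrow> l + l'" by (simp add: ab)
    then show False
      using \<open>\<not> (\<exists>l. D \<longlonglongrightarrow> l)\<close> by blast
  qed
  have aI: "a i \<longlonglongrightarrow> \<alpha> i" if "i \<in> I" for i
    using that by (auto simp: \<alpha>_def I_def limI)
  have bJ: "b i \<longlonglongrightarrow> \<alpha> i" if "i \<in> J" for i
    using that disj by (auto simp: \<alpha>_def J_def limI)
  have ainf: "filterlim (a i) at_top sequentially" if "i \<in> N - I" for i
    using a_alt that by (auto simp: I_def)
  have binf: "filterlim (b i) at_top sequentially" if "i \<in> N - J" for i
    using b_alt that by (auto simp: J_def)
  \<comment> \<open>For every k some gap is exactly 0. If no limit were 0, the finitely many gaps
    would all be positive eventually. Stated for general f, to serve both ends.\<close>
  have min_zero: "K \<noteq> {} \<and> Min (\<beta> ` K) = 0"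
    if K: "K \<subseteq> N" and f: "\<And>i. i \<in> K \<Longrightarrow> f i \<longlonglongrightarrow> \<beta> i" "\<And>i. i \<in> N - K \<Longrightarrow> filterlim (f i) at_top sequentially"
      and f0: "\<And>i k. i \<in> N \<Longrightarrow> 0 \<le> f i k" "\<And>k. \<exists>i\<in>N. f i k = 0"
    for K \<beta> and f :: "nat \<Rightarrow> nat \<Rightarrow> real"
  proof -
    have nonneg: "0 \<le> \<beta> i" if "i \<in> K" for i
      using f(1)[OF that] f0(1)[of i] K that by (intro LIMSEQ_le_const) auto
    have "\<exists>i\<in>K. \<beta> i = 0"
    proof (rule ccontr)
      assume no: "\<not> ?thesis"
      have "eventually (\<lambda>k. 0 < f i k) sequentially" if "i \<in> N" for i
      proof (cases "i \<in> K")
        case True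
        then have "0 < \<beta> i" using no nonneg[OF True] by force
        then show ?thesis using f(1)[OF True] by (intro order_tendstoD) auto
      next
        case False
        then show ?thesis using f(2)[of i] that by (simp add: filterlim_at_top_dense)
      qed
      then have "eventually (\<lambda>k. \<forall>i\<in>N. 0 < f i k) sequentially"
        using finN by (intro eventually_ball_finite) auto
      then have "eventually (\<lambda>k. False) sequentially"
      proof eventually_elim
        case (elim k)
        then show ?case using f0(2)[of k] by (metis less_irrefl)
      qed
      then show False by simp
    qed
    moreover have "finite K" using K finN finite_subset by blast
    ultimately show ?thesis using nonneg by (auto intro!: Min_eqI)
  qed
  have I: "I \<noteq> {}" "Min (\<alpha> ` I) = 0"
    using min_zero[of I a \<alpha>] aI ainf nonneg(1) attained(1) by (auto simp: I_def)
  have J: "J \<noteq> {}" "Min (\<alpha> ` J) = 0"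
    using min_zero[of J b \<alpha>] bJ binf nonneg(2) attained(2) by (auto simp: J_def)
  have data: "horo_data N p I J \<alpha>"
    using p I J disj by (auto simp: horo_data_def I_def J_def)
  have "h v = horo p I J \<alpha> v" if v: "v \<in> Tu m u" for v
  proof -
    \<comment> \<open>As D is the largest minus the smallest eigenvalue, each of these is absorbed
      by one support function, leaving the gaps as coefficients.\<close>
    have "varnorm m u (w k) = D k" for k
      using varnorm_combination[OF P, of "\<lambda>i. c0 (s k) i" k]
      by (simp add: w_def P_def P0(2) D_def D0_def s_def)
    moreover have "support u (v - w k) = support u (v + (\<Sum>i\<in>N. (- b i k) *\<^sub>R P k i)) - Mn k" for k
      using support_unit_translate[of "v + (\<Sum>i\<in>N. (- b i k) *\<^sub>R P k i)" "- Mn k"]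
      by (simp add: wb sum_negf algebra_simps)
    moreover have "support u (- (v - w k)) = support u (- v + (\<Sum>i\<in>N. (- a i k) *\<^sub>R P k i)) + Mx k" for k
      using support_unit_translate[of "- v + (\<Sum>i\<in>N. (- a i k) *\<^sub>R P k i)" "Mx k"]
      by (simp add: wa sum_negf algebra_simps)
    moreover have "D k = Mx k - Mn k" for k by (simp add: D_def D0_def Mx_def Mn_def s_def)
    ultimately have g: "gfun m u (w k) v = support u (- v + (\<Sum>i\<in>N. (- a i k) *\<^sub>R P k i))
        + support u (v + (\<Sum>i\<in>N. (- b i k) *\<^sub>R P k i))" for k
      by (simp add: gfun_def varnorm_eq_support[of "v - _"])
    have "(\<lambda>k. support u (- v + (\<Sum>i\<in>N. (- a i k) *\<^sub>R P k i)))
        \<longlonglongrightarrow> support (\<Sum>i\<in>I. p i) (- v + (\<Sum>i\<in>I. (- \<alpha> i) *\<^sub>R p i))"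
      using I(1) aI ainf by (intro support_limit[OF P Plim] tendsto_minus)
        (auto simp: I_def filterlim_uminus_at_bot)
    moreover have "(\<lambda>k. support u (v + (\<Sum>i\<in>N. (- b i k) *\<^sub>R P k i)))
        \<longlonglongrightarrow> support (\<Sum>i\<in>J. p i) (v + (\<Sum>i\<in>J. (- \<alpha> i) *\<^sub>R p i))"
      using J(1) bJ binf by (intro support_limit[OF P Plim] tendsto_minus)
        (auto simp: J_def filterlim_uminus_at_bot)
    ultimately have "(\<lambda>k. gfun m u (w k) v) \<longlonglongrightarrow> horo p I J \<alpha> v"
      unfolding g horo_def by (rule tendsto_add)
    then show ?thesis using LIMSEQ_unique[OF wh[OF v]] by blast
  qed
  with data show ?thesis unfolding N_def by blast
qed

end

theorem theorem5p3:
  fixes m :: "'a::euclidean_space \<Rightarrow> 'a \<Rightarrow> 'a" and u :: 'a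
  assumes "jordan_algebra m u"
  shows "(\<forall>h. horofunction m u h \<longleftrightarrow>
            (\<exists>n p I J \<alpha>. jordan_frame m u n p \<and>
               I \<subseteq> {..<n} \<and> J \<subseteq> {..<n} \<and> I \<inter> J = {} \<and> I \<noteq> {} \<and> J \<noteq> {} \<and>
               Min (\<alpha> ` I) = 0 \<and> Min (\<alpha> ` J) = 0 \<and>
               (\<forall>v\<in>Tu m u. h v =
                  jLambda m (\<Sum>i\<in>I. p i)
                    (- Uop m (\<Sum>i\<in>I. p i) v - (\<Sum>i\<in>I. \<alpha> i *\<^sub>R p i))
                + jLambda m (\<Sum>j\<in>J. p j)
                    (Uop m (\<Sum>j\<in>J. p j) v - (\<Sum>j\<in>J. \<alpha> j *\<^sub>R p j)))))
         \<and> (\<forall>h. horofunction m u h \<longrightarrow> busemann_point m u h)"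
proof -
  interpret formally_real_jordan_algebra m u by unfold_locales (rule assms)
  let ?f = "\<lambda>p I J \<alpha> v. jLambda m (\<Sum>i\<in>I. p i) (- Uop m (\<Sum>i\<in>I. p i) v - (\<Sum>i\<in>I. \<alpha> i *\<^sub>R p i))
    + jLambda m (\<Sum>j\<in>J. p j) (Uop m (\<Sum>j\<in>J. p j) v - (\<Sum>j\<in>J. \<alpha> j *\<^sub>R p j))"
  let ?D = "\<lambda>n p I J \<alpha>. jordan_frame m u n p \<and> I \<subseteq> {..<n} \<and> J \<subseteq> {..<n} \<and> I \<inter> J = {} \<and> I \<noteq> {} \<and> J \<noteq> {} \<and>
    Min (\<alpha> ` I) = 0 \<and> Min (\<alpha> ` J) = 0"
  have formula: "?f p I J \<alpha> v = horo p I J \<alpha> v" if "horo_data {..<n} p I J \<alpha>" for n :: nat and p I J \<alpha> v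
    using jLambda_sum_eq_horo[OF horo_dataD(1,2,5,3,6)[OF that]] .
  have busemann: "busemann_point m u h"
    if "?D n p I J \<alpha>" "\<forall>v\<in>Tu m u. h v = ?f p I J \<alpha> v" for h n p I J \<alpha>
  proof -
    have data: "horo_data {..<n} p I J \<alpha>" using that(1) by (auto simp: horo_data_def jordan_frame_iff)
    show ?thesis using that(2) by (intro horo_busemann[OF data]) (simp add: formula[OF data])
  qed
  have ex: "\<exists>n p I J \<alpha>. ?D n p I J \<alpha> \<and> (\<forall>v\<in>Tu m u. h v = ?f p I J \<alpha> v)" if h: "horofunction m u h" for h
  proof -
    obtain p I J \<alpha> where d: "horo_data {..<jrank} p I J \<alpha>" "\<forall>v\<in>Tu m u. h v = horo p I J \<alpha> v"
      using horofunction_imp_horo[OF h] by blast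
    have "?D jrank p I J \<alpha>"
      using d(1) jordan_frame_if_complete_system[of p] by (auto simp: horo_data_def)
    moreover have "\<forall>v\<in>Tu m u. h v = ?f p I J \<alpha> v" using d(2) formula[OF d(1)] by simp
    ultimately show ?thesis by blast
  qed
  show ?thesis
  proof (intro conjI allI impI iffI)
    fix h assume "horofunction m u h"
    from ex[OF this] show "\<exists>n p I J \<alpha>. jordan_frame m u n p \<and>
               I \<subseteq> {..<n} \<and> J \<subseteq> {..<n} \<and> I \<inter> J = {} \<and> I \<noteq> {} \<and> J \<noteq> {} \<and>
               Min (\<alpha> ` I) = 0 \<and> Min (\<alpha> ` J) = 0 \<and> (\<forall>v\<in>Tu m u. h v = ?f p I J \<alpha> v)"
      by (simp only: conj_assoc)
  next
    fix h assume "\<exists>n p I J \<alpha>. jordan_frame m u n p \<and>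
               I \<subseteq> {..<n} \<and> J \<subseteq> {..<n} \<and> I \<inter> J = {} \<and> I \<noteq> {} \<and> J \<noteq> {} \<and>
               Min (\<alpha> ` I) = 0 \<and> Min (\<alpha> ` J) = 0 \<and> (\<forall>v\<in>Tu m u. h v = ?f p I J \<alpha> v)"
    then have "busemann_point m u h" by (elim exE conjE) (rule busemann, intro conjI)
    then show "horofunction m u h" by (simp add: busemann_point_def)
  next
    fix h assume "horofunction m u h"
    from ex[OF this] show "busemann_point m u h" by (elim exE conjE) (rule busemann, intro conjI)
  qed
qed

end
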